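(* Let $0<\varepsilon<1$ and consider an energy harvesting discrete memoryless channel (EH-DMC) with harvest-use-store architecture, channel $W$, energy function $\Lambda$, and i.i.d. non-negative energy process $\{E_i\}$ with $\mathbb{E}[E_1]>0$ and $\mathbb{E}[E_1^2]<\infty$. Let $M^*(n,\varepsilon)$ be the maximal number of messages of an EH-DMC code of blocklength $n$ with maximal probability of error at most $\varepsilon$. 1. (Achievable bound) Let $P_X\in\mathcal{F}_{\mathbb{E}[E_1]}$ be an input distribution. For every $0<\lambda<1$ and all sufficiently large $n$, $$\log M^*(n,\varepsilon)\ \ge\ nI(P_X;W)-\sqrt{n}\,K_{\varepsilon,\lambda}\,I(P_X;W)+\sqrt{nV(P_X;W)}\,\Phi^{-1}(\lambda\varepsilon)-\frac12\log n+O(1),$$ where $K_{\varepsilon,\lambda}=\dfrac{2\sqrt{\mathrm{Var}(\Delta_1)}}{\mathbb{E}[E_1]\sqrt{(1-\lambda)\varepsilon}}$ and $\Delta_1=E_1-\Lambda(X_1)$ with $X_1\sim P_X$ independent of $E_1$. 2. (Converse bound) For every $\eta>0$ there are real quantities $D_\varepsilon$, $K_\varepsilon$ and $V^*_\varepsilon(\eta)\ge 0$, functions of $\varepsilon$ (and, for the last one, of $\eta$) not depending on $n$, such that $$\log M^*(n,\varepsilon)\ \le\ nC_{ED}+\sqrt{n}\,C_D'(\mathbb{E}[E_1])\,D_\varepsilon+\sqrt{nV^*_\varepsilon(\eta)}\left(\Phi^{-1}(\varepsilon)+\frac{K_\varepsilon\,\varepsilon}{4}\right)+O(\log n),$$ where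 $C_D'$ is the derivative of the capacity-cost function $C_D(a)=\sup_{P\in\mathcal{F}_a}I(P;W)$ and $C_{ED}=C_D(\mathbb{E}[E_1])$.
   Context: DMC: finite input alphabet $\mathcal{X}$, finite output alphabet $\mathcal{Y}$, transition probabilities $W(y|x)$, used memorylessly and without feedback. $\mathcal{P}$ is the set of probability distributions on $\mathcal{X}$. For $P\in\mathcal{P}$ let $PW(y)=\sum_x P(x)W(y|x)$, $i_P(x,y)=\log\frac{W(y|x)}{PW(y)}$, $I(P;W)=\sum_{x,y}P(x)W(y|x)i_P(x,y)$ and $V(P;W)=\sum_{x,y}P(x)W(y|x)(i_P(x,y))^2-I(P;W)^2$. All logarithms have the same fixed base. The energy function $\Lambda:\mathcal{X}\to[0,\infty)$ gives the energy needed to send a symbol; there is a symbol $x_0\in\mathcal{X}$ with $\Lambda(x_0)=0$. For $a\ge0$, $\mathcal{F}_a=\{P\in\mathcal{P}:\mathbb{E}_P[\Lambda(X)]\le a\}$. Standing assumption: the DMC is not exotic. A DMC with capacity $C=\sup_P I(P;W)$ and (unique) capacity-achieving output distribution $Q_Y^*$ is called exotic if the maximum of $V(P;W)$ over capacity-achieving $P$ is $0$ and there is an input symbol $x'$ with $P(x')=0$ for every capacity-achieving $P$, $D(W(\cdot|x')\|Q_Y^* )=C$, and $V(W(\cdot|x')\|Q_Y^* )>0$, where $V(R\|Q)$ is the variance of $\log\frac{R(Y)}{Q(Y)}$ under $Y\sim R$. EH-DMC: the energies $E_1,E_2,\dots$ are i.i.d., non-negative, and independent of the message and channel noise; the energy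 buffer is infinite, without leakage, and initially empty. Harvest-use-store: in slot $i$ the energy $E_i$ is harvested first, may be used together with buffered energy to send the symbol of that slot, and the remainder is stored. A code with $M$ messages and blocklength $n$ consists of (i) an encoder assigning to each message $m\in\{1,\dots,M\}$ and energy vector $\mathbf{e}=(e_1,\dots,e_n)$ a codeword $(x_1,\dots,x_n)\in\mathcal{X}^n$, where $x_i$ depends only on $m$ and $(e_1,\dots,e_i)$, and $\sum_{i=1}^k\Lambda(x_i)\le\sum_{i=1}^k e_i$ for every $1\le k\le n$; and (ii) a (possibly randomized) decoder producing $\hat U\in\{1,\dots,M\}$ from the channel output $(Y_1,\dots,Y_n)$ only. With $U$ the transmitted message, the maximal probability of error is $\max_m\Pr[\hat U\ne m\mid U=m]$, the probability being over energies, channel and decoder. $\Phi$ is the standard normal cumulative distribution function. $O(\cdot)$ is as $n\to\infty$ with all other parameters fixed. *)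

theory Defs
  imports "HOL-Probability.Probability" "HOL-Library.Landau_Symbols"
begin

text \<open>
  A discrete memoryless channel is a function \<open>W :: 'x \<Rightarrow> 'y pmf\<close> between finite types, where
  \<open>pmf (W x) y\<close> is the transition probability from \<open>x\<close> to \<open>y\<close>. The output distribution of an input
  distribution \<open>P\<close> is \<open>bind_pmf P W\<close>. All logarithms have base \<open>b\<close>.
  Terms whose weight \<open>pmf P x * pmf (W x) y\<close> is zero do not contribute to the sums below, so
  the value of \<open>log b 0\<close> and of division by zero is immaterial.
\<close>

definition info_density ::
    "real \<Rightarrow> ('x::finite \<Rightarrow> 'y::finite pmf) \<Rightarrow> 'x pmf \<Rightarrow> 'x \<Rightarrow> 'y \<Rightarrow> real" where
  "info_density b W P x y = log b (pmf (W x) y / pmf (bind_pmf P W) y)"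

definition mutual_info ::
    "real \<Rightarrow> ('x::finite \<Rightarrow> 'y::finite pmf) \<Rightarrow> 'x pmf \<Rightarrow> real" where
  "mutual_info b W P =
     (\<Sum>x\<in>UNIV. \<Sum>y\<in>UNIV. pmf P x * pmf (W x) y * info_density b W P x y)"

definition info_variance ::
    "real \<Rightarrow> ('x::finite \<Rightarrow> 'y::finite pmf) \<Rightarrow> 'x pmf \<Rightarrow> real" where
  "info_variance b W P =
     (\<Sum>x\<in>UNIV. \<Sum>y\<in>UNIV. pmf P x * pmf (W x) y * (info_density b W P x y)\<^sup>2)
       - (mutual_info b W P)\<^sup>2"

definition capacity :: "real \<Rightarrow> ('x::finite \<Rightarrow> 'y::finite pmf) \<Rightarrow> real" where
  "capacity b W = (SUP P. mutual_info b W P)"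

definition feasible_inputs :: "('x::finite \<Rightarrow> real) \<Rightarrow> real \<Rightarrow> 'x pmf set" where
  "feasible_inputs \<Lambda> a = {P. measure_pmf.expectation P \<Lambda> \<le> a}"

definition capacity_cost ::
    "real \<Rightarrow> ('x::finite \<Rightarrow> 'y::finite pmf) \<Rightarrow> ('x \<Rightarrow> real) \<Rightarrow> real \<Rightarrow> real" where
  "capacity_cost b W \<Lambda> a = (SUP P\<in>feasible_inputs \<Lambda> a. mutual_info b W P)"


subsection \<open>Exotic channels\<close>

definition capacity_achieving :: "real \<Rightarrow> ('x::finite \<Rightarrow> 'y::finite pmf) \<Rightarrow> 'x pmf set" where
  "capacity_achieving b W = {P. mutual_info b W P = capacity b W}"

definition optimal_output :: "real \<Rightarrow> ('x::finite \<Rightarrow> 'y::finite pmf) \<Rightarrow> 'y pmf" where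
  "optimal_output b W = (THE Q. \<exists>P\<in>capacity_achieving b W. Q = bind_pmf P W)"

definition divergence :: "real \<Rightarrow> 'y::finite pmf \<Rightarrow> 'y pmf \<Rightarrow> ereal" where
  "divergence b R Q =
     (if set_pmf R \<subseteq> set_pmf Q
      then ereal (\<Sum>y\<in>UNIV. pmf R y * log b (pmf R y / pmf Q y))
      else \<infinity>)"

definition divergence_variance :: "real \<Rightarrow> 'y::finite pmf \<Rightarrow> 'y pmf \<Rightarrow> real" where
  "divergence_variance b R Q = measure_pmf.variance R (\<lambda>y. log b (pmf R y / pmf Q y))"

definition exotic :: "real \<Rightarrow> ('x::finite \<Rightarrow> 'y::finite pmf) \<Rightarrow> bool" where
  "exotic b W \<longleftrightarrow>
     (SUP P\<in>capacity_achieving b W. info_variance b W P) = 0 \<and>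
     (\<exists>x'. (\<forall>P\<in>capacity_achieving b W. pmf P x' = 0) \<and>
           divergence b (W x') (optimal_output b W) = ereal (capacity b W) \<and>
           divergence_variance b (W x') (optimal_output b W) > 0)"


subsection \<open>Energy harvesting codes\<close>

text \<open>
  Time slots are numbered \<open>1, \<dots>, n\<close>, and vectors of length \<open>n\<close> are functions on \<open>{1..n}\<close>.
  Encoders are measurable, so that error probabilities are defined. They are total in the energy
  vector; only their values at non-negative energy vectors matter, and the energy constraint is
  imposed only there.
\<close>

definition eh_encoder ::
    "('x::finite \<Rightarrow> real) \<Rightarrow> nat \<Rightarrow> nat \<Rightarrow> (nat \<Rightarrow> (nat \<Rightarrow> real) \<Rightarrow> nat \<Rightarrow> 'x) \<Rightarrow> bool" where
  "eh_encoder \<Lambda> n M f \<longleftrightarrow> (\<forall>m\<in>{1..M}.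
     (\<forall>i\<in>{1..n}. (\<lambda>e. f m e i) \<in> measurable (PiM {1..n} (\<lambda>_. borel)) (count_space UNIV)) \<and>
     (\<forall>i\<in>{1..n}. \<forall>e e'. (\<forall>j\<in>{1..i}. e j = e' j) \<longrightarrow> f m e i = f m e' i) \<and>
     (\<forall>e. (\<forall>i\<in>{1..n}. 0 \<le> e i) \<longrightarrow>
          (\<forall>k\<in>{1..n}. (\<Sum>i=1..k. \<Lambda> (f m e i)) \<le> (\<Sum>i=1..k. e i))))"

definition decoder :: "nat \<Rightarrow> ((nat \<Rightarrow> 'y) \<Rightarrow> nat pmf) \<Rightarrow> bool" where
  "decoder M g \<longleftrightarrow> (\<forall>y. set_pmf (g y) \<subseteq> {1..M})"

definition channel_output ::
    "('x::finite \<Rightarrow> 'y::finite pmf) \<Rightarrow> nat \<Rightarrow> (nat \<Rightarrow> 'x) \<Rightarrow> (nat \<Rightarrow> 'y) pmf" where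
  "channel_output W n x = Pi_pmf {1..n} undefined (\<lambda>i. W (x i))"

text \<open>
  The probability space \<open>\<Omega>\<close> carries the energies \<open>E\<close> only. Channel and decoder randomness enter
  through the conditional law of the decoded message given the energies, which expresses that
  the energies are independent of the message and of the channel noise.
\<close>

definition error_prob ::
    "'w measure \<Rightarrow> (nat \<Rightarrow> 'w \<Rightarrow> real) \<Rightarrow> ('x::finite \<Rightarrow> 'y::finite pmf) \<Rightarrow> nat \<Rightarrow>
     (nat \<Rightarrow> (nat \<Rightarrow> real) \<Rightarrow> nat \<Rightarrow> 'x) \<Rightarrow> ((nat \<Rightarrow> 'y) \<Rightarrow> nat pmf) \<Rightarrow> nat \<Rightarrow> real" where
  "error_prob \<Omega> E W n f g m =
     (\<integral>\<omega>. measure_pmf.prob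
             (bind_pmf (channel_output W n (f m (\<lambda>i\<in>{1..n}. E i \<omega>))) g) {u. u \<noteq> m} \<partial>\<Omega>)"

definition eh_code ::
    "'w measure \<Rightarrow> (nat \<Rightarrow> 'w \<Rightarrow> real) \<Rightarrow> ('x::finite \<Rightarrow> 'y::finite pmf) \<Rightarrow> ('x \<Rightarrow> real) \<Rightarrow>
     nat \<Rightarrow> real \<Rightarrow> nat \<Rightarrow> bool" where
  "eh_code \<Omega> E W \<Lambda> n \<epsilon> M \<longleftrightarrow>
     (\<exists>f g. eh_encoder \<Lambda> n M f \<and> decoder M g \<and>
            (MAX m\<in>{1..M}. error_prob \<Omega> E W n f g m) \<le> \<epsilon>)"

text \<open>
  A decoder exists only for \<open>M \<ge> 1\<close>, and for \<open>\<epsilon> < 1\<close> the number of messages is bounded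
  by \<open>CARD('y) ^ n / (1 - \<epsilon>)\<close>, so the maximum is over a finite set.
\<close>

definition max_messages ::
    "'w measure \<Rightarrow> (nat \<Rightarrow> 'w \<Rightarrow> real) \<Rightarrow> ('x::finite \<Rightarrow> 'y::finite pmf) \<Rightarrow> ('x \<Rightarrow> real) \<Rightarrow>
     nat \<Rightarrow> real \<Rightarrow> nat" where
  "max_messages \<Omega> E W \<Lambda> n \<epsilon> = Max {M. eh_code \<Omega> E W \<Lambda> n \<epsilon> M}"


subsection \<open>Quantities in the bounds\<close>

definition Phi :: "real \<Rightarrow> real" where
  "Phi = cdf std_normal_distribution"

definition Phi_inv :: "real \<Rightarrow> real" where
  "Phi_inv = inv Phi"

text \<open>The product measure makes \<open>X \<sim> P\<close> independent of the energy \<open>E\<^sub>1\<close>.\<close>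

definition delta_variance ::
    "'w measure \<Rightarrow> ('w \<Rightarrow> real) \<Rightarrow> ('x::finite \<Rightarrow> real) \<Rightarrow> 'x pmf \<Rightarrow> real" where
  "delta_variance \<Omega> E\<^sub>1 \<Lambda> P =
     prob_space.variance (\<Omega> \<Otimes>\<^sub>M measure_pmf P) (\<lambda>(\<omega>, x). E\<^sub>1 \<omega> - \<Lambda> x)"

definition saving_const ::
    "'w measure \<Rightarrow> ('w \<Rightarrow> real) \<Rightarrow> ('x::finite \<Rightarrow> real) \<Rightarrow> 'x pmf \<Rightarrow> real \<Rightarrow> real \<Rightarrow> real" where
  "saving_const \<Omega> E\<^sub>1 \<Lambda> P \<epsilon> l =
     2 * sqrt (delta_variance \<Omega> E\<^sub>1 \<Lambda> P) /
       (prob_space.expectation \<Omega> E\<^sub>1 * sqrt ((1 - l) * \<epsilon>))"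

end

theory Submission
  imports Defs
begin

text \<open>
  Achievability: the first \<open>N \<approx> \<kappa> \<surd>n\<close> slots send the free symbol and only collect energy. By Kolmogorov's
  maximal inequality the energy saved covers the later fluctuations of consumption minus harvest
  except with probability about \<open>(1 - l) \<epsilon> / 4\<close>, because the factor 2 in the saving constant doubles
  the threshold that would give \<open>(1 - l) \<epsilon>\<close>. The remaining constant slack in the error
  probability makes the central limit theorem sufficient (no Berry-Esseen bound is needed), and
  Feinstein's greedy construction, with the outage probability added to the decoding error, yields
  a code with small maximal error.

  Converse: \<open>D\<close>, \<open>K\<close> and \<open>V\<close> are free, so it suffices to bound \<open>log M\<close> by
  \<open>n C\<^sub>E\<^sub>D + O(\<surd>n)\<close>. A supergradient \<open>\<mu>\<close> of the capacity-cost function at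
  \<open>a = \<bbbE>[E\<^sub>1]\<close> gives an output distribution \<open>Q\<close> with
  \<open>D(W\<^sub>x || Q) \<le> C\<^sub>E\<^sub>D + \<mu> (\<Lambda> x - a)\<close> for every symbol \<open>x\<close>. Since the harvested energy exceeds its
  mean by only \<open>O(\<surd>n)\<close> with high probability, Chebyshev's inequality for the likelihood ratio
  between channel output and \<open>Q\<^sup>n\<close> bounds the success probability of every code.
\<close>

text \<open>\<open>max_messages\<close> is a \<open>Max\<close>, so even the lower bound presupposes
  that the admissible code sizes form a finite set; the converse supplies this and therefore comes
  first. In the achievability part codewords must be fixed without knowing the energies. The energy
  constraint thus becomes a penalty attached to each codeword, its outage probability, whose average
  over random codewords is computed on the product of the energy space and the codeword law; there
  the padded net consumptions are centred and independent. The budget (1 - l) \<epsilon> is spent in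
  ninths: one on a poor harvest in the silent phase, four on the later drift, one on the normal
  approximation, and three stay as the slack that determines the code size. Relying on three
  quarters of the mean energy of the silent phase scales the factor 2 down to 3/2, which is where
  4/9 instead of 1/4 comes from. The converse presupposes neither differentiability of the
  capacity-cost function nor an optimal input: concavity provides a slope, and the output law is a
  limit of outputs of nearly optimal inputs.\<close>

section \<open>Kolmogorov's maximal inequality\<close>

text \<open>
  The partial sums, frozen once they reach \<open>t\<close>. Their increments are still orthogonal, so their second
  moment is at most that of the full sum, and reaching \<open>t\<close> at any time is visible at time \<open>n\<close>.
\<close>

primrec stopped_sum :: "real \<Rightarrow> (nat \<Rightarrow> real) \<Rightarrow> nat \<Rightarrow> real" where
  "stopped_sum t x 0 = 0"
| "stopped_sum t x (Suc k) =
     stopped_sum t x k + (if stopped_sum t x k < t then x (Suc k) else 0)"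

lemma stopped_sum_cong:
  "(\<And>i. i \<in> {1..k} \<Longrightarrow> x i = y i) \<Longrightarrow> stopped_sum t x k = stopped_sum t y k"
  by (induction k) auto

lemma stopped_sum_measurable:
  "k \<le> n \<Longrightarrow> (\<lambda>x. stopped_sum t x k) \<in> borel_measurable (PiM {1..n} (\<lambda>_. borel))"
proof (induction k)
  case (Suc k)
  then have [measurable]: "(\<lambda>x. stopped_sum t x k) \<in> borel_measurable (PiM {1..n} (\<lambda>_. borel))"
    "(\<lambda>x. x (Suc k)) \<in> borel_measurable (PiM {1..n} (\<lambda>_. borel :: real measure))"
    by auto
  show ?case unfolding stopped_sum.simps by measurable
qed simp

lemma stopped_sum_ge:
  assumes "1 \<le> k" "k \<le> n" "t \<le> (\<Sum>i=1..k. x i)" "0 < t"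
  shows "t \<le> stopped_sum t x n"
proof (rule ccontr)
  assume c: "\<not> t \<le> stopped_sum t x n"
  have mono: "t \<le> stopped_sum t x j" if "t \<le> stopped_sum t x i" "i \<le> j" for i j
    using that(2,1) by (induction rule: dec_induct) auto
  have below: "stopped_sum t x j < t" if "j \<le> n" for j
    using mono[OF _ that] c by force
  have "stopped_sum t x j = (\<Sum>i=1..j. x i)" if "j \<le> n" for j
    using that
  proof (induction j)
    case (Suc j)
    then show ?case using below[of j] by simp
  qed simp
  then show False
    using below[OF assms(2)] assms by auto
qed

context prob_space
begin

lemma stopped_sum_second_moment:
  fixes X :: "nat \<Rightarrow> 'a \<Rightarrow> real"
  assumes indep: "indep_vars (\<lambda>_. borel) X {1..n}"
    and sq: "\<And>i. i \<in> {1..n} \<Longrightarrow> integrable M (\<lambda>\<omega>. (X i \<omega>)\<^sup>2)"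
    and mean: "\<And>i. i \<in> {1..n} \<Longrightarrow> expectation (X i) = 0"
  shows "k \<le> n \<Longrightarrow> integrable M (\<lambda>\<omega>. (stopped_sum t (\<lambda>i. X i \<omega>) k)\<^sup>2) \<and>
     expectation (\<lambda>\<omega>. (stopped_sum t (\<lambda>i. X i \<omega>) k)\<^sup>2) \<le> (\<Sum>i=1..k. expectation (\<lambda>\<omega>. (X i \<omega>)\<^sup>2))"
proof (induction k)
  case 0
  show ?case by simp
next
  case (Suc k)
  define T where "T = (\<lambda>\<omega>. stopped_sum t (\<lambda>i. X i \<omega>) k)"
  define h where "h = (\<lambda>\<omega>. if T \<omega> < t then T \<omega> else 0)"
  have rv [measurable]: "X i \<in> borel_measurable M" if "i \<in> {1..n}" for i
    using indep that by (auto simp: indep_vars_def)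
  have T_restrict: "T \<omega> = stopped_sum t (\<lambda>i\<in>{1..k}. X i \<omega>) k" for \<omega>
    unfolding T_def by (rule stopped_sum_cong) auto
  have T_meas [measurable]: "T \<in> borel_measurable M"
  proof -
    have "(\<lambda>\<omega>. \<lambda>i\<in>{1..k}. X i \<omega>) \<in> measurable M (PiM {1..k} (\<lambda>_. borel))"
      using Suc.prems by (intro measurable_restrict rv) auto
    from measurable_compose[OF this stopped_sum_measurable[of k k t]] show ?thesis
      by (simp add: T_restrict[abs_def])
  qed
  have Xk [measurable]: "X (Suc k) \<in> borel_measurable M"
    using Suc.prems by auto
  have sqT: "integrable M (\<lambda>\<omega>. (T \<omega>)\<^sup>2)"
    and bT: "expectation (\<lambda>\<omega>. (T \<omega>)\<^sup>2) \<le> (\<Sum>i=1..k. expectation (\<lambda>\<omega>. (X i \<omega>)\<^sup>2))"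
    using Suc by (auto simp: T_def)
  have sqX: "integrable M (\<lambda>\<omega>. (X (Suc k) \<omega>)\<^sup>2)" using Suc.prems by (intro sq) auto
  have inth: "integrable M h"
    by (rule Bochner_Integration.integrable_bound[OF square_integrable_imp_integrable[OF T_meas sqT]])
       (auto simp: h_def)
  have intX: "integrable M (X (Suc k))"
    by (rule square_integrable_imp_integrable[OF Xk sqX])
  have "indep_var (PiM {1..k} (\<lambda>_. borel)) (\<lambda>\<omega>. \<lambda>i\<in>{1..k}. X i \<omega>)
                  (PiM {Suc k} (\<lambda>_. borel)) (\<lambda>\<omega>. \<lambda>i\<in>{Suc k}. X i \<omega>)"
    by (rule indep_var_restrict[OF indep]) (use Suc.prems in auto)
  note indep_var_compose[OF this, of "\<lambda>x. if stopped_sum t x k < t then stopped_sum t x k else 0" borel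
       "\<lambda>x. x (Suc k)" borel]
  moreover have "(\<lambda>x. if stopped_sum t x k < t then stopped_sum t x k else 0)
      \<in> borel_measurable (PiM {1..k} (\<lambda>_. borel))"
    using stopped_sum_measurable[of k k t] by measurable
  moreover have "h = (\<lambda>\<omega>. if stopped_sum t (\<lambda>i\<in>{1..k}. X i \<omega>) k < t
      then stopped_sum t (\<lambda>i\<in>{1..k}. X i \<omega>) k else 0)"
    by (simp only: h_def T_restrict)
  ultimately have ind: "indep_var borel h borel (X (Suc k))"
    by (simp add: o_def cong: if_cong)
  have prod: "expectation (\<lambda>\<omega>. h \<omega> * X (Suc k) \<omega>) = 0" "integrable M (\<lambda>\<omega>. h \<omega> * X (Suc k) \<omega>)"
    using indep_var_lebesgue_integral[OF ind inth intX] indep_var_integrable[OF ind inth intX]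
      mean[of "Suc k"] Suc.prems by auto
  define g where "g = (\<lambda>\<omega>. (if T \<omega> < t then X (Suc k) \<omega> else 0)\<^sup>2)"
  have intg: "integrable M g"
    by (rule Bochner_Integration.integrable_bound[OF sqX]) (auto simp: g_def)
  have gle: "expectation g \<le> expectation (\<lambda>\<omega>. (X (Suc k) \<omega>)\<^sup>2)"
    by (rule integral_mono[OF intg sqX]) (auto simp: g_def)
  have eq: "(\<lambda>\<omega>. (stopped_sum t (\<lambda>i. X i \<omega>) (Suc k))\<^sup>2) =
     (\<lambda>\<omega>. (T \<omega>)\<^sup>2 + (2 * (h \<omega> * X (Suc k) \<omega>) + g \<omega>))"
    by (auto simp: fun_eq_iff T_def h_def g_def power2_eq_square algebra_simps)
  show ?case
    unfolding eq using sqT bT prod intg gle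
    by simp
qed

text \<open>Markov's inequality for the squared frozen sum at time \<open>n\<close>. It serves three
  purposes: the energy process, the net consumption of a random codeword, and, used at
  \<open>k = n\<close> only, Chebyshev's inequality for log-likelihood ratios.\<close>

lemma kolmogorov_maximal_inequality:
  fixes X :: "nat \<Rightarrow> 'a \<Rightarrow> real"
  assumes indep: "indep_vars (\<lambda>_. borel) X {1..n}"
    and sq: "\<And>i. i \<in> {1..n} \<Longrightarrow> integrable M (\<lambda>\<omega>. (X i \<omega>)\<^sup>2)"
    and mean: "\<And>i. i \<in> {1..n} \<Longrightarrow> expectation (X i) = 0"
    and t: "0 < t"
  shows "prob {\<omega>\<in>space M. \<exists>k\<in>{1..n}. t \<le> (\<Sum>i=1..k. X i \<omega>)}
           \<le> (\<Sum>i=1..n. expectation (\<lambda>\<omega>. (X i \<omega>)\<^sup>2)) / t\<^sup>2"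
proof -
  define T where "T = (\<lambda>\<omega>. stopped_sum t (\<lambda>i. X i \<omega>) n)"
  have rv [measurable]: "X i \<in> borel_measurable M" if "i \<in> {1..n}" for i
    using indep that by (auto simp: indep_vars_def)
  have int: "integrable M (\<lambda>\<omega>. (T \<omega>)\<^sup>2)"
    and le: "expectation (\<lambda>\<omega>. (T \<omega>)\<^sup>2) \<le> (\<Sum>i=1..n. expectation (\<lambda>\<omega>. (X i \<omega>)\<^sup>2))"
    using stopped_sum_second_moment[OF indep sq mean, of n t] by (auto simp: T_def)
  have "prob {\<omega>\<in>space M. \<exists>k\<in>{1..n}. t \<le> (\<Sum>i=1..k. X i \<omega>)} \<le> prob {\<omega>\<in>space M. t\<^sup>2 \<le> (T \<omega>)\<^sup>2}"
  proof (rule finite_measure_mono)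
    show "{\<omega>\<in>space M. \<exists>k\<in>{1..n}. t \<le> (\<Sum>i=1..k. X i \<omega>)} \<subseteq> {\<omega>\<in>space M. t\<^sup>2 \<le> (T \<omega>)\<^sup>2}"
      using stopped_sum_ge[where t=t and n=n] t by (auto simp: T_def intro!: power_mono)
    show "{\<omega>\<in>space M. t\<^sup>2 \<le> (T \<omega>)\<^sup>2} \<in> events"
      using borel_measurable_integrable[OF int] by measurable
  qed
  also have "\<dots> \<le> expectation (\<lambda>\<omega>. (T \<omega>)\<^sup>2) / t\<^sup>2"
    by (rule integral_Markov_inequality_measure[OF int, where A="{}"]) (use t in auto)
  also have "\<dots> \<le> (\<Sum>i=1..n. expectation (\<lambda>\<omega>. (X i \<omega>)\<^sup>2)) / t\<^sup>2"
    using le by (simp add: divide_right_mono)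
  finally show ?thesis .
qed

end

section \<open>Feinstein's construction and best-effort encoders\<close>

lemma prob_bind_pmf:
  assumes "finite (set_pmf p)"
  shows "measure_pmf.prob (bind_pmf p K) U = measure_pmf.expectation p (\<lambda>x. measure_pmf.prob (K x) U)"
proof -
  have "ennreal (measure_pmf.prob (bind_pmf p K) U) = (\<integral>\<^sup>+x. ennreal (measure_pmf.prob (K x) U) \<partial>measure_pmf p)"
    by (simp flip: measure_pmf.emeasure_eq_measure add: emeasure_bind_pmf)
  also have "\<dots> = ennreal (measure_pmf.expectation p (\<lambda>x. measure_pmf.prob (K x) U))"
    by (rule nn_integral_eq_integral) (auto intro: integrable_measure_pmf_finite assms)
  finally show ?thesis
    by (subst (asm) ennreal_inj) (auto intro!: integral_nonneg_AE)
qed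

text \<open>Summing \<open>pmf q y < pmf p y / \<gamma>\<close> over \<open>D\<close>. In the greedy
  construction this limits how much output mass a single decoding set can occupy.\<close>

lemma prob_likelier_set_le:
  assumes fin: "finite (set_pmf p)" and g: "0 < \<gamma>"
    and D: "D \<subseteq> {y. \<gamma> * pmf q y < pmf p y}"
  shows "measure_pmf.prob q D \<le> 1 / \<gamma>"
proof -
  have "D \<subseteq> set_pmf p"
  proof
    fix y assume "y \<in> D"
    with D have "\<gamma> * pmf q y < pmf p y" by auto
    moreover have "0 \<le> \<gamma> * pmf q y" using g by simp
    ultimately show "y \<in> set_pmf p" by (simp add: set_pmf_iff)
  qed
  then have "finite D" using fin finite_subset by blast
  then have "\<gamma> * measure_pmf.prob q D = (\<Sum>y\<in>D. \<gamma> * pmf q y)"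
    by (simp add: measure_measure_pmf_finite sum_distrib_left)
  also have "\<dots> \<le> (\<Sum>y\<in>D. pmf p y)"
    using D by (intro sum_mono) auto
  also have "\<dots> \<le> 1"
    using \<open>finite D\<close> by (simp flip: measure_measure_pmf_finite)
  finally show ?thesis using g by (simp add: field_simps)
qed

text \<open>Greedy choice: if no input could serve as the next codeword on the unclaimed part of its
  set \<open>B x\<close>, averaging this failure over \<open>p\<close> would give \<epsilon> \<le>
  \<alpha> + M / \<gamma>, because the claimed sets have output probability at most M / \<gamma>.
  The inclusion in \<open>B\<close> is carried along for that estimate. The penalty
  \<open>out\<close> is arbitrary here and becomes the outage probability.\<close>

lemma feinstein:
  fixes p :: "'a pmf" and K :: "'a \<Rightarrow> 'c pmf" and out :: "'a \<Rightarrow> real" and \<gamma> :: real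
  defines "B \<equiv> \<lambda>x. {y. \<gamma> * pmf (bind_pmf p K) y < pmf (K x) y}"
  assumes fin: "finite (set_pmf p)" "\<And>x. finite (set_pmf (K x))" and g: "0 < \<gamma>"
    and \<alpha>: "measure_pmf.expectation p (\<lambda>x. out x + measure_pmf.prob (K x) (- B x)) \<le> \<alpha>"
  shows "real M \<le> \<gamma> * (\<epsilon> - \<alpha>) \<Longrightarrow> \<exists>c D. disjoint_family_on D {1..M} \<and>
    (\<forall>m\<in>{1..M}. D m \<subseteq> B (c m) \<and> out (c m) + measure_pmf.prob (K (c m)) (- D m) \<le> \<epsilon>)"
proof (induction M)
  case 0
  show ?case by (auto simp: disjoint_family_on_def)
next
  case (Suc M)
  let ?Q = "bind_pmf p K"
  obtain c D where disj: "disjoint_family_on D {1..M}"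
    and cD: "\<And>m. m \<in> {1..M} \<Longrightarrow> D m \<subseteq> B (c m)"
      "\<And>m. m \<in> {1..M} \<Longrightarrow> out (c m) + measure_pmf.prob (K (c m)) (- D m) \<le> \<epsilon>"
  proof -
    have "real M \<le> \<gamma> * (\<epsilon> - \<alpha>)" using Suc.prems by simp
    from Suc.IH[OF this] show ?thesis using that by blast
  qed
  define U where "U = (\<Union>m\<in>{1..M}. D m)"
  have "measure_pmf.prob ?Q U \<le> (\<Sum>m\<in>{1..M}. measure_pmf.prob ?Q (D m))"
    unfolding U_def by (rule measure_pmf.finite_measure_subadditive_finite) auto
  also have "\<dots> \<le> (\<Sum>m\<in>{1..M}. 1 / \<gamma>)"
    using cD(1) by (intro sum_mono prob_likelier_set_le[OF fin(2) g]) (auto simp: B_def)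
  finally have QU: "measure_pmf.prob ?Q U \<le> M / \<gamma>" by simp
  have "\<exists>x. out x + measure_pmf.prob (K x) (- (B x - U)) \<le> \<epsilon>"
  proof (rule ccontr)
    assume "\<not> ?thesis"
    then have less: "\<epsilon> < out x + measure_pmf.prob (K x) (- (B x - U))" for x by (meson not_le)
    have "\<epsilon> \<le> measure_pmf.expectation p (\<lambda>x. out x + measure_pmf.prob (K x) (- (B x - U)))"
      using integral_mono[of "measure_pmf p" "\<lambda>_. \<epsilon>" "\<lambda>x. out x + measure_pmf.prob (K x) (- (B x - U))"] less
      by (auto intro: integrable_measure_pmf_finite fin less_imp_le)
    also have "\<dots> \<le> measure_pmf.expectation p
        (\<lambda>x. (out x + measure_pmf.prob (K x) (- B x)) + measure_pmf.prob (K x) U)"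
    proof (rule integral_mono)
      fix x
      have "measure_pmf.prob (K x) (- (B x - U)) \<le> measure_pmf.prob (K x) (- B x \<union> U)"
        by (rule measure_pmf.finite_measure_mono) auto
      also have "\<dots> \<le> measure_pmf.prob (K x) (- B x) + measure_pmf.prob (K x) U"
        by (rule measure_Un_le) auto
      finally show "out x + measure_pmf.prob (K x) (- (B x - U))
          \<le> (out x + measure_pmf.prob (K x) (- B x)) + measure_pmf.prob (K x) U" by simp
    qed (auto intro: integrable_measure_pmf_finite fin)
    also have "\<dots> = measure_pmf.expectation p (\<lambda>x. out x + measure_pmf.prob (K x) (- B x))
        + measure_pmf.prob ?Q U"
      unfolding prob_bind_pmf[OF fin(1)]
      by (rule Bochner_Integration.integral_add) (auto intro: integrable_measure_pmf_finite fin)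
    also have "\<dots> \<le> \<alpha> + M / \<gamma>" using \<alpha> QU by simp
    finally show False using Suc.prems g by (simp add: field_simps)
  qed
  then obtain x where x: "out x + measure_pmf.prob (K x) (- (B x - U)) \<le> \<epsilon>" by blast
  show ?case
  proof (intro exI[of _ "c(Suc M := x)"] exI[of _ "D(Suc M := B x - U)"] conjI ballI)
    show "disjoint_family_on (D(Suc M := B x - U)) {1..Suc M}"
      unfolding disjoint_family_on_def
    proof (intro ballI impI)
      fix m k assume "m \<in> {1..Suc M}" "k \<in> {1..Suc M}" "m \<noteq> k"
      then consider "m = Suc M" "k \<in> {1..M}" "k \<noteq> Suc M" | "k = Suc M" "m \<in> {1..M}" "m \<noteq> Suc M"
        | "m \<in> {1..M}" "k \<in> {1..M}" "m \<noteq> Suc M" "k \<noteq> Suc M"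
        by force
      then show "(D(Suc M := B x - U)) m \<inter> (D(Suc M := B x - U)) k = {}"
      proof cases
        case 1 then show ?thesis by (auto simp: U_def)
      next
        case 2 then show ?thesis by (auto simp: U_def)
      next
        case 3 then show ?thesis using disj \<open>m \<noteq> k\<close> by (simp add: disjoint_family_on_def)
      qed
    qed
  next
    fix m assume "m \<in> {1..Suc M}"
    then consider "m = Suc M" | "m \<in> {1..M}" "m \<noteq> Suc M" by force
    then show "(D(Suc M := B x - U)) m \<subseteq> B ((c(Suc M := x)) m)"
      "out ((c(Suc M := x)) m) + measure_pmf.prob (K ((c(Suc M := x)) m)) (- (D(Suc M := B x - U)) m) \<le> \<epsilon>"
      by (cases; use cD x in simp)+
  qed
qed

section \<open>Energy outage, and codes from disjoint decoding sets\<close>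

definition outage_prob ::
  "'w measure \<Rightarrow> (nat \<Rightarrow> 'w \<Rightarrow> real) \<Rightarrow> ('x \<Rightarrow> real) \<Rightarrow> nat \<Rightarrow> (nat \<Rightarrow> 'x) \<Rightarrow> real" where
  "outage_prob \<Omega> E \<Lambda> n x =
     measure \<Omega> {\<omega>\<in>space \<Omega>. \<exists>k\<in>{1..n}. (\<Sum>i=1..k. E i \<omega>) < (\<Sum>i=1..k. \<Lambda> (x i))}"

text \<open>
  Falling silent for good at the first violation keeps the encoder feasible for every energy vector.
\<close>

definition best_effort ::
  "('x \<Rightarrow> real) \<Rightarrow> 'x \<Rightarrow> (nat \<Rightarrow> nat \<Rightarrow> 'x) \<Rightarrow> nat \<Rightarrow> (nat \<Rightarrow> real) \<Rightarrow> nat \<Rightarrow> 'x" where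
  "best_effort \<Lambda> x\<^sub>0 c m e i =
     (if \<forall>k\<in>{1..i}. (\<Sum>j=1..k. \<Lambda> (c m j)) \<le> (\<Sum>j=1..k. e j) then c m i else x\<^sub>0)"

lemma eh_encoder_best_effort:
  fixes \<Lambda> :: "'x::finite \<Rightarrow> real"
  assumes "\<Lambda> x\<^sub>0 = 0"
  shows "eh_encoder \<Lambda> n M (best_effort \<Lambda> x\<^sub>0 c)"
  unfolding eh_encoder_def
proof (intro ballI conjI allI impI)
  fix m i assume "i \<in> {1..n}"
  then have [measurable]: "(\<lambda>e. \<Sum>j=1..k. e j) \<in> borel_measurable (PiM {1..n} (\<lambda>_. borel :: real measure))"
    if "k \<in> {1..i}" for k
    using that by (intro borel_measurable_sum measurable_component_singleton) auto
  show "(\<lambda>e. best_effort \<Lambda> x\<^sub>0 c m e i) \<in> measurable (PiM {1..n} (\<lambda>_. borel)) (count_space UNIV)"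
    unfolding best_effort_def by (intro measurable_If measurable_const) measurable
next
  fix m i and e e' :: "nat \<Rightarrow> real" assume eq: "\<forall>j\<in>{1..i}. e j = e' j"
  then have "(\<Sum>j=1..k. e j) = (\<Sum>j=1..k. e' j)" if "k \<in> {1..i}" for k
    using that by (intro sum.cong) auto
  then show "best_effort \<Lambda> x\<^sub>0 c m e i = best_effort \<Lambda> x\<^sub>0 c m e' i"
    by (simp add: best_effort_def)
next
  fix m k and e :: "nat \<Rightarrow> real" assume e: "\<forall>i\<in>{1..n}. 0 \<le> e i" and "k \<in> {1..n}"
  then have "k \<le> n" by simp
  then show "(\<Sum>i=1..k. \<Lambda> (best_effort \<Lambda> x\<^sub>0 c m e i)) \<le> (\<Sum>i=1..k. e i)"
  proof (induction k)
    case (Suc k)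
    show ?case
    \<comment> \<open>Either the codeword has been affordable in every slot so far, and the sent
      prefix is its own, or slot \<open>Suc k\<close> is silent and the bound for \<open>k\<close>
      persists because energy only accumulates.\<close>
    proof (cases "\<forall>j\<in>{1..Suc k}. (\<Sum>i=1..j. \<Lambda> (c m i)) \<le> (\<Sum>i=1..j. e i)")
      case True
      then have "(\<Sum>i=1..Suc k. \<Lambda> (best_effort \<Lambda> x\<^sub>0 c m e i)) = (\<Sum>i=1..Suc k. \<Lambda> (c m i))"
        by (intro sum.cong) (auto simp: best_effort_def)
      then show ?thesis using bspec[OF True, of "Suc k"] by simp
    next
      case False
      then have "\<Lambda> (best_effort \<Lambda> x\<^sub>0 c m e (Suc k)) = 0" using assms by (simp only: best_effort_def if_False)
      moreover have "0 \<le> e (Suc k)" using e Suc.prems by auto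
      ultimately show ?thesis using Suc by simp
    qed
  qed simp
qed

text \<open>Outside the outage event the best-effort encoder sends the codeword unchanged, so the
  output has the law that belongs to the codeword, and a decoder that ignores the energies fails
  only off \<open>D m\<close>. A union bound adds the outage probability.\<close>

lemma eh_code_disjoint:
  fixes W :: "'x::finite \<Rightarrow> 'y::finite pmf"
  assumes "prob_space \<Omega>" and rv: "\<And>i. i \<in> {1..n} \<Longrightarrow> E i \<in> borel_measurable \<Omega>"
    and zero: "\<Lambda> x\<^sub>0 = 0" and M: "1 \<le> M" and disj: "disjoint_family_on D {1..M}"
    and err: "\<And>m. m \<in> {1..M} \<Longrightarrow>
      outage_prob \<Omega> E \<Lambda> n (c m) + measure_pmf.prob (channel_output W n (c m)) (- D m) \<le> \<epsilon>"
  shows "eh_code \<Omega> E W \<Lambda> n \<epsilon> M"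
proof -
  interpret prob_space \<Omega> by fact
  \<comment> \<open>Outputs in no decoding set are mapped to 1, a valid message since
    \<open>M\<close> is at least 1.\<close>
  define dec where "dec = (\<lambda>y. if \<exists>m\<in>{1..M}. y \<in> D m then SOME m. m \<in> {1..M} \<and> y \<in> D m else 1)"
  have dec_range: "dec y \<in> {1..M}" for y
  proof (cases "\<exists>m\<in>{1..M}. y \<in> D m")
    case True
    then have "\<exists>m. m \<in> {1..M} \<and> y \<in> D m" by auto
    from someI_ex[OF this] True show ?thesis by (auto simp: dec_def)
  qed (use M in \<open>auto simp: dec_def\<close>)
  have dec_eq: "dec y = m" if "m \<in> {1..M}" "y \<in> D m" for m y
  proof -
    have ex: "\<exists>m. m \<in> {1..M} \<and> y \<in> D m" using that by auto
    have "dec y \<in> {1..M} \<and> y \<in> D (dec y)"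
      using someI_ex[OF ex] ex by (auto simp: dec_def)
    then show ?thesis using disj that by (meson disjoint_family_onD disjoint_iff)
  qed
  let ?f = "best_effort \<Lambda> x\<^sub>0 c" and ?g = "\<lambda>y. return_pmf (dec y)"
  have "error_prob \<Omega> E W n ?f ?g m \<le> \<epsilon>" if m: "m \<in> {1..M}" for m
  proof -
    define bad where "bad = {\<omega>\<in>space \<Omega>. \<exists>k\<in>{1..n}. (\<Sum>i=1..k. E i \<omega>) < (\<Sum>i=1..k. \<Lambda> (c m i))}"
    have [measurable]: "bad \<in> events"
    proof -
      have [measurable]: "(\<lambda>\<omega>. \<Sum>i=1..k. E i \<omega>) \<in> borel_measurable \<Omega>" if "k \<in> {1..n}" for k
        using that by (intro borel_measurable_sum rv) auto
      show ?thesis unfolding bad_def by measurable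
    qed
    let ?r = "measure_pmf.prob (channel_output W n (c m)) (- D m)"
    have le: "measure_pmf.prob (bind_pmf (channel_output W n (?f m (\<lambda>i\<in>{1..n}. E i \<omega>))) ?g) {u. u \<noteq> m}
        \<le> indicator bad \<omega> + ?r" if \<omega>: "\<omega> \<in> space \<Omega>" for \<omega>
    proof (cases "\<omega> \<in> bad")
      case True
      then show ?thesis by (simp add: add_increasing2)
    next
      case False
      have "(\<Sum>j=1..k. \<Lambda> (c m j)) \<le> (\<Sum>j=1..k. (\<lambda>i\<in>{1..n}. E i \<omega>) j)" if k: "k \<in> {1..n}" for k
      proof -
        have "(\<Sum>j=1..k. (\<lambda>i\<in>{1..n}. E i \<omega>) j) = (\<Sum>j=1..k. E j \<omega>)"
          using k by (intro sum.cong) auto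
        then show ?thesis using False \<omega> k by (auto simp: bad_def not_less)
      qed
      then have "?f m (\<lambda>i\<in>{1..n}. E i \<omega>) i = c m i" if "i \<in> {1..n}" for i
        using that by (auto simp: best_effort_def)
      then have "channel_output W n (?f m (\<lambda>i\<in>{1..n}. E i \<omega>)) = channel_output W n (c m)"
        unfolding channel_output_def by (intro Pi_pmf_cong) auto
      moreover have "measure_pmf.prob (channel_output W n (c m)) (dec -` {u. u \<noteq> m}) \<le> ?r"
        using dec_eq[OF m] by (intro measure_pmf.finite_measure_mono) auto
      ultimately show ?thesis using False
        by (simp flip: map_pmf_def)
    qed
    have int1: "integrable \<Omega> (indicator bad :: _ \<Rightarrow> real)"
      by (intro integrable_real_indicator) (auto simp: less_top[symmetric])
    then have int: "integrable \<Omega> (\<lambda>\<omega>. indicator bad \<omega> + ?r :: real)"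
      by (intro Bochner_Integration.integrable_add) auto
    have "error_prob \<Omega> E W n ?f ?g m \<le> (\<integral>\<omega>. indicator bad \<omega> + ?r \<partial>\<Omega>)"
      unfolding error_prob_def by (rule integral_mono') (use le int in auto)
    also have "\<dots> = prob bad + ?r"
      by (subst Bochner_Integration.integral_add[OF int1]) (auto simp: prob_space)
    also have "\<dots> \<le> \<epsilon>" using err[OF m] by (simp add: outage_prob_def bad_def)
    finally show ?thesis .
  qed
  then have "(MAX m\<in>{1..M}. error_prob \<Omega> E W n ?f ?g m) \<le> \<epsilon>"
    using M by (subst Max_le_iff) auto
  moreover have "decoder M ?g" using dec_range by (auto simp: decoder_def)
  ultimately show ?thesis
    unfolding eh_code_def using eh_encoder_best_effort[of \<Lambda> x\<^sub>0 n M c, OF zero] by blast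
qed

section \<open>The capacity-cost function\<close>

text \<open>Relative entropy as a plain real number. Where \<open>Q\<close> vanishes and
  \<open>R\<close> does not, the summand is a meaningless default instead of infinity, so the lemmas
  below carry inclusions of supports.\<close>

definition kl :: "real \<Rightarrow> 'y::finite pmf \<Rightarrow> 'y pmf \<Rightarrow> real" where
  "kl b R Q = (\<Sum>y\<in>UNIV. pmf R y * log b (pmf R y / pmf Q y))"

definition mix_pmf :: "real \<Rightarrow> 'a pmf \<Rightarrow> 'a pmf \<Rightarrow> 'a pmf" where
  "mix_pmf t p q = bind_pmf (bernoulli_pmf t) (\<lambda>c. if c then q else p)"

lemma pmf_mix:
  "0 \<le> t \<Longrightarrow> t \<le> 1 \<Longrightarrow> pmf (mix_pmf t p q) x = (1 - t) * pmf p x + t * pmf q x"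
  by (simp add: mix_pmf_def pmf_bind)

lemma bind_mix: "bind_pmf (mix_pmf t p q) W = mix_pmf t (bind_pmf p W) (bind_pmf q W)"
  by (auto simp: mix_pmf_def bind_assoc_pmf intro!: bind_pmf_cong)

lemma set_mix: "0 < t \<Longrightarrow> t < 1 \<Longrightarrow> set_pmf (mix_pmf t p q) = set_pmf p \<union> set_pmf q"
  by (auto simp: mix_pmf_def set_pmf_bernoulli split: if_splits)

lemma expectation_sum_UNIV:
  fixes f :: "'x::finite \<Rightarrow> real"
  shows "measure_pmf.expectation P f = (\<Sum>x\<in>UNIV. pmf P x * f x)"
  by (subst integral_measure_pmf[of UNIV]) auto

lemma pmf_bind_sum: "pmf (bind_pmf P W) y = (\<Sum>x\<in>UNIV. pmf (P :: 'x::finite pmf) x * pmf (W x) y)"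
  by (simp add: pmf_bind expectation_sum_UNIV)

lemma expectation_mix:
  fixes f :: "'x::finite \<Rightarrow> real"
  assumes "0 \<le> t" "t \<le> 1"
  shows "measure_pmf.expectation (mix_pmf t p q) f =
    (1 - t) * measure_pmf.expectation p f + t * measure_pmf.expectation q f"
  using assms by (simp add: expectation_sum_UNIV pmf_mix algebra_simps sum.distrib sum_distrib_left sum_subtractf)

text \<open>Gibbs' inequality, term by term from \<open>ln u \<le> u - 1\<close>; the lower bounds
  add up to 1 - 1 = 0.\<close>

lemma kl_nonneg:
  assumes b: "1 < b" and ac: "set_pmf R \<subseteq> set_pmf Q"
  shows "0 \<le> kl b R Q"
proof -
  have "(pmf R y - pmf Q y) / ln b \<le> pmf R y * log b (pmf R y / pmf Q y)" for y
  proof (cases "pmf R y = 0")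
    case True
    then show ?thesis using b by (simp add: divide_nonpos_pos)
  next
    case False
    then have r: "0 < pmf R y" by (simp add: pmf_pos)
    have q: "0 < pmf Q y" using ac False by (auto simp: set_pmf_iff pmf_pos)
    have "ln (pmf Q y / pmf R y) \<le> pmf Q y / pmf R y - 1" using r q by (intro ln_le_minus_one) auto
    then have "pmf R y * ln (pmf Q y / pmf R y) \<le> pmf Q y - pmf R y"
      using r mult_left_mono[of _ _ "pmf R y"] by (fastforce simp: algebra_simps)
    then have "pmf R y - pmf Q y \<le> pmf R y * ln (pmf R y / pmf Q y)"
      using r q by (simp add: ln_div algebra_simps)
    then show ?thesis using b by (simp add: log_def divide_right_mono)
  qed
  then have "(\<Sum>y\<in>UNIV. (pmf R y - pmf Q y) / ln b) \<le> kl b R Q"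
    unfolding kl_def by (rule sum_mono)
  moreover have "(\<Sum>y\<in>UNIV. pmf R y) = 1" "(\<Sum>y\<in>UNIV. pmf Q y) = 1"
    by (auto intro: sum_pmf_eq_1)
  ultimately show ?thesis by (simp flip: sum_divide_distrib add: sum_subtractf)
qed

lemma mutual_info_kl: "mutual_info b W P = (\<Sum>x\<in>UNIV. pmf P x * kl b (W x) (bind_pmf P W))"
  by (simp add: mutual_info_def info_density_def kl_def sum_distrib_left mult.assoc)

text \<open>The compensation identity: the logarithm of \<open>W x\<close> over \<open>Q\<close>
  splits at the true output law. With \<open>kl_nonneg\<close> it shows that mutual information
  never exceeds the average divergence to any \<open>Q\<close> of sufficient support.\<close>

lemma average_kl:
  assumes b: "1 < b" and ac: "set_pmf (bind_pmf P W) \<subseteq> set_pmf Q"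
  shows "(\<Sum>x\<in>UNIV. pmf P x * kl b (W x) Q) = mutual_info b W P + kl b (bind_pmf P W) Q"
proof -
  let ?R = "bind_pmf P W"
  have "kl b ?R Q = (\<Sum>y\<in>UNIV. \<Sum>x\<in>UNIV. pmf P x * pmf (W x) y * log b (pmf ?R y / pmf Q y))"
    unfolding kl_def by (simp add: pmf_bind_sum[of P W] sum_distrib_right)
  also have "\<dots> = (\<Sum>x\<in>UNIV. \<Sum>y\<in>UNIV. pmf P x * pmf (W x) y * log b (pmf ?R y / pmf Q y))"
    by (rule sum.swap)
  finally have "mutual_info b W P + kl b ?R Q = (\<Sum>x\<in>UNIV. \<Sum>y\<in>UNIV.
     pmf P x * pmf (W x) y * log b (pmf (W x) y / pmf ?R y)
     + pmf P x * pmf (W x) y * log b (pmf ?R y / pmf Q y))"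
    by (simp add: mutual_info_def info_density_def sum.distrib)
  also have "\<dots> = (\<Sum>x\<in>UNIV. \<Sum>y\<in>UNIV. pmf P x * (pmf (W x) y * log b (pmf (W x) y / pmf Q y)))"
  proof (intro sum.cong refl)
    fix x y
    show "pmf P x * pmf (W x) y * log b (pmf (W x) y / pmf ?R y)
      + pmf P x * pmf (W x) y * log b (pmf ?R y / pmf Q y)
      = pmf P x * (pmf (W x) y * log b (pmf (W x) y / pmf Q y))"
    proof (cases "pmf P x = 0 \<or> pmf (W x) y = 0")
      case False
      then have "y \<in> set_pmf ?R" by (auto simp: set_pmf_iff)
      then have "0 < pmf ?R y" "0 < pmf Q y" "0 < pmf (W x) y"
        using ac False by (auto simp: set_pmf_iff pmf_pos simp del: set_bind_pmf)
      then show ?thesis using b by (simp add: log_divide algebra_simps)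
    qed auto
  qed
  finally show ?thesis by (simp add: kl_def sum_distrib_left)
qed

text \<open>The mutual information of the mixture is an average divergence to the mixed output, and
  its \<open>P0\<close> part is at least the mutual information of \<open>P0\<close> by the
  compensation identity. The \<open>P1\<close> part stays a divergence on purpose: with
  \<open>P1\<close> a point mass it isolates a single symbol.\<close>

lemma mutual_info_mix_ge:
  assumes b: "1 < b" and t: "0 < t" "t < 1"
  shows "(1 - t) * mutual_info b W P0 + t * (\<Sum>x\<in>UNIV. pmf P1 x * kl b (W x) (bind_pmf (mix_pmf t P0 P1) W))
    \<le> mutual_info b W (mix_pmf t P0 P1)"
proof -
  let ?Q = "bind_pmf (mix_pmf t P0 P1) W"
  have ac: "set_pmf (bind_pmf P0 W) \<subseteq> set_pmf ?Q"
    using t by (auto simp: set_mix)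
  have "mutual_info b W P0 \<le> (\<Sum>x\<in>UNIV. pmf P0 x * kl b (W x) ?Q)"
    using average_kl[OF b ac] kl_nonneg[OF b ac] by simp
  then have "(1 - t) * mutual_info b W P0 \<le> (1 - t) * (\<Sum>x\<in>UNIV. pmf P0 x * kl b (W x) ?Q)"
    using t by simp
  then show ?thesis using t
    by (simp add: mutual_info_kl[of b W "mix_pmf t P0 P1"] pmf_mix algebra_simps sum.distrib
        sum_distrib_left sum_subtractf)
qed

lemma mutual_info_concave:
  assumes b: "1 < b" and t: "0 < t" "t < 1"
  shows "(1 - t) * mutual_info b W P0 + t * mutual_info b W P1 \<le> mutual_info b W (mix_pmf t P0 P1)"
proof -
  let ?Q = "bind_pmf (mix_pmf t P0 P1) W"
  have ac: "set_pmf (bind_pmf P1 W) \<subseteq> set_pmf ?Q"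
    using t by (auto simp: set_mix)
  have "t * mutual_info b W P1 \<le> t * (\<Sum>x\<in>UNIV. pmf P1 x * kl b (W x) ?Q)"
    using average_kl[OF b ac] kl_nonneg[OF b ac] t by simp
  with mutual_info_mix_ge[OF b t, of W P0 P1] show ?thesis by linarith
qed

text \<open>Comparison with the uniform output law, whose full support makes all divergences
  genuine. Boundedness is what gives the real suprema in the capacity-cost function their
  meaning.\<close>

lemma bdd_above_mutual_info:
  fixes W :: "'x::finite \<Rightarrow> 'y::finite pmf"
  assumes b: "1 < b"
  shows "bdd_above (mutual_info b W ` S)"
proof (rule bdd_aboveI2)
  fix P
  let ?U = "pmf_of_set UNIV :: 'y pmf"
  have ac: "set_pmf (bind_pmf P W) \<subseteq> set_pmf ?U" by simp
  have "mutual_info b W P \<le> (\<Sum>x\<in>UNIV. pmf P x * kl b (W x) ?U)"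
    using average_kl[OF b ac] kl_nonneg[OF b ac] by simp
  also have "\<dots> \<le> (\<Sum>x\<in>UNIV. \<bar>kl b (W x) ?U\<bar>)"
  proof (rule sum_mono)
    fix x
    have "pmf P x * kl b (W x) ?U \<le> pmf P x * \<bar>kl b (W x) ?U\<bar>" by (intro mult_left_mono) auto
    also have "\<dots> \<le> 1 * \<bar>kl b (W x) ?U\<bar>" by (intro mult_right_mono) (auto simp: pmf_le_1)
    finally show "pmf P x * kl b (W x) ?U \<le> \<bar>kl b (W x) ?U\<bar>" by simp
  qed
  finally show "mutual_info b W P \<le> (\<Sum>x\<in>UNIV. \<bar>kl b (W x) ?U\<bar>)" .
qed

lemma mutual_info_le_capacity_cost:
  assumes "1 < b" "P \<in> feasible_inputs \<Lambda> a"
  shows "mutual_info b W P \<le> capacity_cost b W \<Lambda> a"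
  unfolding capacity_cost_def using assms by (intro cSUP_upper bdd_above_mutual_info)

lemma feasible_nonempty:
  assumes "\<Lambda> x\<^sub>0 = 0" "0 \<le> a"
  shows "feasible_inputs \<Lambda> a \<noteq> {}"
proof -
  have "return_pmf x\<^sub>0 \<in> feasible_inputs \<Lambda> a" using assms by (simp add: feasible_inputs_def)
  then show ?thesis by blast
qed

lemma near_optimal_input:
  fixes W :: "'x::finite \<Rightarrow> 'y::finite pmf"
  assumes "1 < b" "\<Lambda> x\<^sub>0 = 0" "0 \<le> a" "0 < \<delta>"
  obtains P where "P \<in> feasible_inputs \<Lambda> a" "capacity_cost b W \<Lambda> a - \<delta> < mutual_info b W P"
proof -
  have "\<exists>P\<in>feasible_inputs \<Lambda> a. capacity_cost b W \<Lambda> a - \<delta> < mutual_info b W P"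
    using assms(4) unfolding capacity_cost_def
    by (subst less_cSUP_iff[OF feasible_nonempty[where \<Lambda>=\<Lambda> and x\<^sub>0=x\<^sub>0, OF assms(2,3)] bdd_above_mutual_info[OF assms(1)], symmetric])
       simp
  then show ?thesis using that by blast
qed

text \<open>Mean energy is linear in the input, so mixing nearly optimal inputs for two budgets is
  feasible for the mixed budget, and mutual information is concave. The sign is flipped to suit
  \<open>convex_le_Inf_differential\<close>.\<close>

lemma convex_capacity_cost:
  fixes W :: "'x::finite \<Rightarrow> 'y::finite pmf"
  assumes b: "1 < b" and zero: "\<Lambda> x\<^sub>0 = 0"
  shows "convex_on {0..} (\<lambda>a. - capacity_cost b W \<Lambda> a)"
proof (intro convex_onI)
  fix t a c :: real assume t: "0 < t" "t < 1" and "a \<in> {0..}" "c \<in> {0..}"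
  then have ac: "0 \<le> a" "0 \<le> c" by auto
  have "(1 - t) * capacity_cost b W \<Lambda> a + t * capacity_cost b W \<Lambda> c
      \<le> capacity_cost b W \<Lambda> ((1 - t) * a + t * c) + \<delta>" if \<delta>: "0 < \<delta>" for \<delta>
  proof -
    obtain P where P: "P \<in> feasible_inputs \<Lambda> a" "capacity_cost b W \<Lambda> a - \<delta> < mutual_info b W P"
      using near_optimal_input[where \<Lambda>=\<Lambda> and x\<^sub>0=x\<^sub>0 and W=W, OF b zero ac(1) \<delta>] by blast
    obtain R where R: "R \<in> feasible_inputs \<Lambda> c" "capacity_cost b W \<Lambda> c - \<delta> < mutual_info b W R"
      using near_optimal_input[where \<Lambda>=\<Lambda> and x\<^sub>0=x\<^sub>0 and W=W, OF b zero ac(2) \<delta>] by blast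
    have "mix_pmf t P R \<in> feasible_inputs \<Lambda> ((1 - t) * a + t * c)"
      using P R t by (simp add: feasible_inputs_def expectation_mix add_mono mult_left_mono)
    from mutual_info_le_capacity_cost[OF b this, of W]
    have "(1 - t) * mutual_info b W P + t * mutual_info b W R
        \<le> capacity_cost b W \<Lambda> ((1 - t) * a + t * c)"
      using mutual_info_concave[OF b t, of W P R] by linarith
    moreover have "(1 - t) * (capacity_cost b W \<Lambda> a - \<delta>) \<le> (1 - t) * mutual_info b W P"
      "t * (capacity_cost b W \<Lambda> c - \<delta>) \<le> t * mutual_info b W R"
      using P R t by (auto intro!: mult_left_mono)
    ultimately show ?thesis by (simp add: algebra_simps)
  qed
  then have "(1 - t) * capacity_cost b W \<Lambda> a + t * capacity_cost b W \<Lambda> c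
      \<le> capacity_cost b W \<Lambda> ((1 - t) * a + t * c)"
    by (rule field_le_epsilon)
  then show "- capacity_cost b W \<Lambda> ((1 - t) *\<^sub>R a + t *\<^sub>R c)
      \<le> (1 - t) * - capacity_cost b W \<Lambda> a + t * - capacity_cost b W \<Lambda> c"
    by simp
qed auto

text \<open>A concave function has a supporting line at the interior point \<open>a\<close> even if
  it has a corner there. Its slope is non-negative because a larger budget enlarges the feasible
  set.\<close>

lemma capacity_cost_supergradient:
  fixes W :: "'x::finite \<Rightarrow> 'y::finite pmf"
  assumes b: "1 < b" and zero: "\<Lambda> x\<^sub>0 = 0" and a: "0 < a"
  obtains \<mu> where "0 \<le> \<mu>" "\<And>c. 0 \<le> c \<Longrightarrow> capacity_cost b W \<Lambda> c \<le> capacity_cost b W \<Lambda> a + \<mu> * (c - a)"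
proof -
  let ?C = "capacity_cost b W \<Lambda>"
  \<comment> \<open>The right-hand slope at \<open>a\<close>: the difference quotients of the convex
    function \<open>- ?C\<close> shrink as \<open>t\<close> decreases to \<open>a\<close>, so their
    infimum is its right derivative.\<close>
  define \<mu> where "\<mu> = - Inf ((\<lambda>t. (- ?C a - - ?C t) / (a - t)) ` ({a<..} \<inter> {0..}))"
  have le: "?C c \<le> ?C a + \<mu> * (c - a)" if "0 \<le> c" for c
    using convex_le_Inf_differential[OF convex_capacity_cost[where \<Lambda>=\<Lambda> and x\<^sub>0=x\<^sub>0 and W=W, OF b zero], of a c] a that
    by (simp add: \<mu>_def)
  have "?C a \<le> ?C (a + 1)"
    unfolding capacity_cost_def
    by (rule cSUP_subset_mono[OF feasible_nonempty[where \<Lambda>=\<Lambda> and x\<^sub>0=x\<^sub>0, OF zero] bdd_above_mutual_info[OF b]])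
       (use a in \<open>auto simp: feasible_inputs_def\<close>)
  with le[of "a + 1"] a have "0 \<le> \<mu>" by simp
  with le show ?thesis by (rule that[rotated])
qed

text \<open>Compactness of the probability simplex: Bolzano-Weierstrass for probability vectors, and
  finitely many coordinates keep sign and total mass in the limit.\<close>

lemma pmf_convergent_subsequence:
  fixes Q :: "nat \<Rightarrow> 'y::finite pmf"
  obtains r :: "nat \<Rightarrow> nat" and q where "strict_mono r" "\<And>y. (\<lambda>k. pmf (Q (r k)) y) \<longlonglongrightarrow> pmf q y"
proof -
  define v where "v k = (\<chi> y. pmf (Q k) y)" for k
  have "norm (v k) \<le> real CARD('y)" for k
  proof -
    have "norm (v k) \<le> (\<Sum>y\<in>UNIV. \<bar>v k $ y\<bar>)" by (rule norm_le_l1_cart)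
    also have "\<dots> \<le> (\<Sum>y\<in>(UNIV :: 'y set). 1)"
      by (intro sum_mono) (simp add: v_def pmf_le_1)
    finally show ?thesis by simp
  qed
  then have "bounded (range v)" by (auto simp: bounded_iff)
  from bounded_imp_convergent_subsequence[OF this] obtain l r
    where r: "strict_mono r" and l: "(v \<circ> r) \<longlonglongrightarrow> l" by blast
  have lim: "(\<lambda>k. pmf (Q (r k)) y) \<longlonglongrightarrow> l $ y" for y
    using tendsto_vec_nth[OF l, of y] by (simp add: v_def)
  have nonneg: "0 \<le> l $ y" for y
    using LIMSEQ_le_const[OF lim] by simp
  have "(\<lambda>k. \<Sum>y\<in>UNIV. pmf (Q (r k)) y) \<longlonglongrightarrow> (\<Sum>y\<in>UNIV. l $ y)"
    by (intro tendsto_sum lim)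
  moreover have "(\<Sum>y\<in>UNIV. pmf (Q (r k)) y) = 1" for k
    by (rule sum_pmf_eq_1) auto
  ultimately have sum1: "(\<Sum>y\<in>UNIV. l $ y) = 1"
    by (simp add: LIMSEQ_const_iff)
  have "pmf (embed_pmf (\<lambda>y. l $ y)) y = l $ y" for y
    using nonneg sum1
    by (intro pmf_embed_pmf) (auto simp: nn_integral_count_space_finite sum_ennreal)
  with r lim show ?thesis by (intro that[of r "embed_pmf (\<lambda>y. l $ y)"]) auto
qed

text \<open>
  Mixing a near-optimal input with a point mass at \<open>x\<close> of weight \<open>t\<close> and comparing mutual informations
  bounds the divergence from the mixed output without differentiating; the error of near-optimality
  \<open>t\<^sup>2\<close> becomes \<open>t\<close>. Lower semicontinuity passes to the limit, where a bounded divergence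
  prevents \<open>Q\<close> from losing support.
\<close>

lemma optimal_output_exists:
  fixes W :: "'x::finite \<Rightarrow> 'y::finite pmf" and J :: "'x \<Rightarrow> real"
  assumes b: "1 < b"
    and upper: "\<And>P. mutual_info b W P \<le> measure_pmf.expectation P J"
    and near: "\<And>\<delta>. 0 < \<delta> \<Longrightarrow> \<exists>P. measure_pmf.expectation P J - \<delta> \<le> mutual_info b W P"
  obtains Q where "\<And>x. set_pmf (W x) \<subseteq> set_pmf Q" "\<And>x. kl b (W x) Q \<le> J x"
proof -
  \<comment> \<open>The weights start at 1/2, which keeps them strictly between 0 and 1 as the
    mixing lemmas require.\<close>
  define t where "t k = inverse (real (Suc (Suc k)))" for k
  have t: "0 < t k" "t k < 1" for k by (auto simp: t_def field_simps)
  have "\<exists>P. measure_pmf.expectation P J - (t k)\<^sup>2 \<le> mutual_info b W P" for k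
    by (rule near) (use t(1)[of k] in simp)
  then obtain P where P: "\<And>k. measure_pmf.expectation (P k) J - (t k)\<^sup>2 \<le> mutual_info b W (P k)"
    by metis
  define Q where "Q k x = mix_pmf (t k) (bind_pmf (P k) W) (W x)" for k x
  have ac: "set_pmf (W x) \<subseteq> set_pmf (Q k x)" for k x
    using t by (auto simp: Q_def set_mix)
  have bound: "kl b (W x) (Q k x) \<le> J x + t k" for k x
  proof -
    have eq: "bind_pmf (mix_pmf (t k) (P k) (return_pmf x)) W = Q k x"
      by (simp add: bind_mix Q_def bind_return_pmf)
    have "(1 - t k) * mutual_info b W (P k) + t k * kl b (W x) (Q k x)
        \<le> mutual_info b W (mix_pmf (t k) (P k) (return_pmf x))"
      using mutual_info_mix_ge[OF b t, of k W "P k" "return_pmf x"]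
      by (simp add: eq indicator_def if_distrib[of "\<lambda>c. c * _"] cong: if_cong)
    also have "\<dots> \<le> (1 - t k) * measure_pmf.expectation (P k) J + t k * J x"
      using upper[of "mix_pmf (t k) (P k) (return_pmf x)"] t[of k] by (simp add: expectation_mix)
    finally have "t k * kl b (W x) (Q k x)
        \<le> (1 - t k) * (measure_pmf.expectation (P k) J - mutual_info b W (P k)) + t k * J x"
      by (simp add: algebra_simps)
    also have "\<dots> \<le> (1 - t k) * (t k)\<^sup>2 + t k * J x"
      using P[of k] t[of k] by (intro add_right_mono mult_left_mono) (auto simp: algebra_simps)
    also have "\<dots> \<le> (t k)\<^sup>2 + t k * J x"
      using t[of k] by (simp add: mult_left_le_one_le)
    also have "\<dots> = t k * (J x + t k)" by (simp add: power2_eq_square algebra_simps)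
    finally show ?thesis using t[of k] by simp
  qed
  obtain r q where r: "strict_mono r" and q: "\<And>y. (\<lambda>k. pmf (bind_pmf (P (r k)) W) y) \<longlonglongrightarrow> pmf q y"
    by (rule pmf_convergent_subsequence[of "\<lambda>k. bind_pmf (P k) W"]) blast
  have "t \<longlonglongrightarrow> 0"
    unfolding t_def using LIMSEQ_Suc[OF LIMSEQ_inverse_real_of_nat] by simp
  then have t0: "(\<lambda>k. t (r k)) \<longlonglongrightarrow> 0"
    using LIMSEQ_subseq_LIMSEQ[OF _ r] by (auto simp: o_def)
  \<comment> \<open>The mixed output \<open>Q k x\<close> depends on \<open>x\<close>, but the
    weight of \<open>W x\<close> tends to 0, so a single limit \<open>q\<close> serves all
    symbols.\<close>
  have lim: "(\<lambda>k. pmf (Q (r k) x) y) \<longlonglongrightarrow> pmf q y" for x y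
  proof -
    have "(\<lambda>k. (1 - t (r k)) * pmf (bind_pmf (P (r k)) W) y + t (r k) * pmf (W x) y)
        \<longlonglongrightarrow> (1 - 0) * pmf q y + 0 * pmf (W x) y"
      by (intro tendsto_intros t0 q)
    then show ?thesis using t by (simp add: Q_def pmf_mix less_imp_le)
  qed
  have supp: "set_pmf (W x) \<subseteq> set_pmf q" for x
  proof
    fix y assume "y \<in> set_pmf (W x)"
    then have w: "0 < pmf (W x) y" by (simp add: pmf_positive)
    define H where "H = (\<Sum>y\<in>UNIV. pmf (W x) y * log b (pmf (W x) y))"
    \<comment> \<open>The divergence is \<open>H\<close> plus a cross entropy with non-negative
      terms, so its term at \<open>y\<close> alone is at most \<open>J x + 1 - H\<close>; the 1
      bounds \<open>t k\<close>. This keeps the mass at \<open>y\<close> above a positive constant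
      that does not depend on \<open>k\<close>.\<close>
    have lower: "b powr (- (J x + 1 - H) / pmf (W x) y) \<le> pmf (Q k x) y" for k
    proof -
      have pos: "0 < pmf (Q k x) z" if "0 < pmf (W x) z" for z
      proof -
        have "z \<in> set_pmf (W x)" using that by (simp add: set_pmf_iff)
        then show ?thesis using ac[of x k] by (intro pmf_positive) blast
      qed
      have "kl b (W x) (Q k x) = (\<Sum>z\<in>UNIV. pmf (W x) z * log b (pmf (W x) z)
          + pmf (W x) z * - log b (pmf (Q k x) z))"
        unfolding kl_def
      proof (intro sum.cong refl)
        fix z
        show "pmf (W x) z * log b (pmf (W x) z / pmf (Q k x) z) = pmf (W x) z * log b (pmf (W x) z)
          + pmf (W x) z * - log b (pmf (Q k x) z)"
          using pos[of z] b by (cases "pmf (W x) z = 0") (auto simp: log_divide pmf_pos algebra_simps)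
      qed
      also have "\<dots> = H + (\<Sum>z\<in>UNIV. pmf (W x) z * - log b (pmf (Q k x) z))"
        unfolding H_def by (rule sum.distrib)
      also have "\<dots> \<ge> H + pmf (W x) y * - log b (pmf (Q k x) y)"
      proof (intro add_left_mono member_le_sum)
        fix z
        show "0 \<le> pmf (W x) z * - log b (pmf (Q k x) z)"
        proof (cases "pmf (W x) z = 0")
          case False
          then have "log b (pmf (Q k x) z) \<le> 0"
            using pos[of z] b by (simp add: pmf_pos pmf_le_1)
          then show ?thesis by (simp add: mult_nonneg_nonpos)
        qed simp
      qed auto
      finally have "pmf (W x) y * - log b (pmf (Q k x) y) \<le> J x + 1 - H"
        using bound[of x k] t(2)[of k] by linarith
      then have "- (J x + 1 - H) / pmf (W x) y \<le> log b (pmf (Q k x) y)"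
        using w by (simp add: field_simps)
      then show ?thesis using pos[OF w] b by (simp add: le_log_iff)
    qed
    have "0 < b powr (- (J x + 1 - H) / pmf (W x) y)" using b by simp
    also have "\<dots> \<le> pmf q y"
      by (rule LIMSEQ_le_const[OF lim[of x]]) (use lower in blast)
    finally show "y \<in> set_pmf q" by (simp add: set_pmf_iff)
  qed
  have "kl b (W x) q \<le> J x" for x
  proof -
    have "(\<lambda>k. kl b (W x) (Q (r k) x)) \<longlonglongrightarrow> kl b (W x) q"
      unfolding kl_def
    proof (rule tendsto_sum)
      fix y
      show "(\<lambda>k. pmf (W x) y * log b (pmf (W x) y / pmf (Q (r k) x) y))
          \<longlonglongrightarrow> pmf (W x) y * log b (pmf (W x) y / pmf q y)"
      proof (cases "pmf (W x) y = 0")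
        case False
        then have "0 < pmf q y" "0 < pmf (W x) y"
          using supp[of x] by (auto simp: set_pmf_iff pmf_pos)
        then show ?thesis using b unfolding log_def by (intro tendsto_intros lim) auto
      qed simp
    qed
    moreover have "(\<lambda>k. J x + t (r k)) \<longlonglongrightarrow> J x + 0"
      by (intro tendsto_intros t0)
    ultimately show ?thesis
      using LIMSEQ_le[of _ "kl b (W x) q" _ "J x"] bound by fastforce
  qed
  with supp show ?thesis by (rule that)
qed

text \<open>The Kuhn-Tucker conditions of the cost-constrained problem. The supporting line, taken
  at the mean energy of an input, bounds mutual information by the mean of \<open>?J\<close>; inputs
  nearly optimal for budget \<open>a\<close> come within \<delta> of that mean, since \<mu> is
  non-negative and their mean energy is at most \<open>a\<close>.\<close>

lemma capacity_cost_output: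
  fixes W :: "'x::finite \<Rightarrow> 'y::finite pmf"
  assumes b: "1 < b" and nonneg: "\<And>x. 0 \<le> \<Lambda> x" and zero: "\<Lambda> x\<^sub>0 = 0" and a: "0 < a"
  obtains \<mu> Q where "0 \<le> \<mu>" "\<And>x. set_pmf (W x) \<subseteq> set_pmf Q"
    "\<And>x. kl b (W x) Q \<le> capacity_cost b W \<Lambda> a + \<mu> * (\<Lambda> x - a)"
proof -
  let ?C = "capacity_cost b W \<Lambda>"
  obtain \<mu> where \<mu>: "0 \<le> \<mu>" "\<And>c. 0 \<le> c \<Longrightarrow> ?C c \<le> ?C a + \<mu> * (c - a)"
    using capacity_cost_supergradient[where \<Lambda>=\<Lambda> and x\<^sub>0=x\<^sub>0 and W=W, OF b zero a] by blast
  let ?J = "\<lambda>x. ?C a + \<mu> * (\<Lambda> x - a)"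
  have EJ: "measure_pmf.expectation P ?J = ?C a + \<mu> * (measure_pmf.expectation P \<Lambda> - a)" for P
    by (simp add: integrable_measure_pmf_finite right_diff_distrib)
  show ?thesis
  proof (rule optimal_output_exists[OF b, of W ?J])
    fix P :: "'x pmf"
    have "mutual_info b W P \<le> ?C (measure_pmf.expectation P \<Lambda>)"
      by (rule mutual_info_le_capacity_cost[OF b]) (simp add: feasible_inputs_def)
    also have "\<dots> \<le> ?C a + \<mu> * (measure_pmf.expectation P \<Lambda> - a)"
      by (rule \<mu>(2)) (simp add: nonneg integral_nonneg_AE)
    finally show "mutual_info b W P \<le> measure_pmf.expectation P ?J" by (simp only: EJ)
  next
    fix \<delta> :: real assume "0 < \<delta>"
    then obtain P where P: "P \<in> feasible_inputs \<Lambda> a" "?C a - \<delta> < mutual_info b W P"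
      using near_optimal_input[where \<Lambda>=\<Lambda> and x\<^sub>0=x\<^sub>0 and W=W, OF b zero, of a \<delta>] a by (metis less_imp_le)
    have "\<mu> * (measure_pmf.expectation P \<Lambda> - a) \<le> 0"
      using P(1) \<mu>(1) by (simp add: feasible_inputs_def mult_nonneg_nonpos)
    with P(2) have "measure_pmf.expectation P ?J - \<delta> \<le> mutual_info b W P" by (simp only: EJ)
    then show "\<exists>P. measure_pmf.expectation P ?J - \<delta> \<le> mutual_info b W P" by blast
  qed (use that \<mu>(1) in blast)
qed

section \<open>The converse bound\<close>

lemma integral_Pi_pmf_component:
  fixes h :: "'c \<Rightarrow> real"
  assumes "finite A" "i \<in> A"
  shows "measure_pmf.expectation (Pi_pmf A d p) (\<lambda>y. h (y i)) = measure_pmf.expectation (p i) h"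
proof -
  have "p i = map_pmf (\<lambda>y. y i) (Pi_pmf A d p)"
    using assms by (simp add: Pi_pmf_component)
  then show ?thesis by simp
qed

lemma finite_set_Pi_pmf:
  "finite A \<Longrightarrow> (\<And>i. i \<in> A \<Longrightarrow> finite (set_pmf (p i))) \<Longrightarrow> finite (set_pmf (Pi_pmf A d p))"
  by (rule finite_subset[OF set_Pi_pmf_subset']) (auto intro: finite_PiE_dflt)

text \<open>The Neyman-Pearson change of measure: off the last event \<open>p\<close> is at most
  \<gamma> times \<open>q\<close>, and on it the test is at most 1. Values of \<open>h\<close>
  strictly between 0 and 1 account for randomised decoders.\<close>

lemma test_success_le:
  assumes fin: "finite (set_pmf p)" "finite (set_pmf q)" and h: "\<And>y. 0 \<le> h y" "\<And>y. h y \<le> 1"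
    and g: "0 \<le> \<gamma>"
  shows "measure_pmf.expectation p h \<le> \<gamma> * measure_pmf.expectation q h
    + measure_pmf.prob p {y. \<gamma> * pmf q y < pmf p y}"
proof -
  let ?S = "set_pmf p \<union> set_pmf q" and ?B = "{y. \<gamma> * pmf q y < pmf p y}"
  have "measure_pmf.expectation p h = (\<Sum>y\<in>?S. pmf p y * h y)"
    using fin by (subst integral_measure_pmf[of ?S]) auto
  also have "\<dots> \<le> (\<Sum>y\<in>?S. \<gamma> * (pmf q y * h y) + pmf p y * indicator ?B y)"
  proof (rule sum_mono)
    fix y
    show "pmf p y * h y \<le> \<gamma> * (pmf q y * h y) + pmf p y * indicator ?B y"
    proof (cases "y \<in> ?B")
      case True
      have "pmf p y * h y \<le> pmf p y * 1" using h by (intro mult_left_mono) auto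
      moreover have "0 \<le> \<gamma> * (pmf q y * h y)" using g h by simp
      ultimately show ?thesis using True by simp
    next
      case False
      then have "pmf p y * h y \<le> (\<gamma> * pmf q y) * h y" using h by (intro mult_right_mono) auto
      then show ?thesis using False by (simp add: mult.assoc)
    qed
  qed
  also have "\<dots> = \<gamma> * (\<Sum>y\<in>?S. pmf q y * h y) + (\<Sum>y\<in>?S. pmf p y * indicator ?B y)"
    by (simp add: sum.distrib sum_distrib_left)
  also have "(\<Sum>y\<in>?S. pmf q y * h y) = measure_pmf.expectation q h"
    using fin by (subst integral_measure_pmf[of ?S]) auto
  also have "(\<Sum>y\<in>?S. pmf p y * indicator ?B y) = measure_pmf.expectation p (indicator ?B)"
    using fin by (subst integral_measure_pmf[of ?S]) auto
  finally show ?thesis by simp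
qed

lemma log_pmf_Pi:
  assumes b: "1 < b" and A: "finite A" and y: "\<And>i. i \<in> A \<Longrightarrow> 0 < pmf (p i) (y i)" "\<And>i. i \<in> A \<Longrightarrow> 0 < pmf (q i) (y i)"
    and d: "\<And>i. i \<notin> A \<Longrightarrow> y i = d"
  shows "b powr s * pmf (Pi_pmf A d q) y < pmf (Pi_pmf A d p) y \<longleftrightarrow>
    s < (\<Sum>i\<in>A. log b (pmf (p i) (y i) / pmf (q i) (y i)))"
proof -
  have P: "pmf (Pi_pmf A d p) y = (\<Prod>i\<in>A. pmf (p i) (y i))" "pmf (Pi_pmf A d q) y = (\<Prod>i\<in>A. pmf (q i) (y i))"
    using A d by (auto intro: pmf_Pi')
  have pos: "0 < (\<Prod>i\<in>A. pmf (p i) (y i))" "0 < (\<Prod>i\<in>A. pmf (q i) (y i))"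
    using y by (auto intro: prod_pos)
  have "(\<Sum>i\<in>A. log b (pmf (p i) (y i) / pmf (q i) (y i))) = log b (\<Prod>i\<in>A. pmf (p i) (y i) / pmf (q i) (y i))"
    using A by (subst log_def, subst ln_prod) (auto simp: log_def sum_divide_distrib dest: y)
  also have "\<dots> = log b ((\<Prod>i\<in>A. pmf (p i) (y i)) / (\<Prod>i\<in>A. pmf (q i) (y i)))"
    by (simp add: prod_dividef)
  finally show ?thesis
    using b pos by (simp add: P less_log_iff pos_less_divide_eq)
qed

text \<open>Given the codeword, the log-likelihood ratio is a sum of independent terms with means
  \<open>kl b (W (x i)) Q\<close>; Chebyshev's inequality controls its excess over the sum of these
  means.\<close>

lemma likelihood_ratio_deviation:
  fixes W :: "'x::finite \<Rightarrow> 'y::finite pmf"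
  assumes b: "1 < b" and ac: "\<And>x. set_pmf (W x) \<subseteq> set_pmf Q"
  obtains v where "0 \<le> v" "\<And>n x s t. 1 \<le> n \<Longrightarrow> 0 < t \<Longrightarrow> (\<Sum>i=1..n. kl b (W (x i)) Q) + t \<le> s \<Longrightarrow>
    measure_pmf.prob (channel_output W n x)
      {y. b powr s * pmf (Pi_pmf {1..n} undefined (\<lambda>_. Q)) y < pmf (channel_output W n x) y}
    \<le> real n * v / t\<^sup>2"
proof
  define ld where "ld x y = log b (pmf (W x) y / pmf Q y) - kl b (W x) Q" for x y
  \<comment> \<open>Adding up the variances of all symbols is wasteful but makes the bound uniform
    over codewords.\<close>
  define v where "v = (\<Sum>x\<in>UNIV. measure_pmf.expectation (W x) (\<lambda>y. (ld x y)\<^sup>2))"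
  show "0 \<le> v" by (auto simp: v_def intro!: sum_nonneg integral_nonneg_AE)
  fix n :: nat and x :: "nat \<Rightarrow> 'x" and s t :: real
  assume n: "1 \<le> n" and t: "0 < t" and s: "(\<Sum>i=1..n. kl b (W (x i)) Q) + t \<le> s"
  let ?P = "Pi_pmf {1..n} undefined (\<lambda>i. W (x i))"
  define X where "X i y = ld (x i) (y i)" for i and y :: "nat \<Rightarrow> 'y"
  have int: "integrable (measure_pmf ?P) h" for h :: "(nat \<Rightarrow> 'y) \<Rightarrow> real"
    by (intro integrable_measure_pmf_finite finite_set_Pi_pmf) auto
  have indep: "prob_space.indep_vars (measure_pmf ?P) (\<lambda>_. borel) X {1..n}"
    unfolding X_def
    by (rule prob_space.indep_vars_compose2[OF measure_pmf.prob_space_axioms indep_vars_Pi_pmf]) auto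
  have mean: "measure_pmf.expectation ?P (X i) = 0" if "i \<in> {1..n}" for i
  proof -
    have "measure_pmf.expectation ?P (X i) = measure_pmf.expectation (W (x i)) (ld (x i))"
      unfolding X_def using that by (subst integral_Pi_pmf_component) auto
    also have "\<dots> = 0"
      unfolding ld_def by (simp add: integrable_measure_pmf_finite) (simp add: expectation_sum_UNIV kl_def)
    finally show ?thesis .
  qed
  have var: "measure_pmf.expectation ?P (\<lambda>y. (X i y)\<^sup>2) \<le> v" if "i \<in> {1..n}" for i
  proof -
    have "measure_pmf.expectation ?P (\<lambda>y. (X i y)\<^sup>2) = measure_pmf.expectation (W (x i)) (\<lambda>y. (ld (x i) y)\<^sup>2)"
      unfolding X_def using that by (subst integral_Pi_pmf_component[where h="\<lambda>y. (ld (x i) y)\<^sup>2"]) auto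
    also have "\<dots> \<le> v"
      unfolding v_def by (rule member_le_sum) (auto intro: integral_nonneg_AE)
    finally show ?thesis .
  qed
  have "measure_pmf.prob ?P {y. b powr s * pmf (Pi_pmf {1..n} undefined (\<lambda>_. Q)) y < pmf ?P y}
      \<le> measure_pmf.prob ?P {y. \<exists>k\<in>{1..n}. t \<le> (\<Sum>i=1..k. X i y)}"
  proof (rule measure_pmf.finite_measure_mono_AE)
    show "AE y in measure_pmf ?P. y \<in> {y. b powr s * pmf (Pi_pmf {1..n} undefined (\<lambda>_. Q)) y < pmf ?P y}
        \<longrightarrow> y \<in> {y. \<exists>k\<in>{1..n}. t \<le> (\<Sum>i=1..k. X i y)}"
    proof (rule AE_pmfI, rule impI, rule CollectI)
      fix y assume y: "y \<in> set_pmf ?P" and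
        less: "y \<in> {y. b powr s * pmf (Pi_pmf {1..n} undefined (\<lambda>_. Q)) y < pmf ?P y}"
      have supp: "y i \<in> set_pmf (W (x i))" if "i \<in> {1..n}" for i
        using y that by (auto simp: set_Pi_pmf PiE_dflt_def)
      have "s < (\<Sum>i=1..n. log b (pmf (W (x i)) (y i) / pmf Q (y i)))"
      proof (subst log_pmf_Pi[symmetric, where d = undefined])
        show "0 < pmf Q (y i)" if "i \<in> {1..n}" for i
          using supp[OF that] ac by (intro pmf_positive) blast
        show "y i = undefined" if "i \<notin> {1..n}" for i
          using y that by (auto simp: set_Pi_pmf PiE_dflt_def)
      qed (use less b supp in \<open>auto intro: pmf_positive\<close>)
      then have "t \<le> (\<Sum>i=1..n. X i y)" using s by (simp add: X_def ld_def sum_subtractf)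
      then show "\<exists>k\<in>{1..n}. t \<le> (\<Sum>i=1..k. X i y)" using n by auto
    qed
  qed auto
  also have "\<dots> \<le> (\<Sum>i=1..n. measure_pmf.expectation ?P (\<lambda>y. (X i y)\<^sup>2)) / t\<^sup>2"
    using prob_space.kolmogorov_maximal_inequality[OF measure_pmf.prob_space_axioms indep int mean t] by simp
  also have "\<dots> \<le> real n * v / t\<^sup>2"
    using sum_mono[of "{1..n}", OF var] by (intro divide_right_mono) auto
  finally show "measure_pmf.prob (channel_output W n x)
      {y. b powr s * pmf (Pi_pmf {1..n} undefined (\<lambda>_. Q)) y < pmf (channel_output W n x) y}
    \<le> real n * v / t\<^sup>2" by (simp add: channel_output_def)
qed

text \<open>Words over a finite alphabet form a finite discrete space, on which every function is
  measurable. The second assumption makes \<phi> blind to the uncontrolled values of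
  \<open>u\<close> outside \<open>{1..n}\<close>.\<close>

lemma measurable_word_function:
  fixes u :: "'w \<Rightarrow> nat \<Rightarrow> 'x::finite" and \<phi> :: "(nat \<Rightarrow> 'x) \<Rightarrow> real"
  assumes u: "\<And>i. i \<in> {1..n} \<Longrightarrow> (\<lambda>\<omega>. u \<omega> i) \<in> measurable M (count_space UNIV)"
    and \<phi>: "\<And>x. \<phi> x = \<phi> (restrict x {1..n})"
  shows "(\<lambda>\<omega>. \<phi> (u \<omega>)) \<in> borel_measurable M"
proof -
  have "(\<lambda>\<omega>. \<lambda>i\<in>{1..n}. u \<omega> i) \<in> measurable M (PiM {1..n} (\<lambda>_. count_space UNIV))"
    by (intro measurable_restrict u)
  then have "(\<lambda>\<omega>. restrict (u \<omega>) {1..n}) \<in> measurable M (count_space (PiE {1..n} (\<lambda>_. UNIV)))"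
    by (simp add: count_space_PiM_finite countable_finite)
  then have "(\<lambda>\<omega>. \<phi> (restrict (u \<omega>) {1..n})) \<in> borel_measurable M"
    by (rule measurable_compose) simp
  then show ?thesis by (simp only: \<phi>[symmetric])
qed

section \<open>The energy process and the converse for a single code\<close>

locale eh_channel = prob_space \<Omega>
  for \<Omega> :: "'w measure" +
  fixes W :: "'x::finite \<Rightarrow> 'y::finite pmf" and \<Lambda> :: "'x \<Rightarrow> real" and x\<^sub>0 :: 'x
    and E :: "nat \<Rightarrow> 'w \<Rightarrow> real" and b \<epsilon> :: real
  assumes base: "1 < b"
    and eps: "0 < \<epsilon>" "\<epsilon> < 1"
    and energy_nonneg: "\<And>x. 0 \<le> \<Lambda> x"
    and zero_energy: "\<Lambda> x\<^sub>0 = 0"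
    and indep: "indep_vars (\<lambda>_. borel) E {1..}"
    and ident_distr: "\<And>i. 1 \<le> i \<Longrightarrow> distr \<Omega> borel (E i) = distr \<Omega> borel (E 1)"
    and harvest_nonneg: "\<And>i. 1 \<le> i \<Longrightarrow> AE \<omega> in \<Omega>. 0 \<le> E i \<omega>"
    and harvest_pos: "0 < expectation (E 1)"
    and harvest_second_moment: "integrable \<Omega> (\<lambda>\<omega>. (E 1 \<omega>)\<^sup>2)"
begin

definition "avgE = expectation (E 1)"

definition "varE = expectation (\<lambda>\<omega>. (E 1 \<omega> - avgE)\<^sup>2)"

lemma E_measurable [measurable]: "1 \<le> i \<Longrightarrow> E i \<in> borel_measurable \<Omega>"
  using indep by (auto simp: indep_vars_def)

lemma E_transfer:
  fixes h :: "real \<Rightarrow> real"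
  assumes "1 \<le> i" and [measurable]: "h \<in> borel_measurable borel"
  shows "expectation (\<lambda>\<omega>. h (E i \<omega>)) = expectation (\<lambda>\<omega>. h (E 1 \<omega>))"
    and "integrable \<Omega> (\<lambda>\<omega>. h (E i \<omega>)) \<longleftrightarrow> integrable \<Omega> (\<lambda>\<omega>. h (E 1 \<omega>))"
proof -
  have *: "expectation (\<lambda>\<omega>. h (E j \<omega>)) = (\<integral>x. h x \<partial>distr \<Omega> borel (E j))"
    "integrable \<Omega> (\<lambda>\<omega>. h (E j \<omega>)) \<longleftrightarrow> integrable (distr \<Omega> borel (E j)) h" if "1 \<le> j" for j
    using E_measurable[OF that] by (auto simp: integral_distr integrable_distr_eq)
  show "expectation (\<lambda>\<omega>. h (E i \<omega>)) = expectation (\<lambda>\<omega>. h (E 1 \<omega>))"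
    "integrable \<Omega> (\<lambda>\<omega>. h (E i \<omega>)) \<longleftrightarrow> integrable \<Omega> (\<lambda>\<omega>. h (E 1 \<omega>))"
    by (simp_all only: *[OF assms(1)] *[of 1] order_refl ident_distr[OF assms(1)])
qed

lemma E_integrable: "1 \<le> i \<Longrightarrow> integrable \<Omega> (E i)" "1 \<le> i \<Longrightarrow> integrable \<Omega> (\<lambda>\<omega>. (E i \<omega>)\<^sup>2)"
proof -
  assume i: "1 \<le> i"
  show sq: "integrable \<Omega> (\<lambda>\<omega>. (E i \<omega>)\<^sup>2)"
    using E_transfer(2)[OF i, of "\<lambda>x. x\<^sup>2"] harvest_second_moment by simp
  show "integrable \<Omega> (E i)"
    by (rule square_integrable_imp_integrable[OF E_measurable[OF i] sq])
qed

lemma E_mean: "1 \<le> i \<Longrightarrow> expectation (E i) = avgE"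
  using E_transfer(1)[of i "\<lambda>x. x"] by (simp add: avgE_def)

lemma E_variance: "1 \<le> i \<Longrightarrow> expectation (\<lambda>\<omega>. (E i \<omega> - avgE)\<^sup>2) = varE"
  using E_transfer(1)[of i "\<lambda>x. (x - avgE)\<^sup>2"] by (simp add: varE_def)

lemma varE_nonneg: "0 \<le> varE"
  by (simp add: varE_def)

text \<open>The maximal inequality is one-sided, hence the sign: \<sigma> = 1 detects a surplus of
  energy for the converse, \<sigma> = -1 a shortage for achievability.\<close>

lemma E_deviation:
  assumes t: "0 < t" and \<sigma>: "\<sigma> = 1 \<or> \<sigma> = -1"
  shows "prob {\<omega>\<in>space \<Omega>. \<exists>k\<in>{1..n}. t \<le> (\<Sum>i=1..k. \<sigma> * (E i \<omega> - avgE))} \<le> real n * varE / t\<^sup>2"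
proof -
  have "indep_vars (\<lambda>_. borel) (\<lambda>i \<omega>. \<sigma> * (E i \<omega> - avgE)) {1..n}"
    by (rule indep_vars_compose2[OF indep_vars_subset[OF indep], where Y = "\<lambda>_ x. \<sigma> * (x - avgE)"]) auto
  from kolmogorov_maximal_inequality[OF this _ _ t]
  have "prob {\<omega>\<in>space \<Omega>. \<exists>k\<in>{1..n}. t \<le> (\<Sum>i=1..k. \<sigma> * (E i \<omega> - avgE))}
      \<le> (\<Sum>i=1..n. expectation (\<lambda>\<omega>. (\<sigma> * (E i \<omega> - avgE))\<^sup>2)) / t\<^sup>2"
    using E_integrable by (simp add: power_mult_distrib power2_diff E_mean prob_space)
  also have "(\<Sum>i=1..n. expectation (\<lambda>\<omega>. (\<sigma> * (E i \<omega> - avgE))\<^sup>2)) = (\<Sum>i=1..n. varE)"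
    using \<sigma> by (intro sum.cong refl) (auto simp: power_mult_distrib E_variance)
  finally show ?thesis by simp
qed

text \<open>The converse bounds an error integral from below, and the integral of a non-integrable
  function is 0 by convention, so measurability has to be secured.\<close>

lemma decoded_prob_measurable:
  assumes f: "eh_encoder \<Lambda> n M f" and m: "m \<in> {1..M}"
  shows "(\<lambda>\<omega>. measure_pmf.prob (bind_pmf (channel_output W n (f m (\<lambda>i\<in>{1..n}. E i \<omega>))) g) U)
    \<in> borel_measurable \<Omega>"
proof (rule measurable_word_function[where n = n and u = "\<lambda>\<omega>. f m (\<lambda>i\<in>{1..n}. E i \<omega>)"
      and \<phi> = "\<lambda>x. measure_pmf.prob (bind_pmf (channel_output W n x) g) U"])
  fix i assume i: "i \<in> {1..n}"
  have "(\<lambda>\<omega>. \<lambda>i\<in>{1..n}. E i \<omega>) \<in> measurable \<Omega> (PiM {1..n} (\<lambda>_. borel))"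
    by (intro measurable_restrict) auto
  moreover have "(\<lambda>e. f m e i) \<in> measurable (PiM {1..n} (\<lambda>_. borel)) (count_space UNIV)"
    using f m i by (auto simp: eh_encoder_def)
  ultimately show "(\<lambda>\<omega>. f m (\<lambda>i\<in>{1..n}. E i \<omega>) i) \<in> measurable \<Omega> (count_space UNIV)"
    by (rule measurable_compose)
next
  fix x :: "nat \<Rightarrow> 'x"
  have "channel_output W n x = channel_output W n (restrict x {1..n})"
    unfolding channel_output_def by (intro Pi_pmf_cong) auto
  then show "measure_pmf.prob (bind_pmf (channel_output W n x) g) U
      = measure_pmf.prob (bind_pmf (channel_output W n (restrict x {1..n})) g) U" by simp
qed

text \<open>Change of measure to the output law \<open>q\<close>, which does not depend on the
  message: under it the probabilities of decoding the \<open>M\<close> messages add up to at most 1,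
  while under the true law each success probability exceeds \<open>b powr s\<close> times that under
  \<open>q\<close> by at most (1 - \<epsilon>) / 2.\<close>

lemma converse:
  obtains L where "\<And>n M. 1 \<le> n \<Longrightarrow> eh_code \<Omega> E W \<Lambda> n \<epsilon> M \<Longrightarrow>
    real M \<le> 2 / (1 - \<epsilon>) * b powr (real n * capacity_cost b W \<Lambda> avgE + L * sqrt (real n))"
proof -
  let ?C = "capacity_cost b W \<Lambda> avgE"
  obtain \<mu> Q where \<mu>: "0 \<le> \<mu>" and ac: "\<And>x. set_pmf (W x) \<subseteq> set_pmf Q"
    and kl_le: "\<And>x. kl b (W x) Q \<le> ?C + \<mu> * (\<Lambda> x - avgE)"
    using capacity_cost_output[where \<Lambda>=\<Lambda> and x\<^sub>0=x\<^sub>0 and W=W, OF base energy_nonneg zero_energy harvest_pos]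
    by (auto simp: avgE_def)
  obtain v where v: "0 \<le> v" "\<And>n x s t. 1 \<le> n \<Longrightarrow> 0 < t \<Longrightarrow> (\<Sum>i=1..n. kl b (W (x i)) Q) + t \<le> s \<Longrightarrow>
    measure_pmf.prob (channel_output W n x)
      {y. b powr s * pmf (Pi_pmf {1..n} undefined (\<lambda>_. Q)) y < pmf (channel_output W n x) y}
    \<le> real n * v / t\<^sup>2"
    using likelihood_ratio_deviation[where W=W, OF base ac] by blast
  \<comment> \<open>Both exceptional events, surplus energy and a large likelihood ratio, receive
    probability (1 - \<epsilon>) / 4, which leaves half of the required success probability 1 -
    \<epsilon>.\<close>
  have scale: "\<exists>c>0. w / c\<^sup>2 \<le> (1 - \<epsilon>) / 4" if "0 \<le> w" for w
  proof (intro exI conjI)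
    let ?c = "sqrt (4 * (w + 1) / (1 - \<epsilon>))"
    show "0 < ?c" using that eps by simp
    have "w / ?c\<^sup>2 = (1 - \<epsilon>) / 4 * (w / (w + 1))" using that eps by simp
    also have "\<dots> \<le> (1 - \<epsilon>) / 4" using that eps by (intro mult_right_le_one_le) auto
    finally show "w / ?c\<^sup>2 \<le> (1 - \<epsilon>) / 4" .
  qed
  obtain c where c: "0 < c" "varE / c\<^sup>2 \<le> (1 - \<epsilon>) / 4"
    using scale[OF varE_nonneg] by auto
  obtain d where d: "0 < d" "v / d\<^sup>2 \<le> (1 - \<epsilon>) / 4"
    using scale[OF v(1)] by auto
  \<comment> \<open>Surplus energy of \<open>c * sqrt n\<close> can raise the divergence sum by
    \<open>\<mu> * c * sqrt n\<close>; \<open>d\<close> covers the fluctuation of the likelihood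
    ratio.\<close>
  define L where "L = \<mu> * c + d"
  show ?thesis
  proof (rule that)
    fix n M :: nat assume n: "1 \<le> n" and code: "eh_code \<Omega> E W \<Lambda> n \<epsilon> M"
    from code obtain f g where f: "eh_encoder \<Lambda> n M f" and "decoder M g"
      and err: "(MAX m\<in>{1..M}. error_prob \<Omega> E W n f g m) \<le> \<epsilon>"
      by (auto simp: eh_code_def)
    define s where "s = real n * ?C + L * sqrt (real n)"
    define q where "q = Pi_pmf {1..n} undefined (\<lambda>_. Q)"
    define \<alpha> where "\<alpha> m = measure_pmf.prob (bind_pmf q g) {m}" for m
    define bad where "bad = {\<omega>\<in>space \<Omega>. \<exists>k\<in>{1..n}. c * sqrt (real n) \<le> (\<Sum>i=1..k. 1 * (E i \<omega> - avgE))}"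
    have bad_meas [measurable]: "bad \<in> events"
    proof -
      have [measurable]: "(\<lambda>\<omega>. \<Sum>i=1..k. 1 * (E i \<omega> - avgE)) \<in> borel_measurable \<Omega>" for k
        by (intro borel_measurable_sum borel_measurable_times borel_measurable_diff) auto
      show ?thesis unfolding bad_def by measurable
    qed
    have "prob bad \<le> varE / c\<^sup>2"
      using E_deviation[of "c * sqrt (real n)" 1 n] c n
      by (simp add: bad_def power_mult_distrib)
    with c(2) have prob_bad: "prob bad \<le> (1 - \<epsilon>) / 4" by linarith
    have success: "1 - error_prob \<Omega> E W n f g m \<le> b powr s * \<alpha> m + (1 - \<epsilon>) / 2" if m: "m \<in> {1..M}" for m
    proof -
      define x where "x \<omega> = f m (\<lambda>i\<in>{1..n}. E i \<omega>)" for \<omega>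
      define F where "F \<omega> = measure_pmf.prob (bind_pmf (channel_output W n (x \<omega>)) g) {u. u \<noteq> m}" for \<omega>
      have F_int: "integrable \<Omega> F"
      proof (rule integrable_const_bound[where B=1])
        show "F \<in> borel_measurable \<Omega>"
          using decoded_prob_measurable[OF f m, of g "{u. u \<noteq> m}"] by (simp add: F_def[abs_def] x_def)
      qed (auto simp: F_def)
      \<comment> \<open>Encoders obey the energy constraint only on non-negative energy vectors, so
        the pointwise estimate holds for almost every \<omega>.\<close>
      have "AE \<omega> in \<Omega>. \<forall>i\<in>{1..n}. 0 \<le> E i \<omega>"
        by (intro AE_finite_allI harvest_nonneg) auto
      then have AE: "AE \<omega> in \<Omega>. 1 - F \<omega> \<le> b powr s * \<alpha> m + (1 - \<epsilon>) / 4 + indicator bad \<omega>"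
      proof (rule AE_mp, intro AE_I2 impI)
        fix \<omega> assume \<omega>: "\<omega> \<in> space \<Omega>" and pos: "\<forall>i\<in>{1..n}. 0 \<le> E i \<omega>"
        have compl: "1 - F \<omega> = measure_pmf.prob (bind_pmf (channel_output W n (x \<omega>)) g) {m}"
        proof -
          have "{u. u \<noteq> m} = UNIV - {m}" by auto
          then show ?thesis
            unfolding F_def using measure_pmf.prob_compl[of "{m}" "bind_pmf (channel_output W n (x \<omega>)) g"] by simp
        qed
        show "1 - F \<omega> \<le> b powr s * \<alpha> m + (1 - \<epsilon>) / 4 + indicator bad \<omega>"
        proof (cases "\<omega> \<in> bad")
          case True
          have "1 - F \<omega> \<le> 1" by (simp add: F_def)
          moreover have "0 \<le> b powr s * \<alpha> m" by (simp add: \<alpha>_def)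
          moreover have "0 \<le> (1 - \<epsilon>) / 4" using eps by simp
          moreover have "indicator bad \<omega> = (1 :: real)" using True by simp
          ultimately show ?thesis by linarith
        next
          case False
          have "(\<Sum>i=1..n. \<Lambda> (x \<omega> i)) \<le> (\<Sum>i=1..n. (\<lambda>i\<in>{1..n}. E i \<omega>) i)"
          proof -
            have "\<forall>i\<in>{1..n}. 0 \<le> (\<lambda>i\<in>{1..n}. E i \<omega>) i" using pos by simp
            then show ?thesis using f m n unfolding eh_encoder_def x_def by (meson atLeastAtMost_iff order_refl)
          qed
          also have "\<dots> = (\<Sum>i=1..n. E i \<omega>)" by (intro sum.cong) auto
          also have "\<dots> \<le> real n * avgE + c * sqrt (real n)"
            using False \<omega> n by (auto simp: bad_def not_le sum_subtractf dest!: bspec[of _ _ n])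
          finally have cost: "(\<Sum>i=1..n. \<Lambda> (x \<omega> i)) - real n * avgE \<le> c * sqrt (real n)" by simp
          have "(\<Sum>i=1..n. kl b (W (x \<omega> i)) Q) \<le> (\<Sum>i=1..n. ?C + \<mu> * (\<Lambda> (x \<omega> i) - avgE))"
            by (intro sum_mono kl_le)
          also have "\<dots> = real n * ?C + \<mu> * ((\<Sum>i=1..n. \<Lambda> (x \<omega> i)) - real n * avgE)"
            by (simp add: sum.distrib sum_distrib_left sum_subtractf right_diff_distrib)
          also have "\<dots> \<le> real n * ?C + \<mu> * (c * sqrt (real n))"
            using cost \<mu> by (intro add_left_mono mult_left_mono)
          finally have "(\<Sum>i=1..n. kl b (W (x \<omega> i)) Q) + d * sqrt (real n) \<le> s"
            by (simp add: s_def L_def algebra_simps)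
          from v(2)[OF n _ this]
          have "measure_pmf.prob (channel_output W n (x \<omega>))
              {y. b powr s * pmf q y < pmf (channel_output W n (x \<omega>)) y} \<le> v / d\<^sup>2"
            using d n by (simp add: q_def power_mult_distrib)
          with d(2) have dev: "measure_pmf.prob (channel_output W n (x \<omega>))
              {y. b powr s * pmf q y < pmf (channel_output W n (x \<omega>)) y} \<le> (1 - \<epsilon>) / 4" by linarith
          have exp_eq: "measure_pmf.prob (bind_pmf r g) {m} = measure_pmf.expectation r (\<lambda>y. pmf (g y) m)" for r
            by (simp add: measure_pmf_single pmf_bind)
          have "measure_pmf.expectation (channel_output W n (x \<omega>)) (\<lambda>y. pmf (g y) m)
              \<le> b powr s * measure_pmf.expectation q (\<lambda>y. pmf (g y) m)
                + measure_pmf.prob (channel_output W n (x \<omega>)) {y. b powr s * pmf q y < pmf (channel_output W n (x \<omega>)) y}"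
            by (rule test_success_le)
               (auto simp: pmf_le_1 channel_output_def q_def intro!: finite_set_Pi_pmf)
          then have "1 - F \<omega> \<le> b powr s * \<alpha> m + (1 - \<epsilon>) / 4"
            using dev unfolding compl \<alpha>_def exp_eq by linarith
          then show ?thesis using False by simp
        qed
      qed
      have ind_int: "integrable \<Omega> (indicator bad :: _ \<Rightarrow> real)"
        by (intro integrable_real_indicator) (auto simp: less_top[symmetric])
      have "1 - error_prob \<Omega> E W n f g m = expectation (\<lambda>\<omega>. 1 - F \<omega>)"
        using F_int by (simp add: error_prob_def F_def[abs_def] x_def prob_space)
      also have "\<dots> \<le> expectation (\<lambda>\<omega>. (b powr s * \<alpha> m + (1 - \<epsilon>) / 4) + indicator bad \<omega>)"
        using AE F_int ind_int by (intro integral_mono_AE) auto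
      also have "\<dots> = b powr s * \<alpha> m + (1 - \<epsilon>) / 4 + prob bad"
        by (subst Bochner_Integration.integral_add[OF _ ind_int]) (auto simp: prob_space)
      finally show ?thesis using prob_bad by linarith
    qed
    \<comment> \<open>Summing over messages; the term \<open>M * (1 - \<epsilon>) / 2\<close> on the
      right is absorbed by the left side, which yields the factor
      \<open>2 / (1 - \<epsilon>)\<close>.\<close>
    have "real M * (1 - \<epsilon>) = (\<Sum>m\<in>{1..M}. 1 - \<epsilon>)" by simp
    also have "\<dots> \<le> (\<Sum>m\<in>{1..M}. b powr s * \<alpha> m + (1 - \<epsilon>) / 2)"
    proof (rule sum_mono)
      fix m assume m: "m \<in> {1..M}"
      then have "error_prob \<Omega> E W n f g m \<le> (MAX m\<in>{1..M}. error_prob \<Omega> E W n f g m)"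
        by (intro Max_ge) auto
      with err success[OF m] show "1 - \<epsilon> \<le> b powr s * \<alpha> m + (1 - \<epsilon>) / 2" by linarith
    qed
    also have "\<dots> = b powr s * (\<Sum>m\<in>{1..M}. \<alpha> m) + real M * (1 - \<epsilon>) / 2"
      by (simp add: sum.distrib sum_distrib_left)
    also have "\<dots> \<le> b powr s * 1 + real M * (1 - \<epsilon>) / 2"
    proof (intro add_right_mono mult_left_mono)
      have "(\<Sum>m\<in>{1..M}. \<alpha> m) = measure_pmf.prob (bind_pmf q g) {1..M}"
        by (simp add: \<alpha>_def measure_measure_pmf_finite)
      then show "(\<Sum>m\<in>{1..M}. \<alpha> m) \<le> 1" by simp
    qed simp
    finally show "real M \<le> 2 / (1 - \<epsilon>) * b powr (real n * ?C + L * sqrt (real n))"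
      using eps by (simp add: field_simps s_def)
  qed
qed

end

section \<open>Sums of independent variables and products with discrete laws\<close>

lemma isCont_Phi: "isCont Phi z"
proof -
  interpret real_distribution std_normal_distribution by (rule real_dist_normal_dist)
  have "emeasure std_normal_distribution {z} = 0"
    by (subst emeasure_density) (auto simp: nn_integral_0_iff_AE intro!: AE_mp[OF AE_lborel_singleton[of z]])
  then show ?thesis by (simp add: Phi_def isCont_cdf measure_def)
qed

text \<open>\<open>Phi_inv\<close> is a choice function, so all that is required is that
  \<open>p\<close> is a value of \<open>Phi\<close>; this follows from continuity and the limits at
  both ends.\<close>

lemma Phi_Phi_inv:
  assumes "0 < p" "p < 1"
  shows "Phi (Phi_inv p) = p"
proof -
  interpret real_distribution std_normal_distribution by (rule real_dist_normal_dist)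
  have "eventually (\<lambda>x. p < Phi x) at_top" "eventually (\<lambda>x. Phi x < p) at_bot"
    using order_tendstoD(1)[OF cdf_lim_at_top_prob assms(2)] order_tendstoD(2)[OF cdf_lim_at_bot assms(1)]
    by (auto simp: Phi_def)
  then obtain u v where uv: "p < Phi u" "Phi v < p"
    by (auto simp: eventually_at_top_linorder eventually_at_bot_linorder)
  have "v \<le> u" using uv cdf_nondecreasing[of u v] by (fastforce simp: Phi_def)
  then obtain z where "Phi z = p"
    using IVT[of Phi v p u] uv isCont_Phi by auto
  then show ?thesis unfolding Phi_inv_def by (intro f_inv_into_f) auto
qed

text \<open>The central limit theorem speaks of an infinite sequence on one space, whereas the sums
  here live on \<open>Pi_pmf\<close>, a different space for each \<open>k\<close>. The infinite
  product of the law \<nu> hosts the sequence; its first \<open>n\<close> coordinates and those of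
  \<open>Pi_pmf\<close> have the same joint law, the \<open>n\<close>-fold product of \<nu>.\<close>

lemma iid_sum_CLT:
  fixes L :: "real pmf"
  assumes fin: "finite (set_pmf L)" and mean: "measure_pmf.expectation L (\<lambda>x. x) = m"
    and var: "measure_pmf.expectation L (\<lambda>x. (x - m)\<^sup>2) = v" and v: "0 < v"
  shows "(\<lambda>k. measure_pmf.prob (Pi_pmf {..<k} 0 (\<lambda>_. L))
      {\<tau>. (\<Sum>i<k. \<tau> i) \<le> real k * m + sqrt (real k * v) * z}) \<longlonglongrightarrow> Phi z"
proof -
  define \<nu> where "\<nu> = distr (measure_pmf L) borel (\<lambda>x. x)"
  have \<nu>: "prob_space \<nu>" and [simp, measurable_cong]: "sets \<nu> = sets borel" and [simp]: "space \<nu> = UNIV"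
    by (auto simp: \<nu>_def intro!: measure_pmf.prob_space_distr)
  define M where "M = PiM (UNIV :: nat set) (\<lambda>_. \<nu>)"
  interpret product_prob_space "\<lambda>_. \<nu>" "UNIV :: nat set"
    by (intro product_prob_spaceI \<nu>)
  interpret Pr: prob_space M
    unfolding M_def by (intro prob_space_PiM \<nu>)
  have setsM: "sets M = sets (PiM UNIV (\<lambda>_. borel))"
    unfolding M_def by (intro sets_PiM_cong) auto
  have X [measurable]: "(\<lambda>\<omega>. \<omega> i) \<in> borel_measurable M" for i
    unfolding measurable_cong_sets[OF setsM refl] by simp
  have comp: "distr M borel (\<lambda>\<omega>. \<omega> i) = \<nu>" for i
  proof -
    have "distr M borel (\<lambda>\<omega>. \<omega> i) = distr M \<nu> (\<lambda>\<omega>. \<omega> i)"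
      by (intro distr_cong) auto
    also have "\<dots> = \<nu>" unfolding M_def by (rule distr_PiM_component[OF \<nu>]) auto
    finally show ?thesis .
  qed
  have transfer: "integral\<^sup>L M (\<lambda>\<omega>. h (\<omega> i)) = measure_pmf.expectation L h"
    "integrable M (\<lambda>\<omega>. h (\<omega> i))" if [measurable]: "h \<in> borel_measurable borel"
    for h :: "real \<Rightarrow> real" and i
  proof -
    have "integral\<^sup>L M (\<lambda>\<omega>. h (\<omega> i)) = integral\<^sup>L \<nu> h"
      by (subst comp[of i, symmetric]) (simp add: integral_distr)
    also have "\<dots> = measure_pmf.expectation L h" by (simp add: \<nu>_def integral_distr)
    finally show "integral\<^sup>L M (\<lambda>\<omega>. h (\<omega> i)) = measure_pmf.expectation L h" .
    have "integrable \<nu> h"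
      by (simp add: \<nu>_def integrable_distr_eq integrable_measure_pmf_finite fin)
    then show "integrable M (\<lambda>\<omega>. h (\<omega> i))"
      by (subst (asm) comp[of i, symmetric]) (simp add: integrable_distr_eq)
  qed
  have indep: "Pr.indep_vars (\<lambda>_. borel) (\<lambda>i \<omega>. \<omega> i) (UNIV :: nat set)"
  proof (subst Pr.indep_vars_iff_distr_eq_PiM')
    have "distr M (PiM UNIV (\<lambda>_. borel)) (\<lambda>\<omega>. \<omega>) = M"
      by (rule distr_id2) (simp add: setsM)
    then show "distr M (PiM UNIV (\<lambda>_. borel)) (\<lambda>\<omega>. \<lambda>i\<in>UNIV. \<omega> i) = PiM UNIV (\<lambda>i. distr M borel (\<lambda>\<omega>. \<omega> i))"
      by (simp add: comp M_def[symmetric] restrict_UNIV)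
  qed auto
  have "weak_conv_m (\<lambda>n. distr M borel (\<lambda>\<omega>. (\<Sum>i<n. \<omega> i - m) / sqrt (real n * (sqrt v)\<^sup>2))) std_normal_distribution"
  proof (rule Pr.central_limit_theorem[OF indep])
    show "Pr.expectation (\<lambda>\<omega>. \<omega> i) = m" for i
      using transfer(1)[of "\<lambda>x. x" i] mean by simp
    then show "Pr.variance (\<lambda>\<omega>. \<omega> i) = (sqrt v)\<^sup>2" for i
      using transfer(1)[of "\<lambda>x. (x - m)\<^sup>2" i] var v by simp
    show "integrable M (\<lambda>\<omega>. (\<omega> i)\<^sup>2)" for i
      using transfer(2)[of "\<lambda>x. x\<^sup>2" i] by simp
    show "distr M borel (\<lambda>\<omega>. \<omega> i) = \<nu>" for i by (rule comp)
    show "0 < sqrt v" using v by simp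
  qed
  then have lim: "(\<lambda>n. cdf (distr M borel (\<lambda>\<omega>. (\<Sum>i<n. \<omega> i - m) / sqrt (real n * (sqrt v)\<^sup>2))) z) \<longlonglongrightarrow> Phi z"
    using isCont_Phi[of z] by (simp add: weak_conv_m_def weak_conv_def Phi_def)
  have eq: "cdf (distr M borel (\<lambda>\<omega>. (\<Sum>i<n. \<omega> i - m) / sqrt (real n * (sqrt v)\<^sup>2))) z
      = measure_pmf.prob (Pi_pmf {..<n} 0 (\<lambda>_. L)) {\<tau>. (\<Sum>i<n. \<tau> i) \<le> real n * m + sqrt (real n * v) * z}"
    (is "_ = measure_pmf.prob ?Pi {\<tau>. _ \<le> ?c}") if n: "0 < n" for n
  proof -
    let ?J = "{..<n}" and ?B = "PiM {..<n} (\<lambda>_. borel :: real measure)"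
    have sum_meas [measurable]: "(\<lambda>\<tau>. \<Sum>i<n. \<tau> i) \<in> borel_measurable ?B"
      by (intro borel_measurable_sum) auto
    have "cdf (distr M borel (\<lambda>\<omega>. (\<Sum>i<n. \<omega> i - m) / sqrt (real n * (sqrt v)\<^sup>2))) z
        = measure M {\<omega> \<in> space M. (\<Sum>i<n. \<omega> i) \<le> ?c}"
      unfolding cdf_def
    proof (subst measure_distr)
      have "0 < sqrt (real n * v)" using n v by simp
      then show "measure M ((\<lambda>\<omega>. (\<Sum>i<n. \<omega> i - m) / sqrt (real n * (sqrt v)\<^sup>2)) -` {..z} \<inter> space M)
          = measure M {\<omega> \<in> space M. (\<Sum>i<n. \<omega> i) \<le> ?c}"
        using v by (intro arg_cong[where f = "measure M"])
          (auto simp: sum_subtractf pos_divide_le_eq algebra_simps)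
    qed auto
    also have "\<dots> = measure (distr M ?B (\<lambda>\<omega>. restrict \<omega> ?J)) {\<tau>\<in>space ?B. (\<Sum>i<n. \<tau> i) \<le> ?c}"
      by (subst measure_distr) (auto simp: space_PiM intro!: arg_cong[where f = "measure M"] measurable_restrict)
    also have "distr M ?B (\<lambda>\<omega>. restrict \<omega> ?J) = PiM ?J (\<lambda>_. \<nu>)"
    proof -
      have "distr M ?B (\<lambda>\<omega>. restrict \<omega> ?J) = distr M (PiM ?J (\<lambda>_. \<nu>)) (\<lambda>\<omega>. restrict \<omega> ?J)"
        by (intro distr_cong refl sets_PiM_cong) auto
      also have "\<dots> = PiM ?J (\<lambda>_. \<nu>)" unfolding M_def by (rule distr_PiM_restrict_finite) auto
      finally show ?thesis .
    qed
    also have "PiM ?J (\<lambda>_. \<nu>) = distr (measure_pmf ?Pi) ?B (\<lambda>\<omega>. restrict \<omega> ?J)"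
    proof -
      have "prob_space.indep_vars (measure_pmf ?Pi) (\<lambda>_. borel) (\<lambda>i \<tau>. \<tau> i) ?J"
        by (rule prob_space.indep_vars_compose2[OF measure_pmf.prob_space_axioms indep_vars_Pi_pmf,
              where Y = "\<lambda>_ x. x"]) auto
      moreover have "distr (measure_pmf ?Pi) borel (\<lambda>\<tau>. \<tau> i) = \<nu>" if "i \<in> ?J" for i
      proof -
        have "L = map_pmf (\<lambda>\<tau>. \<tau> i) ?Pi" using that by (simp add: Pi_pmf_component)
        then have "\<nu> = distr (measure_pmf (map_pmf (\<lambda>\<tau>. \<tau> i) ?Pi)) borel (\<lambda>x. x)"
          by (simp add: \<nu>_def)
        also have "\<dots> = distr (measure_pmf ?Pi) borel (\<lambda>\<tau>. \<tau> i)"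
          unfolding map_pmf_rep_eq by (subst distr_distr) (auto simp: o_def)
        finally show ?thesis ..
      qed
      then have "PiM ?J (\<lambda>i. distr (measure_pmf ?Pi) borel (\<lambda>\<tau>. \<tau> i)) = PiM ?J (\<lambda>_. \<nu>)"
        by (intro PiM_cong) auto
      ultimately show ?thesis
        using n by (subst (asm) prob_space.indep_vars_iff_distr_eq_PiM'[OF measure_pmf.prob_space_axioms]) auto
    qed
    also have "measure \<dots> {\<tau>\<in>space ?B. (\<Sum>i<n. \<tau> i) \<le> ?c} = measure_pmf.prob ?Pi {\<tau>. (\<Sum>i<n. \<tau> i) \<le> ?c}"
      by (subst measure_distr) (auto simp: space_PiM intro!: arg_cong[where f = "measure_pmf.prob ?Pi"])
    finally show ?thesis .
  qed
  show ?thesis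
    by (rule Lim_transform_eventually[OF lim], rule eventually_sequentiallyI[of 1], rule eq) simp
qed

lemma sum_Pi_pmf_insert:
  fixes p :: "'a \<Rightarrow> real pmf"
  assumes "finite A" "x \<notin> A"
  shows "map_pmf (\<lambda>\<tau>. \<Sum>i\<in>insert x A. \<tau> i) (Pi_pmf (insert x A) 0 p) =
    map_pmf (\<lambda>(y, s). y + s) (pair_pmf (p x) (map_pmf (\<lambda>\<tau>. \<Sum>i\<in>A. \<tau> i) (Pi_pmf A 0 p)))"
proof -
  have "(\<Sum>i\<in>insert x A. (f(x := y)) i) = y + (\<Sum>i\<in>A. f i)" for f :: "'a \<Rightarrow> real" and y
    using assms by (auto intro!: sum.cong)
  then show ?thesis
    using assms by (simp add: Pi_pmf_insert map_pmf_comp pair_map_pmf2 case_prod_unfold o_def del: sum.insert)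
qed

text \<open>Only the number of non-silent slots matters. For \<open>n \<le> N\<close> truncated
  subtraction makes the right side the law of the empty sum.\<close>

lemma sum_Pi_pmf_shift:
  fixes n N :: nat
  shows "map_pmf (\<lambda>\<tau>. \<Sum>i=1..n. \<tau> i) (Pi_pmf {1..n} 0 (\<lambda>i. if i \<le> N then return_pmf 0 else L)) =
    map_pmf (\<lambda>\<tau>. \<Sum>i<n-N. \<tau> i) (Pi_pmf {..<n-N} 0 (\<lambda>_. L :: real pmf))"
proof (induction n)
  case (Suc n)
  have "{1..Suc n} = insert (Suc n) {1..n}" by auto
  then have *: "map_pmf (\<lambda>\<tau>. \<Sum>i=1..Suc n. \<tau> i) (Pi_pmf {1..Suc n} 0 (\<lambda>i. if i \<le> N then return_pmf 0 else L))
      = map_pmf (\<lambda>(y, s). y + s) (pair_pmf (if Suc n \<le> N then return_pmf 0 else L)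
          (map_pmf (\<lambda>\<tau>. \<Sum>i<n-N. \<tau> i) (Pi_pmf {..<n-N} 0 (\<lambda>_. L))))"
    using sum_Pi_pmf_insert[of "{1..n}" "Suc n" "\<lambda>i. if i \<le> N then return_pmf 0 else L"] Suc.IH by simp
  show ?case
  proof (cases "Suc n \<le> N")
    case True
    then show ?thesis by (subst *) (simp add: pair_return_pmf1 map_pmf_comp)
  next
    case False
    then have "{..<Suc n - N} = insert (n - N) {..<n - N}" by auto
    with False show ?thesis
      using sum_Pi_pmf_insert[of "{..<n - N}" "n - N" "\<lambda>_. L"] by (subst *) (simp del: sum.insert)
  qed
qed simp

text \<open>Fubini's theorem; for a finitely supported second factor, integrability of every section
  suffices.\<close>

lemma integral_pair_pmf:
  fixes F :: "'a \<Rightarrow> 'b \<Rightarrow> real"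
  assumes "prob_space M" and fin: "finite (set_pmf q)"
    and meas [measurable]: "(\<lambda>(\<omega>, x). F \<omega> x) \<in> borel_measurable (M \<Otimes>\<^sub>M measure_pmf q)"
    and int: "\<And>x. integrable M (\<lambda>\<omega>. F \<omega> x)"
  shows "integrable (M \<Otimes>\<^sub>M measure_pmf q) (\<lambda>(\<omega>, x). F \<omega> x)"
    and "(\<integral>(\<omega>, x). F \<omega> x \<partial>(M \<Otimes>\<^sub>M measure_pmf q)) = measure_pmf.expectation q (\<lambda>x. \<integral>\<omega>. F \<omega> x \<partial>M)"
proof -
  interpret prob_space M by fact
  interpret pair_sigma_finite M "measure_pmf q" ..
  have *: "measure_pmf.expectation q h = (\<Sum>x\<in>set_pmf q. pmf q x * h x)" for h :: "'b \<Rightarrow> real"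
    using fin by (subst integral_measure_pmf[of "set_pmf q"]) auto
  show "integrable (M \<Otimes>\<^sub>M measure_pmf q) (\<lambda>(\<omega>, x). F \<omega> x)"
    by (rule Fubini_integrable[OF meas]) (auto simp: * integrable_measure_pmf_finite fin int)
  from integral_snd[OF this]
  show "(\<integral>(\<omega>, x). F \<omega> x \<partial>(M \<Otimes>\<^sub>M measure_pmf q)) = measure_pmf.expectation q (\<lambda>x. \<integral>\<omega>. F \<omega> x \<partial>M)"
    by simp
qed

text \<open>For fixed \<open>y\<close> the independence of the \<open>X i\<close> factorises the
  slice into functions of single coordinates of \<open>y\<close>; integrating over the independent
  coordinates of \<open>Pi_pmf\<close> factorises the whole. This makes the maximal inequality
  available for energies and random codeword jointly.\<close>

lemma indep_vars_pair_Pi_pmf: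
  fixes X :: "'i \<Rightarrow> 'a \<Rightarrow> real" and h :: "'i \<Rightarrow> 'b \<Rightarrow> real"
  assumes M: "prob_space M" and fin: "finite I" and indep: "prob_space.indep_vars M (\<lambda>_. borel) X I"
  shows "prob_space.indep_vars (M \<Otimes>\<^sub>M measure_pmf (Pi_pmf I d p)) (\<lambda>_. borel)
    (\<lambda>i (\<omega>, y). h i (y i) - X i \<omega>) I"
proof (cases "I = {}")
  case True
  interpret prob_space M by fact
  interpret pair_prob_space M "measure_pmf (Pi_pmf I d p)" ..
  show ?thesis by (subst P.indep_vars_def, subst P.indep_sets_def) (simp add: True)
next
  case False
  interpret M1: prob_space M by fact
  let ?q = "Pi_pmf I d p"
  interpret pair_prob_space M "measure_pmf ?q" ..
  let ?Z = "\<lambda>i (\<omega>, y). h i (y i) - X i \<omega>"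
  have X [measurable]: "X i \<in> borel_measurable M" if "i \<in> I" for i
    using indep that by (auto simp: prob_space.indep_vars_def[OF M])
  have Z [measurable]: "?Z i \<in> borel_measurable (M \<Otimes>\<^sub>M measure_pmf ?q)" if i: "i \<in> I" for i
  proof -
    have [measurable]: "(\<lambda>y. h i (y i)) \<in> borel_measurable (measure_pmf ?q)" by simp
    note X[OF i, measurable]
    show ?thesis by measurable
  qed
  define \<phi> where "\<phi> A j u = emeasure M {\<omega>\<in>space M. h j u - X j \<omega> \<in> A}" for A j u
  have single: "emeasure (M \<Otimes>\<^sub>M measure_pmf ?q) (?Z j -` A \<inter> space (M \<Otimes>\<^sub>M measure_pmf ?q))
      = (\<integral>\<^sup>+u. \<phi> A j u \<partial>measure_pmf (p j))" if j: "j \<in> I" and A: "A \<in> sets borel" for j A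
  proof -
    have "emeasure (M \<Otimes>\<^sub>M measure_pmf ?q) (?Z j -` A \<inter> space (M \<Otimes>\<^sub>M measure_pmf ?q))
        = (\<integral>\<^sup>+y. \<phi> A j (y j) \<partial>measure_pmf ?q)"
      by (subst emeasure_pair_measure_alt2[OF measurable_sets[OF Z[OF j] A]])
         (auto simp: \<phi>_def space_pair_measure intro!: nn_integral_cong arg_cong[where f = "emeasure M"])
    also have "\<dots> = (\<integral>\<^sup>+u. \<phi> A j u \<partial>measure_pmf (map_pmf (\<lambda>y. y j) ?q))"
      by simp
    also have "map_pmf (\<lambda>y. y j) ?q = p j"
      using j fin by (simp add: Pi_pmf_component)
    finally show ?thesis .
  qed
  show ?thesis
  proof (subst P.indep_vars_finite[OF False fin, where E = "\<lambda>_. sets borel"])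
    show "\<forall>A\<in>I \<rightarrow> sets borel. P.prob (\<Inter>j\<in>I. ?Z j -` A j \<inter> space (M \<Otimes>\<^sub>M measure_pmf ?q))
        = (\<Prod>j\<in>I. P.prob (?Z j -` A j \<inter> space (M \<Otimes>\<^sub>M measure_pmf ?q)))"
    proof
      fix A assume A: "A \<in> I \<rightarrow> sets (borel :: real measure)"
      let ?S = "\<Inter>j\<in>I. ?Z j -` A j \<inter> space (M \<Otimes>\<^sub>M measure_pmf ?q)"
      have S: "?S \<in> sets (M \<Otimes>\<^sub>M measure_pmf ?q)"
        using A False fin by (intro sets.finite_INT measurable_sets[OF Z]) auto
      have slice: "emeasure M ((\<lambda>\<omega>. (\<omega>, y)) -` ?S) = (\<Prod>j\<in>I. \<phi> (A j) j (y j))" for y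
      proof -
        have "prob_space.indep_vars M (\<lambda>_. borel) (\<lambda>j \<omega>. h j (y j) - X j \<omega>) I"
          by (rule prob_space.indep_vars_compose2[OF M indep, where Y = "\<lambda>j x. h j (y j) - x"]) auto
        from prob_space.indep_varsD_finite[OF M this False fin, of A]
        have "measure M (\<Inter>j\<in>I. (\<lambda>\<omega>. h j (y j) - X j \<omega>) -` A j \<inter> space M)
            = (\<Prod>j\<in>I. measure M ((\<lambda>\<omega>. h j (y j) - X j \<omega>) -` A j \<inter> space M))"
          using A by (simp only: Pi_iff)
        moreover have "(\<lambda>\<omega>. (\<omega>, y)) -` ?S = (\<Inter>j\<in>I. (\<lambda>\<omega>. h j (y j) - X j \<omega>) -` A j \<inter> space M)"
          using False by (auto simp: space_pair_measure)
        moreover have "\<phi> (A j) j (y j) = ennreal (measure M ((\<lambda>\<omega>. h j (y j) - X j \<omega>) -` A j \<inter> space M))" for j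
          by (auto simp: \<phi>_def M1.emeasure_eq_measure intro!: arg_cong[where f = "measure M"])
        ultimately show ?thesis by (simp add: M1.emeasure_eq_measure prod_ennreal)
      qed
      have "ennreal (P.prob ?S) = (\<integral>\<^sup>+y. (\<Prod>j\<in>I. \<phi> (A j) j (y j)) \<partial>measure_pmf ?q)"
        by (simp only: P.emeasure_eq_measure[symmetric] emeasure_pair_measure_alt2[OF S] slice)
      also have "\<dots> = (\<Prod>j\<in>I. \<integral>\<^sup>+u. \<phi> (A j) j u \<partial>measure_pmf (p j))"
        by (rule nn_integral_prod_Pi_pmf[OF fin])
      also have "\<dots> = (\<Prod>j\<in>I. ennreal (P.prob (?Z j -` A j \<inter> space (M \<Otimes>\<^sub>M measure_pmf ?q))))"
      proof (intro prod.cong refl)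
        fix j assume j: "j \<in> I"
        with A have "A j \<in> sets borel" by auto
        from single[OF j this, unfolded P.emeasure_eq_measure]
        show "(\<integral>\<^sup>+u. \<phi> (A j) j u \<partial>measure_pmf (p j)) = ennreal (P.prob (?Z j -` A j \<inter> space (M \<Otimes>\<^sub>M measure_pmf ?q)))"
          by (rule sym)
      qed
      also have "\<dots> = ennreal (\<Prod>j\<in>I. P.prob (?Z j -` A j \<inter> space (M \<Otimes>\<^sub>M measure_pmf ?q)))"
        by (rule prod_ennreal) simp
      finally show "P.prob ?S = (\<Prod>j\<in>I. P.prob (?Z j -` A j \<inter> space (M \<Otimes>\<^sub>M measure_pmf ?q)))"
        by (subst (asm) ennreal_inj) (auto intro: prod_nonneg)
    qed
  qed (use Z in \<open>auto simp: Int_stable_def sets.sigma_sets_eq[of borel, simplified]\<close>)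
qed

section \<open>The achievable bound\<close>

lemma Pi_pmf_map_dependent:
  assumes "finite A"
  shows "Pi_pmf A d' (\<lambda>i. map_pmf (g i) (q i)) = map_pmf (\<lambda>f i. if i \<in> A then g i (f i) else d') (Pi_pmf A d q)"
  using assms unfolding map_pmf_def by (subst Pi_pmf_bind[where d' = d]) simp_all

definition info_law :: "real \<Rightarrow> ('x::finite \<Rightarrow> 'y::finite pmf) \<Rightarrow> 'x pmf \<Rightarrow> real pmf" where
  "info_law b W P = bind_pmf P (\<lambda>x. map_pmf (info_density b W P x) (W x))"

lemma finite_set_info_law: "finite (set_pmf (info_law b W P))"
  by (simp add: info_law_def)

lemma expectation_info_law:
  fixes h :: "real \<Rightarrow> real"
  shows "measure_pmf.expectation (info_law b W P) h =
    (\<Sum>x\<in>UNIV. \<Sum>y\<in>UNIV. pmf P x * pmf (W x) y * h (info_density b W P x y))"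
  unfolding info_law_def
  by (subst pmf_expectation_bind[of UNIV]) (auto simp: expectation_sum_UNIV sum_distrib_left mult.assoc)

lemma info_law_mean: "measure_pmf.expectation (info_law b W P) (\<lambda>x. x) = mutual_info b W P"
  by (simp add: expectation_info_law mutual_info_def)

lemma info_law_variance:
  "measure_pmf.expectation (info_law b W P) (\<lambda>x. (x - mutual_info b W P)\<^sup>2) = info_variance b W P"
proof -
  have "measure_pmf.expectation (info_law b W P) (\<lambda>x. (x - mutual_info b W P)\<^sup>2)
      = measure_pmf.expectation (info_law b W P) (\<lambda>x. x\<^sup>2) - (mutual_info b W P)\<^sup>2"
    using measure_pmf.variance_eq[of "info_law b W P" "\<lambda>x. x"]
    by (simp add: integrable_measure_pmf_finite finite_set_info_law info_law_mean)
  then show ?thesis by (simp add: expectation_info_law info_variance_def)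
qed

lemma info_variance_nonneg: "0 \<le> info_variance b W P"
  by (simp flip: info_law_variance)

lemma mutual_info_nonneg:
  assumes "1 < b"
  shows "0 \<le> mutual_info b W P"
  unfolding mutual_info_kl
proof (rule sum_nonneg)
  fix x
  show "0 \<le> pmf P x * kl b (W x) (bind_pmf P W)"
  proof (cases "x \<in> set_pmf P")
    case True
    then have "set_pmf (W x) \<subseteq> set_pmf (bind_pmf P W)" by auto
    then show ?thesis by (intro mult_nonneg_nonneg kl_nonneg[OF assms]) auto
  qed (simp add: set_pmf_iff)
qed

text \<open>The \<open>- 1\<close> serves the degenerate case \<open>v = 0\<close>: the sum is then
  constantly \<open>k * m\<close>, and without the shift the event would be certain instead of
  empty. It costs a constant in the rate.\<close>

lemma iid_sum_lower_tail:
  fixes L :: "real pmf"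
  assumes fin: "finite (set_pmf L)" and mean: "measure_pmf.expectation L (\<lambda>x. x) = m"
    and var: "measure_pmf.expectation L (\<lambda>x. (x - m)\<^sup>2) = v" and \<delta>: "0 < \<delta>"
  shows "\<forall>\<^sub>F k in sequentially. measure_pmf.prob (Pi_pmf {..<k} 0 (\<lambda>_. L))
    {\<tau>. (\<Sum>i<k. \<tau> i) \<le> real k * m + sqrt (real k * v) * z - 1} \<le> Phi z + \<delta>"
proof (cases "0 < v")
  case True
  have "\<forall>\<^sub>F k in sequentially. measure_pmf.prob (Pi_pmf {..<k} 0 (\<lambda>_. L))
    {\<tau>. (\<Sum>i<k. \<tau> i) \<le> real k * m + sqrt (real k * v) * z} < Phi z + \<delta>"
    using order_tendstoD(2)[OF iid_sum_CLT[OF fin mean var True, of z]] \<delta> by simp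
  then show ?thesis
  proof eventually_elim
    case (elim k)
    have "measure_pmf.prob (Pi_pmf {..<k} 0 (\<lambda>_. L)) {\<tau>. (\<Sum>i<k. \<tau> i) \<le> real k * m + sqrt (real k * v) * z - 1}
      \<le> measure_pmf.prob (Pi_pmf {..<k} 0 (\<lambda>_. L)) {\<tau>. (\<Sum>i<k. \<tau> i) \<le> real k * m + sqrt (real k * v) * z}"
      by (rule measure_pmf.finite_measure_mono) auto
    with elim show ?case by linarith
  qed
next
  case False
  moreover have "0 \<le> v" by (simp flip: var)
  ultimately have v0: "v = 0" by simp
  have L: "x = m" if "x \<in> set_pmf L" for x
  proof -
    have "AE x in measure_pmf L. (x - m)\<^sup>2 = 0"
      using var v0 integral_nonneg_eq_0_iff_AE[of "measure_pmf L" "\<lambda>x. (x - m)\<^sup>2"]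
      by (simp add: integrable_measure_pmf_finite fin)
    then show ?thesis using that by (auto simp: AE_measure_pmf_iff)
  qed
  have "measure_pmf.prob (Pi_pmf {..<k} 0 (\<lambda>_. L)) {\<tau>. (\<Sum>i<k. \<tau> i) \<le> real k * m + sqrt (real k * v) * z - 1} = 0" for k
  proof -
    have "\<tau> i = m" if "\<tau> \<in> set_pmf (Pi_pmf {..<k} 0 (\<lambda>_. L))" "i < k" for \<tau> i
      using that by (auto simp: set_Pi_pmf PiE_dflt_def intro: L)
    then have "(\<Sum>i<k. \<tau> i) = (\<Sum>i<k. m)" if "\<tau> \<in> set_pmf (Pi_pmf {..<k} 0 (\<lambda>_. L))" for \<tau>
      using that by (intro sum.cong) auto
    then have "(\<Sum>i<k. \<tau> i) = real k * m" if "\<tau> \<in> set_pmf (Pi_pmf {..<k} 0 (\<lambda>_. L))" for \<tau>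
      using that by simp
    then show ?thesis
      by (auto simp: measure_pmf_zero_iff v0)
  qed
  moreover have "0 \<le> Phi z" by (simp add: Phi_def cdf_def)
  ultimately show ?thesis using \<delta> by simp
qed

definition delayed_input :: "nat \<Rightarrow> nat \<Rightarrow> 'x \<Rightarrow> 'x pmf \<Rightarrow> (nat \<Rightarrow> 'x) pmf" where
  "delayed_input n N x\<^sub>0 P = Pi_pmf {1..n} x\<^sub>0 (\<lambda>i. if i \<le> N then return_pmf x\<^sub>0 else P)"

lemma finite_set_delayed_input: "finite (set_pmf (delayed_input n N x\<^sub>0 (P :: 'x::finite pmf)))"
  unfolding delayed_input_def by (rule finite_set_Pi_pmf) auto

text \<open>The output law of the whole delayed input is a product with factor
  \<open>W x\<^sub>0\<close> in the silent slots. There the log-likelihood ratio is log 1 = 0,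
  elsewhere it is the information density, so averaging over codewords leaves a sum of
  \<open>n - N\<close> independent copies of \<open>info_law\<close>.\<close>

lemma expected_unlikely_output:
  fixes W :: "'x::finite \<Rightarrow> 'y::finite pmf" and P :: "'x pmf" and x\<^sub>0 :: 'x and n N :: nat
  assumes b: "1 < b"
  defines "p \<equiv> delayed_input n N x\<^sub>0 P"
  shows "measure_pmf.expectation p (\<lambda>x. measure_pmf.prob (channel_output W n x)
      (- {y. b powr s * pmf (bind_pmf p (channel_output W n)) y < pmf (channel_output W n x) y}))
    = measure_pmf.prob (Pi_pmf {..<n-N} 0 (\<lambda>_. info_law b W P)) {\<tau>. (\<Sum>i<n-N. \<tau> i) \<le> s}"
proof -
  define pin where "pin i = (if i \<le> N then return_pmf x\<^sub>0 else P)" for i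
  define dens where "dens i x y = log b (pmf (W x) y / pmf (bind_pmf (pin i) W) y)" for i x y
  define G where "G x = Pi_pmf {1..n} 0 (\<lambda>i. map_pmf (dens i (x i)) (W (x i)))" for x
  have p: "p = Pi_pmf {1..n} x\<^sub>0 pin" by (simp add: p_def delayed_input_def pin_def[abs_def])
  have Q: "bind_pmf p (channel_output W n) = Pi_pmf {1..n} undefined (\<lambda>i. bind_pmf (pin i) W)"
    unfolding p channel_output_def[abs_def] by (rule Pi_pmf_bind[symmetric]) simp
  have "measure_pmf.expectation p (\<lambda>x. measure_pmf.prob (channel_output W n x)
      (- {y. b powr s * pmf (bind_pmf p (channel_output W n)) y < pmf (channel_output W n x) y}))
    = measure_pmf.expectation p (\<lambda>x. measure_pmf.prob (G x) {\<tau>. (\<Sum>i=1..n. \<tau> i) \<le> s})"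
  proof (intro integral_cong_AE AE_pmfI)
    fix x assume x: "x \<in> set_pmf p"
    have "measure_pmf.prob (G x) {\<tau>. (\<Sum>i=1..n. \<tau> i) \<le> s}
        = measure_pmf.prob (channel_output W n x) {y. (\<Sum>i=1..n. dens i (x i) (y i)) \<le> s}"
      unfolding G_def channel_output_def
      by (subst Pi_pmf_map_dependent[where d = undefined]) (auto simp: vimage_def)
    also have "\<dots> = measure_pmf.prob (channel_output W n x)
        (- {y. b powr s * pmf (bind_pmf p (channel_output W n)) y < pmf (channel_output W n x) y})"
    proof (intro measure_pmf.finite_measure_eq_AE AE_pmfI)
      fix y assume y: "y \<in> set_pmf (channel_output W n x)"
      have supp: "y i \<in> set_pmf (W (x i))" "x i \<in> set_pmf (pin i)" if "i \<in> {1..n}" for i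
        using x y that by (auto simp: p channel_output_def set_Pi_pmf PiE_dflt_def)
      have "b powr s * pmf (bind_pmf p (channel_output W n)) y < pmf (channel_output W n x) y
          \<longleftrightarrow> s < (\<Sum>i=1..n. dens i (x i) (y i))"
        unfolding Q channel_output_def dens_def
      proof (rule log_pmf_Pi[OF b])
        show "0 < pmf (bind_pmf (pin i) W) (y i)" if "i \<in> {1..n}" for i
          using supp[OF that] by (intro pmf_positive) auto
        show "y i = undefined" if "i \<notin> {1..n}" for i
          using y that by (auto simp: channel_output_def set_Pi_pmf PiE_dflt_def)
      qed (use supp in \<open>auto intro: pmf_positive\<close>)
      then show "y \<in> {y. (\<Sum>i=1..n. dens i (x i) (y i)) \<le> s} \<longleftrightarrow>
          y \<in> - {y. b powr s * pmf (bind_pmf p (channel_output W n)) y < pmf (channel_output W n x) y}"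
        by auto
    qed auto
    finally show "measure_pmf.prob (channel_output W n x)
        (- {y. b powr s * pmf (bind_pmf p (channel_output W n)) y < pmf (channel_output W n x) y})
      = measure_pmf.prob (G x) {\<tau>. (\<Sum>i=1..n. \<tau> i) \<le> s}" ..
  qed auto
  \<comment> \<open>From here on codeword and densities are drawn jointly; both steps are products
    over slots, so they can be bound slot by slot.\<close>
  also have "\<dots> = measure_pmf.prob (bind_pmf p G) {\<tau>. (\<Sum>i=1..n. \<tau> i) \<le> s}"
    by (rule prob_bind_pmf[symmetric]) (simp add: p_def finite_set_delayed_input)
  also have "bind_pmf p G = Pi_pmf {1..n} 0 (\<lambda>i. bind_pmf (pin i) (\<lambda>x. map_pmf (dens i x) (W x)))"
    unfolding p G_def[abs_def] by (rule Pi_pmf_bind[symmetric]) simp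
  also have "\<dots> = Pi_pmf {1..n} 0 (\<lambda>i. if i \<le> N then return_pmf 0 else info_law b W P)"
  proof (intro Pi_pmf_cong refl)
    fix i :: nat
    show "bind_pmf (pin i) (\<lambda>x. map_pmf (dens i x) (W x)) = (if i \<le> N then return_pmf 0 else info_law b W P)"
    proof (cases "i \<le> N")
      case True
      have "map_pmf (dens i x\<^sub>0) (W x\<^sub>0) = map_pmf (\<lambda>_. 0) (W x\<^sub>0)"
        using True by (intro map_pmf_cong) (auto simp: dens_def pin_def bind_return_pmf set_pmf_iff)
      then show ?thesis using True by (simp add: pin_def bind_return_pmf)
    next
      case False
      then have "dens i = info_density b W P"
        by (simp add: fun_eq_iff dens_def info_density_def pin_def)
      then show ?thesis using False by (simp add: pin_def info_law_def)
    qed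
  qed
  also have "measure_pmf.prob \<dots> {\<tau>. (\<Sum>i=1..n. \<tau> i) \<le> s} = measure_pmf.prob
      (map_pmf (\<lambda>\<tau>. \<Sum>i=1..n. \<tau> i) (Pi_pmf {1..n} 0 (\<lambda>i. if i \<le> N then return_pmf 0 else info_law b W P))) {..s}"
    by (simp add: vimage_def)
  also have "\<dots> = measure_pmf.prob (Pi_pmf {..<n-N} 0 (\<lambda>_. info_law b W P)) {\<tau>. (\<Sum>i<n-N. \<tau> i) \<le> s}"
    unfolding sum_Pi_pmf_shift by (simp add: vimage_def)
  finally show ?thesis .
qed

section \<open>Energy outage of the delayed random input\<close>

context eh_channel
begin

text \<open>
  Either the first \<open>N\<close> slots collect less than three quarters of their mean energy, or the later net
  consumption exceeds those three quarters.
\<close>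

lemma outage_le:
  assumes N: "1 \<le> N" "N \<le> n" and d: "0 \<le> d" and x: "\<And>i. i \<in> {1..N} \<Longrightarrow> x i = x\<^sub>0"
  shows "outage_prob \<Omega> E \<Lambda> n x \<le> 16 * varE / (real N * avgE\<^sup>2) +
    prob {\<omega>\<in>space \<Omega>. \<exists>k\<in>{1..n}. 3 / 4 * real N * avgE
      \<le> (\<Sum>i=1..k. (if i \<le> N then 0 else \<Lambda> (x i) + d) - (if i \<le> N then 0 else E i \<omega>))}"
proof -
  have a: "0 < avgE" using harvest_pos by (simp add: avgE_def)
  define Z where "Z i \<omega> = (if i \<le> N then 0 else \<Lambda> (x i) + d) - (if i \<le> N then 0 else E i \<omega>)" for i \<omega>
  \<comment> \<open>The shortage allowed in the silent phase is a quarter of its mean energy; the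
    square of 4 reappears as the factor 16.\<close>
  define S where "S = {\<omega>\<in>space \<Omega>. \<exists>k\<in>{1..N}. real N * avgE / 4 \<le> (\<Sum>i=1..k. - 1 * (E i \<omega> - avgE))}"
  define T where "T = {\<omega>\<in>space \<Omega>. \<exists>k\<in>{1..n}. 3 / 4 * real N * avgE \<le> (\<Sum>i=1..k. Z i \<omega>)}"
  have [measurable]: "(\<lambda>\<omega>. \<Sum>i=1..k. - 1 * (E i \<omega> - avgE)) \<in> borel_measurable \<Omega>"
    "(\<lambda>\<omega>. \<Sum>i=1..k. Z i \<omega>) \<in> borel_measurable \<Omega>" for k
    unfolding Z_def by (intro borel_measurable_sum borel_measurable_times borel_measurable_diff; auto)+
  have [measurable]: "S \<in> events" unfolding S_def by measurable
  have [measurable]: "T \<in> events" unfolding T_def by measurable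
  have S: "prob S \<le> 16 * varE / (real N * avgE\<^sup>2)"
  proof -
    have "prob S \<le> real N * varE / (real N * avgE / 4)\<^sup>2"
      unfolding S_def using E_deviation[of "real N * avgE / 4" "-1" N] a N by simp
    also have "\<dots> = 16 * varE / (real N * avgE\<^sup>2)"
      using N a by (simp add: power2_eq_square field_simps)
    finally show ?thesis .
  qed
  have "AE \<omega> in \<Omega>. \<forall>i\<in>{1..n}. 0 \<le> E i \<omega>"
    by (intro AE_finite_allI harvest_nonneg) auto
  then have "outage_prob \<Omega> E \<Lambda> n x \<le> prob (S \<union> T)"
    unfolding outage_prob_def
  proof (intro finite_measure_mono_AE, elim AE_mp, intro AE_I2 impI)
    fix \<omega> assume \<omega>: "\<omega> \<in> space \<Omega>" and pos: "\<forall>i\<in>{1..n}. 0 \<le> E i \<omega>"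
      and "\<omega> \<in> {\<omega> \<in> space \<Omega>. \<exists>k\<in>{1..n}. (\<Sum>i=1..k. E i \<omega>) < (\<Sum>i=1..k. \<Lambda> (x i))}"
    then obtain k where k: "k \<in> {1..n}" and less: "(\<Sum>i=1..k. E i \<omega>) < (\<Sum>i=1..k. \<Lambda> (x i))" by auto
    show "\<omega> \<in> S \<union> T"
    proof (cases "\<omega> \<in> S")
      case False
      have x0: "(\<Sum>i=1..j. \<Lambda> (x i)) = 0" if "j \<le> N" for j
        using that x zero_energy by (intro sum.neutral) auto
      \<comment> \<open>Silent slots cost nothing, so a violation can only occur after slot
        \<open>N\<close>.\<close>
      have "N < k"
      proof (rule ccontr)
        assume "\<not> N < k"
        then have "(\<Sum>i=1..k. E i \<omega>) < 0" using less x0[of k] by simp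
        moreover have "0 \<le> (\<Sum>i=1..k. E i \<omega>)" using pos k by (intro sum_nonneg) auto
        ultimately show False by simp
      qed
      then have split: "(\<Sum>i=1..k. f i) = (\<Sum>i=1..N. f i) + (\<Sum>i=Suc N..k. f i)" for f :: "nat \<Rightarrow> real"
        using sum.ub_add_nat[of 1 N f "k - N"] N by simp
      have "(\<Sum>i=1..N. - 1 * (E i \<omega> - avgE)) < real N * avgE / 4"
        using False \<omega> N by (auto simp: S_def not_le)
      then have "3 / 4 * real N * avgE \<le> (\<Sum>i=1..N. E i \<omega>)"
        by (simp add: sum_subtractf sum_negf)
      also have "\<dots> \<le> (\<Sum>i=Suc N..k. \<Lambda> (x i)) - (\<Sum>i=Suc N..k. E i \<omega>)"
        using less split[of "\<lambda>i. E i \<omega>"] split[of "\<lambda>i. \<Lambda> (x i)"] x0[of N] by simp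
      also have "\<dots> = (\<Sum>i=Suc N..k. \<Lambda> (x i) - E i \<omega>)" by (simp add: sum_subtractf)
      \<comment> \<open>Padding by \<open>d\<close> only enlarges the sum. Later \<open>d\<close> is
        the gap between mean harvest and mean cost, which centres the summands.\<close>
      also have "\<dots> \<le> (\<Sum>i=Suc N..k. Z i \<omega>)"
        using d by (intro sum_mono) (auto simp: Z_def)
      also have "\<dots> = (\<Sum>i=1..k. Z i \<omega>)"
      proof -
        have "(\<Sum>i=1..N. Z i \<omega>) = 0" by (intro sum.neutral) (simp add: Z_def)
        then show ?thesis using split[of "\<lambda>i. Z i \<omega>"] by simp
      qed
      finally show ?thesis using \<omega> k by (auto simp: T_def)
    qed simp
  qed auto
  also have "\<dots> \<le> prob S + prob T" by (rule measure_Un_le) auto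
  finally show ?thesis using S by (simp add: T_def Z_def)
qed

text \<open>A fixed codeword may consume far from the average, but on the product space the padded
  net consumptions are independent, centred, and of second moment at most
  \<open>varE + measure_pmf.variance P \<Lambda>\<close>. The maximal inequality applies there, and
  Fubini's theorem turns its probability into the average over codewords.\<close>

lemma expected_outage:
  assumes P: "measure_pmf.expectation P \<Lambda> \<le> avgE" and N: "1 \<le> N" "N \<le> n"
  shows "measure_pmf.expectation (delayed_input n N x\<^sub>0 P) (outage_prob \<Omega> E \<Lambda> n)
    \<le> 16 * varE / (real N * avgE\<^sup>2) +
      real n * (varE + measure_pmf.variance P \<Lambda>) / (3 / 4 * real N * avgE)\<^sup>2"
proof -
  let ?p = "delayed_input n N x\<^sub>0 P" and ?\<Lambda> = "measure_pmf.expectation P \<Lambda>"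
  define d where "d = avgE - ?\<Lambda>"
  define t where "t = 3 / 4 * real N * avgE"
  have t: "0 < t" using harvest_pos N by (simp add: avgE_def t_def)
  define h where "h i u = (if i \<le> N then 0 else \<Lambda> u + d)" for i u
  define X where "X i \<omega> = (if i \<le> N then 0 else E i \<omega>)" for i \<omega>
  define Z where "Z i = (\<lambda>(\<omega>, x). h i (x i) - X i \<omega>)" for i and x :: "nat \<Rightarrow> 'x"
  have fin: "finite (set_pmf ?p)" by (rule finite_set_delayed_input)
  have X_meas [measurable]: "X i \<in> borel_measurable \<Omega>" if "1 \<le> i" for i
    using that unfolding X_def by (cases "i \<le> N") auto
  have h_meas [measurable]: "(\<lambda>x. h i (x i)) \<in> borel_measurable (measure_pmf ?p)" for i by simp
  have "indep_vars (\<lambda>_. borel) X {1..n}"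
    unfolding X_def[abs_def]
    by (rule indep_vars_compose2[OF indep_vars_subset[OF indep], where Y = "\<lambda>i e. if i \<le> N then 0 else e"]) auto
  note \<Omega> = prob_space_axioms and prob_1 = prob_space and emeasure_\<Omega> = emeasure_eq_measure
    and Xindep = this
  interpret pair_prob_space \<Omega> "measure_pmf ?p" ..
  have Zindep: "P.indep_vars (\<lambda>_. borel) Z {1..n}"
    unfolding Z_def delayed_input_def by (intro indep_vars_pair_Pi_pmf \<Omega> Xindep) auto
  have comp: "measure_pmf.expectation ?p (\<lambda>x. g (x i)) = measure_pmf.expectation P g"
    if "i \<in> {1..n}" "\<not> i \<le> N" for g :: "'x \<Rightarrow> real" and i
    using that unfolding delayed_input_def by (subst integral_Pi_pmf_component) auto
  have Z_meas [measurable]: "Z i \<in> borel_measurable (\<Omega> \<Otimes>\<^sub>M measure_pmf ?p)" if "1 \<le> i" for i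
    unfolding Z_def using X_meas[OF that] by measurable
  have X_int: "integrable \<Omega> (X i)" "integrable \<Omega> (\<lambda>\<omega>. (X i \<omega>)\<^sup>2)" if "1 \<le> i" for i
    unfolding X_def using E_integrable[OF that] by (cases "i \<le> N"; simp)+
  have int: "integrable \<Omega> (\<lambda>\<omega>. h i (x i) - X i \<omega>)" "integrable \<Omega> (\<lambda>\<omega>. (h i (x i) - X i \<omega>)\<^sup>2)"
    if "1 \<le> i" for i x
    using X_int[OF that] by (auto simp: power2_diff)
  have Zsq_meas: "(\<lambda>(\<omega>, x). (h i (x i) - X i \<omega>)\<^sup>2) \<in> borel_measurable (\<Omega> \<Otimes>\<^sub>M measure_pmf ?p)" if "1 \<le> i" for i
    using X_meas[OF that] by measurable
  have mean: "P.expectation (Z i) = 0" if i: "i \<in> {1..n}" for i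
  proof -
    have "P.expectation (Z i) = measure_pmf.expectation ?p (\<lambda>x. \<integral>\<omega>. h i (x i) - X i \<omega> \<partial>\<Omega>)"
      unfolding Z_def using i Z_meas[of i] int(1)[of i]
      by (intro integral_pair_pmf(2)[OF \<Omega> fin]) (auto simp: Z_def)
    also have "\<dots> = measure_pmf.expectation ?p (\<lambda>x. h i (x i) - (if i \<le> N then 0 else avgE))"
    proof (intro Bochner_Integration.integral_cong refl)
      fix x :: "nat \<Rightarrow> 'x"
      show "(\<integral>\<omega>. h i (x i) - X i \<omega> \<partial>\<Omega>) = h i (x i) - (if i \<le> N then 0 else avgE)"
        using E_integrable(1)[of i] i by (cases "i \<le> N") (simp_all add: X_def E_mean prob_1)
    qed
    also have "\<dots> = 0"
    proof (cases "i \<le> N")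
      case False
      have "measure_pmf.expectation ?p (\<lambda>x. h i (x i) - (if i \<le> N then 0 else avgE))
          = measure_pmf.expectation P (\<lambda>u. \<Lambda> u - ?\<Lambda>)"
        using False comp[OF i False, of "\<lambda>u. \<Lambda> u - ?\<Lambda>"] by (simp add: h_def d_def)
      then show ?thesis by (simp add: integrable_measure_pmf_finite)
    qed (simp add: h_def)
    finally show ?thesis .
  qed
  have second: "integrable (\<Omega> \<Otimes>\<^sub>M measure_pmf ?p) (\<lambda>w. (Z i w)\<^sup>2)"
    "P.expectation (\<lambda>w. (Z i w)\<^sup>2) \<le> varE + measure_pmf.variance P \<Lambda>" if i: "i \<in> {1..n}" for i
  proof -
    have eq: "(\<lambda>w. (Z i w)\<^sup>2) = (\<lambda>(\<omega>, x). (h i (x i) - X i \<omega>)\<^sup>2)"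
      by (auto simp: Z_def)
    have i1: "1 \<le> i" using i by simp
    have F: "integrable (\<Omega> \<Otimes>\<^sub>M measure_pmf ?p) (\<lambda>(\<omega>, x). (h i (x i) - X i \<omega>)\<^sup>2)"
      "P.expectation (\<lambda>(\<omega>, x). (h i (x i) - X i \<omega>)\<^sup>2)
        = measure_pmf.expectation ?p (\<lambda>x. \<integral>\<omega>. (h i (x i) - X i \<omega>)\<^sup>2 \<partial>\<Omega>)"
      by (rule integral_pair_pmf[OF \<Omega> fin Zsq_meas[OF i1]], rule int(2)[OF i1])+
    show "integrable (\<Omega> \<Otimes>\<^sub>M measure_pmf ?p) (\<lambda>w. (Z i w)\<^sup>2)"
      unfolding eq by (rule F(1))
    show "P.expectation (\<lambda>w. (Z i w)\<^sup>2) \<le> varE + measure_pmf.variance P \<Lambda>"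
    proof (cases "i \<le> N")
      case True
      then show ?thesis
        using varE_nonneg measure_pmf.variance_positive[of P \<Lambda>] by (simp add: eq h_def X_def case_prod_unfold)
    next
      case False
      have "(\<integral>\<omega>. (h i u - X i \<omega>)\<^sup>2 \<partial>\<Omega>) = varE + (\<Lambda> u - ?\<Lambda>)\<^sup>2" for u
      proof -
        let ?c = "\<Lambda> u - ?\<Lambda>"
        have "(\<integral>\<omega>. (h i u - X i \<omega>)\<^sup>2 \<partial>\<Omega>) = (\<integral>\<omega>. (?c\<^sup>2 - 2 * ?c * (E i \<omega> - avgE)) + (E i \<omega> - avgE)\<^sup>2 \<partial>\<Omega>)"
          using False by (intro Bochner_Integration.integral_cong refl)
            (simp add: h_def X_def d_def power2_eq_square algebra_simps)
        also have "\<dots> = (\<integral>\<omega>. ?c\<^sup>2 - 2 * ?c * (E i \<omega> - avgE) \<partial>\<Omega>) + (\<integral>\<omega>. (E i \<omega> - avgE)\<^sup>2 \<partial>\<Omega>)"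
          using E_integrable[OF i1] by (intro Bochner_Integration.integral_add) (auto simp: power2_diff)
        also have "(\<integral>\<omega>. ?c\<^sup>2 - 2 * ?c * (E i \<omega> - avgE) \<partial>\<Omega>) = ?c\<^sup>2"
          using E_integrable[OF i1] E_mean[OF i1] by (simp add: prob_1)
        finally show ?thesis using E_variance[OF i1] by simp
      qed
      then have "P.expectation (\<lambda>w. (Z i w)\<^sup>2) = measure_pmf.expectation ?p (\<lambda>x. varE + (\<Lambda> (x i) - ?\<Lambda>)\<^sup>2)"
        unfolding eq F(2) by simp
      also have "\<dots> = measure_pmf.expectation P (\<lambda>u. varE + (\<Lambda> u - ?\<Lambda>)\<^sup>2)"
        by (rule comp[OF i False])
      also have "\<dots> = varE + measure_pmf.variance P \<Lambda>"
        by (simp add: integrable_measure_pmf_finite)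
      finally show ?thesis by simp
    qed
  qed
  define T where "T = {w\<in>space (\<Omega> \<Otimes>\<^sub>M measure_pmf ?p). \<exists>k\<in>{1..n}. t \<le> (\<Sum>i=1..k. Z i w)}"
  have [measurable]: "T \<in> sets (\<Omega> \<Otimes>\<^sub>M measure_pmf ?p)"
  proof -
    have [measurable]: "(\<lambda>w. \<Sum>i=1..k. Z i w) \<in> borel_measurable (\<Omega> \<Otimes>\<^sub>M measure_pmf ?p)" for k
      by (intro borel_measurable_sum Z_meas) auto
    show ?thesis unfolding T_def by measurable
  qed
  have slice: "{\<omega>\<in>space \<Omega>. \<exists>k\<in>{1..n}. t \<le> (\<Sum>i=1..k. h i (x i) - X i \<omega>)} = (\<lambda>\<omega>. (\<omega>, x)) -` T" for x
    by (auto simp: T_def Z_def space_pair_measure)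
  have "measure_pmf.expectation ?p (outage_prob \<Omega> E \<Lambda> n) \<le> measure_pmf.expectation ?p
      (\<lambda>x. 16 * varE / (real N * avgE\<^sup>2) + measure \<Omega> ((\<lambda>\<omega>. (\<omega>, x)) -` T))"
  proof (rule integral_mono_AE)
    show "AE x in measure_pmf ?p. outage_prob \<Omega> E \<Lambda> n x
        \<le> 16 * varE / (real N * avgE\<^sup>2) + measure \<Omega> ((\<lambda>\<omega>. (\<omega>, x)) -` T)"
    proof (rule AE_pmfI)
      fix x assume x: "x \<in> set_pmf ?p"
      have "x i = x\<^sub>0" if "i \<in> {1..N}" for i
        using x that N by (auto simp: delayed_input_def set_Pi_pmf PiE_dflt_def split: if_splits)
      then show "outage_prob \<Omega> E \<Lambda> n x \<le> 16 * varE / (real N * avgE\<^sup>2) + measure \<Omega> ((\<lambda>\<omega>. (\<omega>, x)) -` T)"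
        unfolding slice[symmetric] h_def X_def t_def
        using P by (intro outage_le N) (auto simp: d_def)
    qed
  qed (auto intro: integrable_measure_pmf_finite fin)
  also have "\<dots> = 16 * varE / (real N * avgE\<^sup>2) + measure_pmf.expectation ?p (\<lambda>x. measure \<Omega> ((\<lambda>\<omega>. (\<omega>, x)) -` T))"
    by (simp add: integrable_measure_pmf_finite fin)
  also have "measure_pmf.expectation ?p (\<lambda>x. measure \<Omega> ((\<lambda>\<omega>. (\<omega>, x)) -` T)) = P.prob T"
  proof -
    have "ennreal (P.prob T) = (\<integral>\<^sup>+x. ennreal (measure \<Omega> ((\<lambda>\<omega>. (\<omega>, x)) -` T)) \<partial>measure_pmf ?p)"
      by (simp add: P.emeasure_eq_measure[symmetric] emeasure_pair_measure_alt2 emeasure_\<Omega>)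
    also have "\<dots> = ennreal (measure_pmf.expectation ?p (\<lambda>x. measure \<Omega> ((\<lambda>\<omega>. (\<omega>, x)) -` T)))"
      by (rule nn_integral_eq_integral) (auto intro: integrable_measure_pmf_finite fin)
    finally show ?thesis
      by (subst (asm) ennreal_inj) (auto intro!: integral_nonneg_AE)
  qed
  also have "P.prob T \<le> (\<Sum>i=1..n. P.expectation (\<lambda>w. (Z i w)\<^sup>2)) / t\<^sup>2"
    unfolding T_def by (rule P.kolmogorov_maximal_inequality[OF Zindep second(1) mean t])
  also have "\<dots> \<le> real n * (varE + measure_pmf.variance P \<Lambda>) / t\<^sup>2"
    using sum_mono[of "{1..n}", OF second(2)] by (intro divide_right_mono) auto
  finally show ?thesis by (simp add: t_def)
qed

end

text \<open>Variances of independent variables add: for fixed \<open>x\<close> the cross term is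
  linear in the centred harvest and integrates to 0. This ties the saving constant to the second
  moment in the outage bound.\<close>

lemma delta_variance_eq:
  assumes \<Omega>: "prob_space \<Omega>" and int: "integrable \<Omega> X" "integrable \<Omega> (\<lambda>\<omega>. (X \<omega>)\<^sup>2)"
  shows "delta_variance \<Omega> X \<Lambda> P = prob_space.variance \<Omega> X + measure_pmf.variance P \<Lambda>"
proof -
  interpret prob_space \<Omega> by fact
  have [measurable]: "X \<in> borel_measurable \<Omega>" using int(1) by auto
  have [measurable]: "\<Lambda> \<in> borel_measurable (measure_pmf P)" by simp
  have fin: "finite (set_pmf P)" by simp
  let ?X = "expectation X" and ?\<Lambda> = "measure_pmf.expectation P \<Lambda>"
  have mean: "(\<integral>(\<omega>, x). X \<omega> - \<Lambda> x \<partial>(\<Omega> \<Otimes>\<^sub>M measure_pmf P)) = ?X - ?\<Lambda>"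
    by (subst integral_pair_pmf(2)[OF \<Omega> fin]) (auto simp: int prob_space integrable_measure_pmf_finite)
  have "(\<integral>\<omega>. (X \<omega> - \<Lambda> x - (?X - ?\<Lambda>))\<^sup>2 \<partial>\<Omega>) = variance X + (\<Lambda> x - ?\<Lambda>)\<^sup>2" for x
  proof -
    let ?c = "\<Lambda> x - ?\<Lambda>"
    have "(\<integral>\<omega>. (X \<omega> - \<Lambda> x - (?X - ?\<Lambda>))\<^sup>2 \<partial>\<Omega>)
        = (\<integral>\<omega>. (?c\<^sup>2 - 2 * ?c * (X \<omega> - ?X)) + (X \<omega> - ?X)\<^sup>2 \<partial>\<Omega>)"
      by (intro Bochner_Integration.integral_cong refl) (simp add: power2_eq_square algebra_simps)
    also have "\<dots> = (\<integral>\<omega>. ?c\<^sup>2 - 2 * ?c * (X \<omega> - ?X) \<partial>\<Omega>) + variance X"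
      using int by (intro Bochner_Integration.integral_add) (auto simp: power2_diff)
    also have "(\<integral>\<omega>. ?c\<^sup>2 - 2 * ?c * (X \<omega> - ?X) \<partial>\<Omega>) = ?c\<^sup>2"
      using int by (simp add: prob_space)
    finally show ?thesis by simp
  qed
  moreover have "integrable \<Omega> (\<lambda>\<omega>. (X \<omega> - \<Lambda> x - (?X - ?\<Lambda>))\<^sup>2)" for x
    using int by (simp add: power2_diff)
  moreover have "(\<lambda>w. ((\<lambda>(\<omega>, x). X \<omega> - \<Lambda> x) w - (?X - ?\<Lambda>))\<^sup>2) = (\<lambda>(\<omega>, x). (X \<omega> - \<Lambda> x - (?X - ?\<Lambda>))\<^sup>2)"
    by auto
  ultimately show ?thesis
    unfolding delta_variance_def mean
    using integral_pair_pmf(2)[OF \<Omega> fin, of "\<lambda>\<omega> x. (X \<omega> - \<Lambda> x - (?X - ?\<Lambda>))\<^sup>2"]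
    by (simp add: integrable_measure_pmf_finite)
qed

lemma eventually_sqrt_ge: "\<forall>\<^sub>F n in sequentially. c \<le> sqrt (real n)"
proof (rule eventually_sequentiallyI[of "nat \<lceil>c\<^sup>2\<rceil>"])
  fix n assume "nat \<lceil>c\<^sup>2\<rceil> \<le> n"
  then have "c\<^sup>2 \<le> real n" by linarith
  then show "c \<le> sqrt (real n)" by (rule real_le_rsqrt)
qed

text \<open>Dropping \<open>N\<close> slots changes the square root by at most
  \<open>N / sqrt n\<close>, which stays bounded when \<open>N\<close> is of order
  \<open>sqrt n\<close>.\<close>

lemma sqrt_diff_ge:
  assumes "1 \<le> n" "N \<le> n"
  shows "sqrt (real n) - real N / sqrt (real n) \<le> sqrt (real (n - N))"
proof (rule real_le_rsqrt)
  have n: "0 < real n" "real N \<le> real n" using assms by auto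
  have "(sqrt (real n) - real N / sqrt (real n))\<^sup>2 = real n - 2 * real N + (real N)\<^sup>2 / real n"
    using n by (simp add: power2_diff power_divide)
  also have "(real N)\<^sup>2 / real n \<le> real N"
    using n by (simp add: divide_le_eq mult_left_mono power2_eq_square)
  finally show "(sqrt (real n) - real N / sqrt (real n))\<^sup>2 \<le> real (n - N)"
    using assms by (simp add: of_nat_diff)
qed

section \<open>The maximum over codes and the choice of parameters\<close>

context eh_channel
begin

text \<open>One message sent by permanent silence. It makes the set of code sizes non-empty and the
  logarithm of the maximum non-negative.\<close>

lemma eh_code_one: "eh_code \<Omega> E W \<Lambda> n \<epsilon> 1"
proof (rule eh_code_disjoint[OF prob_space_axioms, where c = "\<lambda>_ _. x\<^sub>0" and D = "\<lambda>_. UNIV" and x\<^sub>0 = x\<^sub>0])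
  have "AE \<omega> in \<Omega>. \<forall>i\<in>{1..n}. 0 \<le> E i \<omega>"
    by (intro AE_finite_allI harvest_nonneg) auto
  then have "AE \<omega> in \<Omega>. \<not> (\<exists>k\<in>{1..n}. (\<Sum>i=1..k. E i \<omega>) < (\<Sum>i=1..k. \<Lambda> x\<^sub>0))"
    by (rule AE_mp) (auto simp: zero_energy not_less intro!: AE_I2 sum_nonneg)
  then have "outage_prob \<Omega> E \<Lambda> n (\<lambda>_. x\<^sub>0) = 0"
    unfolding outage_prob_def by (rule prob_eq_0_AE)
  then show "outage_prob \<Omega> E \<Lambda> n (\<lambda>_. x\<^sub>0) + measure_pmf.prob (channel_output W n (\<lambda>_. x\<^sub>0)) (- UNIV) \<le> \<epsilon>"
    using eps by simp
qed (auto simp: zero_energy disjoint_family_on_def)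

lemma finite_eh_codes:
  assumes "1 \<le> n"
  shows "finite {M. eh_code \<Omega> E W \<Lambda> n \<epsilon> M}"
proof -
  obtain L where "\<And>M. eh_code \<Omega> E W \<Lambda> n \<epsilon> M \<Longrightarrow>
    real M \<le> 2 / (1 - \<epsilon>) * b powr (real n * capacity_cost b W \<Lambda> avgE + L * sqrt (real n))"
    using converse assms by metis
  then have "{M. eh_code \<Omega> E W \<Lambda> n \<epsilon> M}
      \<subseteq> {..nat \<lceil>2 / (1 - \<epsilon>) * b powr (real n * capacity_cost b W \<Lambda> avgE + L * sqrt (real n))\<rceil>}"
    by (force simp: le_nat_iff le_ceiling_iff)
  then show ?thesis by (rule finite_subset) simp
qed

lemma max_messages_ge: "1 \<le> n \<Longrightarrow> eh_code \<Omega> E W \<Lambda> n \<epsilon> M \<Longrightarrow> M \<le> max_messages \<Omega> E W \<Lambda> n \<epsilon>"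
  unfolding max_messages_def by (intro Max_ge finite_eh_codes) auto

lemma max_messages_code: "1 \<le> n \<Longrightarrow> eh_code \<Omega> E W \<Lambda> n \<epsilon> (max_messages \<Omega> E W \<Lambda> n \<epsilon>)"
  using Max_in[OF finite_eh_codes, of n] eh_code_one[of n] unfolding max_messages_def by blast

lemma log_max_messages_le:
  obtains L where "\<And>n. 1 \<le> n \<Longrightarrow> log b (real (max_messages \<Omega> E W \<Lambda> n \<epsilon>))
    \<le> real n * capacity_cost b W \<Lambda> avgE + L * sqrt (real n) + log b (2 / (1 - \<epsilon>))"
proof -
  obtain L where L: "\<And>n M. 1 \<le> n \<Longrightarrow> eh_code \<Omega> E W \<Lambda> n \<epsilon> M \<Longrightarrow>
    real M \<le> 2 / (1 - \<epsilon>) * b powr (real n * capacity_cost b W \<Lambda> avgE + L * sqrt (real n))"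
    using converse by metis
  show ?thesis
  proof (rule that[of L])
    fix n :: nat assume n: "1 \<le> n"
    let ?M = "real (max_messages \<Omega> E W \<Lambda> n \<epsilon>)" and ?s = "real n * capacity_cost b W \<Lambda> avgE + L * sqrt (real n)"
    have "1 \<le> ?M" using max_messages_ge[OF n eh_code_one] by simp
    then have "log b ?M \<le> log b (2 / (1 - \<epsilon>) * b powr ?s)"
      using L[OF n max_messages_code[OF n]] base by (intro log_mono) auto
    also have "\<dots> = log b (2 / (1 - \<epsilon>)) + ?s"
      by (subst log_mult) (use base eps in auto)
    finally show "log b ?M \<le> ?s + log b (2 / (1 - \<epsilon>))" by simp
  qed
qed

text \<open>Feinstein's construction with threshold \<open>b powr s\<close> and slack \<eta> yields
  \<open>b powr s * \<eta>\<close> messages, rounded down. Rounding costs at most a factor 2 if this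
  number is at least 1, whence \<open>\<eta> / 2\<close>; otherwise the bound is non-positive and
  one message suffices.\<close>

lemma log_max_messages_ge:
  assumes P: "measure_pmf.expectation P \<Lambda> \<le> avgE" and N: "1 \<le> N" "N \<le> n" and \<eta>: "0 < \<eta>"
    and err: "16 * varE / (real N * avgE\<^sup>2) +
      real n * (varE + measure_pmf.variance P \<Lambda>) / (3 / 4 * real N * avgE)\<^sup>2 +
      measure_pmf.prob (Pi_pmf {..<n-N} 0 (\<lambda>_. info_law b W P)) {\<tau>. (\<Sum>i<n-N. \<tau> i) \<le> s} \<le> \<epsilon> - \<eta>"
  shows "s + log b (\<eta> / 2) \<le> log b (real (max_messages \<Omega> E W \<Lambda> n \<epsilon>))"
proof -
  define M where "M = nat \<lfloor>b powr s * \<eta>\<rfloor>"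
  have n: "1 \<le> n" using N by simp
  have pos: "0 < b powr s * \<eta>" using base \<eta> by simp
  have eq: "s + log b (\<eta> / 2) = log b (b powr s * \<eta> / 2)"
    using base \<eta> by (simp add: log_mult log_divide)
  show ?thesis
  proof (cases "1 \<le> b powr s * \<eta>")
    case False
    have "1 \<le> max_messages \<Omega> E W \<Lambda> n \<epsilon>" using max_messages_ge[OF n eh_code_one] .
    moreover have "log b (b powr s * \<eta> / 2) \<le> 0" using False base pos by simp
    ultimately show ?thesis using base by (simp add: eq order_trans[OF _ zero_le_log_cancel_iff[THEN iffD2]])
  next
    case True
    then have M1: "1 \<le> M" by (simp add: M_def le_nat_iff le_floor_iff)
    let ?p = "delayed_input n N x\<^sub>0 P" and ?K = "channel_output W n"
    let ?B = "\<lambda>x. {y. b powr s * pmf (bind_pmf ?p ?K) y < pmf (?K x) y}"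
    have fin: "finite (set_pmf ?p)" by (rule finite_set_delayed_input)
    have "measure_pmf.expectation ?p (\<lambda>x. outage_prob \<Omega> E \<Lambda> n x + measure_pmf.prob (?K x) (- ?B x))
        = measure_pmf.expectation ?p (outage_prob \<Omega> E \<Lambda> n)
          + measure_pmf.expectation ?p (\<lambda>x. measure_pmf.prob (?K x) (- ?B x))"
      by (intro Bochner_Integration.integral_add integrable_measure_pmf_finite fin)
    also have "\<dots> \<le> \<epsilon> - \<eta>"
      using expected_outage[OF P N] expected_unlikely_output[OF base, of n N x\<^sub>0 P W s] err by linarith
    finally have avg: "measure_pmf.expectation ?p (\<lambda>x. outage_prob \<Omega> E \<Lambda> n x + measure_pmf.prob (?K x) (- ?B x)) \<le> \<epsilon> - \<eta>" .
    have finK: "finite (set_pmf (?K x))" for x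
      unfolding channel_output_def by (rule finite_set_Pi_pmf) auto
    have "real M \<le> b powr s * (\<epsilon> - (\<epsilon> - \<eta>))" using pos by (simp add: M_def)
    from feinstein[OF fin finK _ avg this] base obtain c D where disj: "disjoint_family_on D {1..M}"
      and cD: "\<forall>m\<in>{1..M}. D m \<subseteq> ?B (c m) \<and> outage_prob \<Omega> E \<Lambda> n (c m) + measure_pmf.prob (?K (c m)) (- D m) \<le> \<epsilon>"
      by auto
    have "eh_code \<Omega> E W \<Lambda> n \<epsilon> M"
      by (rule eh_code_disjoint[where \<Lambda> = \<Lambda> and x\<^sub>0 = x\<^sub>0, OF prob_space_axioms _ zero_energy M1 disj]) (use cD in auto)
    from max_messages_ge[OF n this] have le: "real M \<le> real (max_messages \<Omega> E W \<Lambda> n \<epsilon>)" by simp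
    have "b powr s * \<eta> / 2 \<le> real M" using M1 by (simp add: M_def) linarith
    then have "log b (b powr s * \<eta> / 2) \<le> log b (real (max_messages \<Omega> E W \<Lambda> n \<epsilon>))"
      using le base pos by (intro log_mono) auto
    then show ?thesis by (simp add: eq)
  qed
qed

text \<open>Silence for \<open>N\<close>, about \<open>\<kappa> * sqrt n\<close>, slots forfeits
  \<open>N * I\<close> of rate, which is the negative term of order \<open>sqrt n\<close>. Replacing
  \<open>n\<close> by \<open>n - N\<close> in the normal term changes it by a constant only.\<close>

lemma achievability:
  assumes P: "P \<in> feasible_inputs \<Lambda> avgE" and l: "0 < l" "l < 1"
  obtains c where "\<forall>\<^sub>F n in sequentially. real n * mutual_info b W P
      - sqrt (real n) * saving_const \<Omega> (E 1) \<Lambda> P \<epsilon> l * mutual_info b W P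
      + sqrt (real n * info_variance b W P) * Phi_inv (l * \<epsilon>) - 1 / 2 * log b (real n) + c
    \<le> log b (real (max_messages \<Omega> E W \<Lambda> n \<epsilon>))"
proof -
  define I where "I = mutual_info b W P"
  define V where "V = info_variance b W P"
  define z where "z = Phi_inv (l * \<epsilon>)"
  define \<kappa> where "\<kappa> = saving_const \<Omega> (E 1) \<Lambda> P \<epsilon> l"
  define v where "v = varE + measure_pmf.variance P \<Lambda>"
  define \<delta> where "\<delta> = (1 - l) * \<epsilon>"
  \<comment> \<open>The extra slot guarantees \<open>1 \<le> N n\<close> even if \<kappa> = 0, that
    is, if harvest and cost have no variance.\<close>
  define N where "N n = nat \<lceil>\<kappa> * sqrt (real n)\<rceil> + 1" for n
  define s where "s n = real (n - N n) * I + sqrt (real (n - N n) * V) * z - 1" for n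
  have I0: "0 \<le> I" unfolding I_def by (rule mutual_info_nonneg[OF base])
  have V0: "0 \<le> V" unfolding V_def by (rule info_variance_nonneg)
  have v0: "0 \<le> v" using varE_nonneg measure_pmf.variance_positive[of P \<Lambda>] by (simp add: v_def)
  have \<delta>0: "0 < \<delta>" using l eps by (simp add: \<delta>_def)
  have a0: "0 < avgE" using harvest_pos by (simp add: avgE_def)
  have \<kappa>: "\<kappa> = 2 * sqrt v / (avgE * sqrt \<delta>)"
    using delta_variance_eq[OF prob_space_axioms E_integrable[of 1], of \<Lambda> P] E_variance[of 1]
    by (simp add: \<kappa>_def saving_const_def v_def \<delta>_def avgE_def)
  have \<kappa>0: "0 \<le> \<kappa>" unfolding \<kappa> using v0 a0 \<delta>0 by simp
  have N_ge: "\<kappa> * sqrt (real n) \<le> real (N n)" for n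
    unfolding N_def by linarith
  have N_le: "real (N n) \<le> \<kappa> * sqrt (real n) + 2" for n
  proof -
    have "0 \<le> \<kappa> * sqrt (real n)" using \<kappa>0 by simp
    then show ?thesis unfolding N_def by linarith
  qed
  \<comment> \<open>At most half of the block is silent from some \<open>n\<close> on, so
    \<open>n - N n\<close> tends to infinity and the normal limit can be applied along it.\<close>
  have N_half: "\<forall>\<^sub>F n in sequentially. 2 * N n \<le> n"
    using eventually_sqrt_ge[of "2 * \<kappa> + 4"]
  proof eventually_elim
    case (elim n)
    have "2 * real (N n) \<le> 2 * \<kappa> * sqrt (real n) + 4 * 1" using N_le[of n] by simp
    also have "\<dots> \<le> 2 * \<kappa> * sqrt (real n) + 4 * sqrt (real n)"
      using elim \<kappa>0 by linarith
    also have "\<dots> = (2 * \<kappa> + 4) * sqrt (real n)" by (simp add: algebra_simps)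
    also have "\<dots> \<le> sqrt (real n) * sqrt (real n)" using elim by (intro mult_right_mono) auto
    finally show ?case by simp
  qed
  have lim: "filterlim (\<lambda>n. n - N n) sequentially sequentially"
    unfolding filterlim_at_top
  proof
    fix Z :: nat
    show "\<forall>\<^sub>F n in sequentially. Z \<le> n - N n"
      using N_half eventually_ge_at_top[of "2 * Z"] by eventually_elim linarith
  qed
  have Phi: "Phi z = l * \<epsilon>"
    unfolding z_def using l eps mult_strict_mono[of l 1 \<epsilon> 1] by (intro Phi_Phi_inv) auto
  have decode: "\<forall>\<^sub>F n in sequentially. measure_pmf.prob (Pi_pmf {..<n - N n} 0 (\<lambda>_. info_law b W P))
      {\<tau>. (\<Sum>i<n - N n. \<tau> i) \<le> s n} \<le> l * \<epsilon> + \<delta> / 9"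
    using eventually_compose_filterlim[OF iid_sum_lower_tail[OF finite_set_info_law info_law_mean info_law_variance,
        of "\<delta> / 9" b W P z] lim] \<delta>0
    by (simp add: s_def I_def V_def Phi)
  \<comment> \<open>With variance present, \<open>N n\<close> grows like \<open>sqrt n\<close> and
    the bound tends to 0; without any, \<kappa> and hence the growth of \<open>N n\<close> vanish,
    but so does \<open>varE\<close>.\<close>
  have saved: "\<forall>\<^sub>F n in sequentially. 16 * varE / (real (N n) * avgE\<^sup>2) \<le> \<delta> / 9"
  proof (cases "v = 0")
    case True
    then have "varE = 0" using varE_nonneg measure_pmf.variance_positive[of P \<Lambda>] unfolding v_def by linarith
    then show ?thesis using \<delta>0 by simp
  next
    case False
    then have \<kappa>1: "0 < \<kappa>" unfolding \<kappa> using v0 a0 \<delta>0 by simp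
    show ?thesis
      using eventually_sqrt_ge[of "144 * varE / (avgE\<^sup>2 * \<delta>) / \<kappa>"]
    proof eventually_elim
      case (elim n)
      have "144 * varE / (avgE\<^sup>2 * \<delta>) \<le> \<kappa> * sqrt (real n)"
        using iffD1[OF pos_divide_le_eq[OF \<kappa>1] elim] by (simp only: mult.commute)
      also have "\<dots> \<le> real (N n)" by (rule N_ge)
      finally have "144 * varE \<le> real (N n) * (avgE\<^sup>2 * \<delta>)" using a0 \<delta>0 by (simp add: pos_divide_le_eq)
      moreover have "0 < real (N n) * avgE\<^sup>2" using a0 by (simp add: N_def)
      ultimately show ?case by (simp add: pos_divide_le_eq algebra_simps)
    qed
  qed
  \<comment> \<open>By choice of \<kappa>, \<open>(N n * avgE)\<^sup>2 * \<delta>\<close> is at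
    least \<open>4 * n * v\<close>; dividing by the square of 3/4 gives 16/9 times 1/4.\<close>
  have drift: "real n * v / (3 / 4 * real (N n) * avgE)\<^sup>2 \<le> 4 / 9 * \<delta>" for n
  proof -
    have "(\<kappa> * sqrt (real n))\<^sup>2 * avgE\<^sup>2 * \<delta> = 4 * (real n * v)"
      unfolding \<kappa> using a0 \<delta>0 v0 by (simp add: power_mult_distrib power_divide field_simps)
    moreover have "(\<kappa> * sqrt (real n))\<^sup>2 * avgE\<^sup>2 * \<delta> \<le> (real (N n))\<^sup>2 * avgE\<^sup>2 * \<delta>"
      using N_ge[of n] \<kappa>0 \<delta>0 by (intro mult_right_mono power_mono) auto
    ultimately have "4 * (real n * v) \<le> (real (N n))\<^sup>2 * avgE\<^sup>2 * \<delta>" by simp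
    moreover have "0 < (3 / 4 * real (N n) * avgE)\<^sup>2" using a0 by (simp add: N_def)
    ultimately show ?thesis by (subst pos_divide_le_eq) (auto simp: power_mult_distrib power_divide mult_ac)
  qed
  \<comment> \<open>The terms come from rounding \<open>N n\<close> (at most 2 extra slots), from
    the change of the square root, from the shift in \<open>s\<close>, and from the slack
    \<open>\<delta> / 3\<close> divided by 2.\<close>
  define c where "c = - 2 * I - sqrt V * \<bar>z\<bar> * (\<kappa> + 2) - 1 + log b (\<delta> / 6)"
  have "\<forall>\<^sub>F n in sequentially. real n * I - sqrt (real n) * \<kappa> * I + sqrt (real n * V) * z
      - 1 / 2 * log b (real n) + c \<le> log b (real (max_messages \<Omega> E W \<Lambda> n \<epsilon>))"
    using decode saved N_half eventually_ge_at_top[of 1]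
  proof eventually_elim
    case (elim n)
    have N: "1 \<le> N n" "N n \<le> n" using elim(3) by (auto simp: N_def)
    have "s n + log b (\<delta> / 3 / 2) \<le> log b (real (max_messages \<Omega> E W \<Lambda> n \<epsilon>))"
    proof (rule log_max_messages_ge[OF _ N])
      show "measure_pmf.expectation P \<Lambda> \<le> avgE" using P by (simp add: feasible_inputs_def)
      show "0 < \<delta> / 3" using \<delta>0 by simp
      have "\<delta> = \<epsilon> - l * \<epsilon>" by (simp add: \<delta>_def algebra_simps)
      then have "\<epsilon> - \<delta> / 3 = \<delta> / 9 + 4 / 9 * \<delta> + (l * \<epsilon> + \<delta> / 9)" by linarith
      then show "16 * varE / (real (N n) * avgE\<^sup>2) +
          real n * (varE + measure_pmf.variance P \<Lambda>) / (3 / 4 * real (N n) * avgE)\<^sup>2 +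
          measure_pmf.prob (Pi_pmf {..<n - N n} 0 (\<lambda>_. info_law b W P)) {\<tau>. (\<Sum>i<n - N n. \<tau> i) \<le> s n}
          \<le> \<epsilon> - \<delta> / 3"
        using elim(1,2) drift[of n] unfolding v_def by linarith
    qed
    moreover have "real n * I - sqrt (real n) * \<kappa> * I - 2 * I \<le> real (n - N n) * I"
    proof -
      have "real n - sqrt (real n) * \<kappa> - 2 \<le> real (n - N n)"
        using N_le[of n] N by (simp add: of_nat_diff mult.commute)
      from mult_right_mono[OF this I0] show ?thesis by (simp add: algebra_simps)
    qed
    moreover have "sqrt (real n * V) * z - sqrt V * \<bar>z\<bar> * (\<kappa> + 2) \<le> sqrt (real (n - N n) * V) * z"
    proof -
      have "real (N n) / sqrt (real n) \<le> (\<kappa> * sqrt (real n) + 2) / sqrt (real n)"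
        using N_le by (intro divide_right_mono) auto
      also have "\<dots> = \<kappa> + 2 / sqrt (real n)" using elim(4) by (simp add: field_simps)
      also have "\<dots> \<le> \<kappa> + 2" using elim(4) by (simp add: divide_le_eq)
      finally have "sqrt (real n) - sqrt (real (n - N n)) \<le> \<kappa> + 2"
        using sqrt_diff_ge[OF elim(4) N(2)] by linarith
      moreover have "0 \<le> sqrt (real n) - sqrt (real (n - N n))" by simp
      ultimately have "(sqrt (real n) - sqrt (real (n - N n))) * z \<le> (\<kappa> + 2) * \<bar>z\<bar>"
        by (intro order_trans[OF mult_left_mono[OF abs_ge_self] mult_right_mono]) auto
      from mult_left_mono[OF this, of "sqrt V"] V0 show ?thesis
        by (simp add: real_sqrt_mult algebra_simps)
    qed
    \<comment> \<open>The logarithmic term of the claim is a concession: the bound obtained so far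
      has only a constant remainder.\<close>
    moreover have "0 \<le> 1 / 2 * log b (real n)" using elim(4) base by simp
    ultimately show ?case by (simp add: s_def c_def)
  qed
  then show ?thesis by (intro that[of c]) (simp add: I_def V_def \<kappa>_def z_def)
qed

end

theorem theorem2:
  fixes W :: "'x::finite \<Rightarrow> 'y::finite pmf" and \<Lambda> :: "'x \<Rightarrow> real" and x\<^sub>0 :: 'x
    and \<Omega> :: "'w measure" and E :: "nat \<Rightarrow> 'w \<Rightarrow> real"
    and b \<epsilon> :: real
  assumes base: "1 < b"
    and eps: "0 < \<epsilon>" "\<epsilon> < 1"
    and not_exotic: "\<not> exotic b W"
    and energy_nonneg: "\<And>x. 0 \<le> \<Lambda> x"
    and zero_energy: "\<Lambda> x\<^sub>0 = 0"
    and prob_space: "prob_space \<Omega>"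
    and indep: "prob_space.indep_vars \<Omega> (\<lambda>_. borel) E {1..}"
    and ident_distr: "\<And>i. 1 \<le> i \<Longrightarrow> distr \<Omega> borel (E i) = distr \<Omega> borel (E 1)"
    and harvest_nonneg: "\<And>i. 1 \<le> i \<Longrightarrow> AE \<omega> in \<Omega>. 0 \<le> E i \<omega>"
    and harvest_pos: "0 < prob_space.expectation \<Omega> (E 1)"
    and harvest_second_moment: "integrable \<Omega> (\<lambda>\<omega>. (E 1 \<omega>)\<^sup>2)"
  shows
    "(\<forall>P\<in>feasible_inputs \<Lambda> (prob_space.expectation \<Omega> (E 1)). \<forall>l. 0 < l \<and> l < 1 \<longrightarrow>
       (\<exists>r\<in>O(\<lambda>n. 1). \<forall>\<^sub>F n in sequentially.
          log b (real (max_messages \<Omega> E W \<Lambda> n \<epsilon>))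
            \<ge> real n * mutual_info b W P
              - sqrt (real n) * saving_const \<Omega> (E 1) \<Lambda> P \<epsilon> l * mutual_info b W P
              + sqrt (real n * info_variance b W P) * Phi_inv (l * \<epsilon>)
              - 1 / 2 * log b (real n) + r n))
     \<and>
     (\<exists>(D::real) (K::real) (V::real \<Rightarrow> real). \<forall>\<eta>>0. V \<eta> \<ge> 0 \<and>
       (\<exists>r\<in>O(\<lambda>n. log b (real n)). \<forall>\<^sub>F n in sequentially.
          log b (real (max_messages \<Omega> E W \<Lambda> n \<epsilon>))
            \<le> real n * capacity_cost b W \<Lambda> (prob_space.expectation \<Omega> (E 1))
              + sqrt (real n)
                * deriv (capacity_cost b W \<Lambda>) (prob_space.expectation \<Omega> (E 1)) * D
              + sqrt (real n * V \<eta>) * (Phi_inv \<epsilon> + K * \<epsilon> / 4)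
              + r n))"
proof -
  interpret eh_channel \<Omega> W \<Lambda> x\<^sub>0 E b \<epsilon>
    by (intro eh_channel.intro eh_channel_axioms.intro) fact+
  show ?thesis
  proof (intro conjI ballI allI impI)
    fix P and l :: real assume P: "P \<in> feasible_inputs \<Lambda> (expectation (E 1))" and l: "0 < l \<and> l < 1"
    obtain c where "\<forall>\<^sub>F n in sequentially. real n * mutual_info b W P
        - sqrt (real n) * saving_const \<Omega> (E 1) \<Lambda> P \<epsilon> l * mutual_info b W P
        + sqrt (real n * info_variance b W P) * Phi_inv (l * \<epsilon>) - 1 / 2 * log b (real n) + c
      \<le> log b (real (max_messages \<Omega> E W \<Lambda> n \<epsilon>))"
      using achievability[of P l] P l unfolding avgE_def by blast
    then show "\<exists>r\<in>O(\<lambda>n. 1). \<forall>\<^sub>F n in sequentially. real n * mutual_info b W P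
        - sqrt (real n) * saving_const \<Omega> (E 1) \<Lambda> P \<epsilon> l * mutual_info b W P
        + sqrt (real n * info_variance b W P) * Phi_inv (l * \<epsilon>) - 1 / 2 * log b (real n) + r n
      \<le> log b (real (max_messages \<Omega> E W \<Lambda> n \<epsilon>))"
      by (intro bexI[of _ "\<lambda>_. c"]) auto
  next
    obtain L where L: "\<And>n. 1 \<le> n \<Longrightarrow> log b (real (max_messages \<Omega> E W \<Lambda> n \<epsilon>))
        \<le> real n * capacity_cost b W \<Lambda> avgE + L * sqrt (real n) + log b (2 / (1 - \<epsilon>))"
      using log_max_messages_le by blast
    have "(\<lambda>n. log b (2 / (1 - \<epsilon>))) \<in> O(\<lambda>n. log b (real n))"
    proof (rule bigoI)
      show "\<forall>\<^sub>F n in sequentially. norm (log b (2 / (1 - \<epsilon>))) \<le> \<bar>log b (2 / (1 - \<epsilon>))\<bar> * norm (log b (real n))"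
      proof (rule eventually_sequentiallyI[of "nat \<lceil>b\<rceil>"])
        fix n assume "nat \<lceil>b\<rceil> \<le> n"
        then have "b \<le> real n" by linarith
        then have "1 \<le> log b (real n)" using base by (subst le_log_iff) auto
        then show "norm (log b (2 / (1 - \<epsilon>))) \<le> \<bar>log b (2 / (1 - \<epsilon>))\<bar> * norm (log b (real n))"
          using mult_left_mono[of 1 "log b (real n)" "\<bar>log b (2 / (1 - \<epsilon>))\<bar>"] by simp
      qed
    qed
    \<comment> \<open>Choice of the witnesses: with \<open>D = 0\<close> and \<open>V\<close>
      constantly 1 the coefficient of \<open>sqrt n\<close> is the last factor, and this
      \<open>K\<close> makes it equal to \<open>L\<close>. It depends on \<epsilon> and the channel
      data but not on \<open>n\<close>.\<close>
    moreover have "Phi_inv \<epsilon> + (4 * (L - Phi_inv \<epsilon>) / \<epsilon>) * \<epsilon> / 4 = L" using eps by (simp add: field_simps)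
    ultimately show "\<exists>(D::real) (K::real) (V::real \<Rightarrow> real). \<forall>\<eta>>0. V \<eta> \<ge> 0 \<and>
       (\<exists>r\<in>O(\<lambda>n. log b (real n)). \<forall>\<^sub>F n in sequentially.
          log b (real (max_messages \<Omega> E W \<Lambda> n \<epsilon>))
            \<le> real n * capacity_cost b W \<Lambda> (expectation (E 1))
              + sqrt (real n) * deriv (capacity_cost b W \<Lambda>) (expectation (E 1)) * D
              + sqrt (real n * V \<eta>) * (Phi_inv \<epsilon> + K * \<epsilon> / 4)
              + r n)"
      using L
      by (intro exI[of _ 0] exI[of _ "4 * (L - Phi_inv \<epsilon>) / \<epsilon>"] exI[of _ "\<lambda>_. 1"] allI impI conjI
          bexI[of _ "\<lambda>_. log b (2 / (1 - \<epsilon>))"] eventually_sequentiallyI[of 1])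
         (auto simp: avgE_def mult.commute)
  qed
qed

end
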